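(* Fix $\gamma>1/2$ and a fixed (independent of $N$) integer $\mathfrak{d}$, and let $a_0,a_1,\dots,a_{\mathfrak{d}}$ be deterministic complex numbers. Let $J=J_N$ be the $N\times N$ nilpotent matrix with $J_{ij}=\mathbf{1}_{j=i+1}$, let $M_N:=\sum_{i=0}^{\mathfrak{d}}a_iJ^i$, let $G_N$ be an $N\times N$ matrix with i.i.d. standard complex Gaussian entries, and let $\mathcal{M}_N:=M_N+N^{-\gamma}G_N$. Let $L_N:=N^{-1}\sum_{i=1}^N\delta_{\lambda_i}$ be the empirical measure of the eigenvalues $\lambda_1,\dots,\lambda_N$ of $\mathcal{M}_N$. Then, as $N\to\infty$, $L_N$ converges weakly in probability to the law of $\sum_{i=0}^{\mathfrak{d}}a_iU^i$, where $U$ is uniformly distributed on the unit circle in $\mathbb{C}$.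
   Context: Random probability measures $L_N$ converge weakly in probability to a deterministic probability measure $\mu$ if $\int f\,dL_N\to\int f\,d\mu$ in probability for every bounded continuous $f:\mathbb{C}\to\mathbb{R}$. *)

theory Defs
  imports "HOL-Probability.Probability" "Jordan_Normal_Form.Char_Poly"
begin

text \<open>Rows and columns are indexed from 0; this does not affect the condition \<open>j = i + 1\<close>.\<close>

definition shift_mat :: "nat \<Rightarrow> complex mat" where
  "shift_mat N = mat N N (\<lambda>(i, j). if j = i + 1 then 1 else 0)"

text \<open>\<open>\<Sum>i\<le>d. a i J^i\<close>, written entrywise since matrices of this type, whose dimensions are
  not part of the type, form no additive monoid over which one could use \<^const>\<open>sum\<close>.\<close>

definition toeplitz_mat :: "nat \<Rightarrow> (nat \<Rightarrow> complex) \<Rightarrow> nat \<Rightarrow> complex mat" where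
  "toeplitz_mat d a N = mat N N (\<lambda>(r, c). \<Sum>i\<le>d. a i * (shift_mat N ^\<^sub>m i) $$ (r, c))"

text \<open>Standard means mean 0 and \<open>E |X|^2 = 1\<close>: the real and imaginary parts are independent
  centred real Gaussians of variance 1/2.\<close>

definition std_complex_gaussian :: "'w measure \<Rightarrow> ('w \<Rightarrow> complex) \<Rightarrow> bool" where
  "std_complex_gaussian P X \<longleftrightarrow>
     distributed P lborel X (\<lambda>z. ennreal (exp (- (norm z)\<^sup>2) / pi))"

definition gaussian_matrix :: "'w measure \<Rightarrow> nat \<Rightarrow> ('w \<Rightarrow> complex mat) \<Rightarrow> bool" where
  "gaussian_matrix P N G \<longleftrightarrow>
     (\<forall>\<omega>\<in>space P. G \<omega> \<in> carrier_mat N N) \<and>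
     prob_space.indep_vars P (\<lambda>_. borel) (\<lambda>ij \<omega>. G \<omega> $$ ij) ({..<N} \<times> {..<N}) \<and>
     (\<forall>ij\<in>{..<N} \<times> {..<N}. std_complex_gaussian P (\<lambda>\<omega>. G \<omega> $$ ij))"

text \<open>The eigenvalues with algebraic multiplicity are the roots of the characteristic polynomial.
  The \<^const>\<open>distr\<close> only replaces the discrete sigma-algebra of the pmf by the Borel one.
  For the \<open>0 \<times> 0\<close> matrix the value is arbitrary.\<close>

definition empirical_eigenvalue_measure :: "complex mat \<Rightarrow> complex measure" where
  "empirical_eigenvalue_measure A =
     distr (measure_pmf (pmf_of_multiset (proots (char_poly A)))) borel (\<lambda>z. z)"

lemma measure_empirical_eigenvalue_measure:
  assumes "A \<in> carrier_mat N N" "N > 0" "S \<in> sets borel"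
  shows "measure (empirical_eigenvalue_measure A) S =
           (\<Sum>z\<in>#proots (char_poly A). indicator S z) / real N"
proof -
  define m where "m = proots (char_poly A)"
  have sz: "size m = N"
    using degree_monic_char_poly[OF assms(1)] by (simp add: m_def size_proots_complex)
  with assms(2) have ne: "m \<noteq> {#}" by auto
  have aux: "(\<Sum>z\<in>#M. f z) = (\<Sum>z\<in>set_mset M. real (count M z) * f z)"
    for M :: "complex multiset" and f
  proof -
    have "(\<Sum>z\<in>#M. f z) = (\<Sum>z\<in>set_mset M. count M z *\<^sub>R f z)"
    proof (induction M)
      case (add x M)
      show ?case
      proof (cases "x \<in># M")
        case True
        have "(\<Sum>z\<in>set_mset (add_mset x M). count (add_mset x M) z *\<^sub>R f z) =
              (\<Sum>z\<in>set_mset M. count M z *\<^sub>R f z + (if z = x then f z else 0))"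
          using True by (intro sum.cong) (auto simp: algebra_simps)
        with True add show ?thesis by (simp add: sum.distrib)
      next
        case False
        hence "(\<Sum>z\<in>set_mset M. count (add_mset x M) z *\<^sub>R f z) =
               (\<Sum>z\<in>set_mset M. count M z *\<^sub>R f z)"
          by (intro sum.cong) auto
        with False add show ?thesis by (simp add: not_in_iff)
      qed
    qed auto
    thus ?thesis by simp
  qed
  have "measure (empirical_eigenvalue_measure A) S = measure (measure_pmf (pmf_of_multiset m)) S"
    using assms(3) by (simp add: empirical_eigenvalue_measure_def measure_distr m_def)
  also have "\<dots> = measure_pmf.expectation (pmf_of_multiset m) (indicator S)"
    by simp
  also have "\<dots> = (\<Sum>z\<in>set_mset m. indicator S z * (real (count m z) / real N))"
    using ne sz by (subst integral_measure_pmf_real[where A = "set_mset m"]) auto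
  also have "\<dots> = (\<Sum>z\<in>#m. indicator S z) / real N"
    unfolding aux sum_divide_distrib by (intro sum.cong) auto
  finally show ?thesis by (simp add: m_def)
qed

text \<open>Convergence in probability to a constant. Measurability of the \<open>X n\<close> is part of the
  definition, because \<^const>\<open>measure\<close> assigns 0 to every non-measurable set. Each \<open>X n\<close> may live
  on its own probability space \<open>P n\<close>.\<close>

definition tendsto_in_prob ::
    "(nat \<Rightarrow> 'w measure) \<Rightarrow> (nat \<Rightarrow> 'w \<Rightarrow> real) \<Rightarrow> real \<Rightarrow> bool" where
  "tendsto_in_prob P X x \<longleftrightarrow>
     (\<forall>n. X n \<in> borel_measurable (P n)) \<and>
     (\<forall>\<epsilon>>0. (\<lambda>n. measure (P n) {\<omega>\<in>space (P n). \<bar>X n \<omega> - x\<bar> > \<epsilon>}) \<longlonglongrightarrow> 0)"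

definition weakly_tendsto_in_prob ::
    "(nat \<Rightarrow> 'w measure) \<Rightarrow> (nat \<Rightarrow> 'w \<Rightarrow> complex measure) \<Rightarrow> complex measure \<Rightarrow> bool" where
  "weakly_tendsto_in_prob P L \<mu> \<longleftrightarrow>
     (\<forall>f :: complex \<Rightarrow> real. continuous_on UNIV f \<and> bounded (range f) \<longrightarrow>
        tendsto_in_prob P (\<lambda>n \<omega>. \<integral>z. f z \<partial>(L n \<omega>)) (\<integral>z. f z \<partial>\<mu>))"

definition uniform_unit_circle :: "complex measure" where
  "uniform_unit_circle = distr (uniform_measure lborel {0..<2 * pi}) borel cis"

end

theory Submission
  imports Defs "HOL-Complex_Analysis.Complex_Analysis" "HOL-Real_Asymp.Real_Asymp"
    "Jordan_Normal_Form.Schur_Decomposition"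
begin

text \<open>Let \<open>p(u) = \<Sum>i\<le>d. a i u^i\<close> be the symbol, so that \<open>M_N\<close> is the upper triangular Toeplitz matrix of
\<open>p\<close>, and put \<open>\<delta> = N^(-\<gamma>)\<close>. The proof compares the noisy matrix \<open>M_N + \<delta> G\<close> with the circulant matrix
\<open>C\<close> of the same symbol. The two deterministic matrices agree except in the last \<open>d\<close> rows; \<open>C\<close> is
normal and its eigenvalues are the nodes \<open>p(\<omega>^r)\<close>, where \<open>\<omega> = exp(2 \<pi> i / N)\<close> and \<open>r < N\<close>. By
Riemann sums the nodes equidistribute towards the law of \<open>p(U)\<close>. It remains to show that the
eigenvalues of the noisy matrix and the nodes have asymptotically the same empirical measure, and
for this it suffices that the logarithms of \<open>|det (M_N - z + \<delta> G)|\<close> and of \<open>|det (C - z)|\<close> differ by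
\<open>o(N)\<close> in mean, after integration over bounded sets of \<open>z\<close>.

The upper bound is the Hadamard inequality in the Fourier basis (\<open>norm_fdet_le_fourier\<close>). If \<open>F\<close> is
the matrix of the discrete Fourier transform, the columns of \<open>(C - z) F\<close> are those of \<open>F\<close> multiplied
by \<open>p(\<omega>^r) - z\<close>, and \<open>M_N - C + \<delta> G\<close> perturbs them, relative to the norm \<open>sqrt N\<close> of a column of
\<open>F\<close>, by quantities whose second moments are \<open>O(1/N + N^(1 - 2 \<gamma>))\<close>. This tends to 0 exactly because
\<open>\<gamma> > 1/2\<close>, and as \<open>ln (1 + y/|w|)\<close> is dominated by \<open>2 sqrt (y/|w|)\<close>, which is locally integrable in
the plane, the positive part of the logarithm of the ratio of the two determinants is \<open>o(N)\<close>
(\<open>det_ratio_upper\<close>).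

The lower bound uses that a determinant is affine in each of its entries. For a standard complex
Gaussian \<open>y\<close>, the mean of \<open>ln |\<alpha> + \<beta> y|\<close> is at least \<open>ln |\<alpha>|\<close>, since \<open>y\<close> is rotation invariant and
\<open>ln |.|\<close> is subharmonic (\<open>gauss_drop\<close>), and it is at least \<open>ln |\<beta>|\<close> minus a universal constant,
since the logarithmic singularity is integrable (\<open>gauss_take\<close>). Integrating out the entries of \<open>G\<close>
one at a time, the mean of \<open>ln |det (M_N - z + \<delta> G)|\<close> is therefore bounded below by the logarithm of
any coefficient of the determinant, seen as a polynomial in the entries of \<open>G\<close>, minus a constant for
every entry in the monomial (\<open>gauss_matrix_lower\<close>). Expanding \<open>det (C - z)\<close> along its last \<open>d\<close> rows
shows that some monomial with one entry in each of these rows has a coefficient of modulus at least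
\<open>(\<delta> / K)^d |det (C - z)|\<close> with a bounded \<open>K\<close> (\<open>prod_nodes_le_minor\<close>). The loss is \<open>O(ln N)\<close>.

A random variable whose positive part has small mean and whose mean is not very negative is small in
\<open>L^1\<close> (\<open>abs_ln_le_of_lower_bounds\<close>). Hence the log-determinants are close in \<open>L^1\<close>, which transfers
to \<open>\<Sum> f(\<lambda>)\<close> for every \<open>f\<close> of the form \<open>f(\<lambda>) = \<integral> h(z) ln |z - \<lambda>| dz\<close> with bounded \<open>h\<close> of bounded
support. These functions approximate every continuous \<open>f\<close> of compact support uniformly
(\<open>uniform_approx_by_pot\<close>): averaging \<open>ln |.|\<close> over a circle of radius \<open>r\<close> truncates it to \<open>ln
max(|.|, r)\<close>, and the difference of two truncations is a compactly supported bump, which serves as a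
mollifier. Since the nodes stay in a fixed disc, testing against a cutoff function excludes that
mass escapes to infinity, and this covers all bounded continuous \<open>f\<close>.\<close>

section \<open>The mean of the logarithm over the unit circle\<close>

lemma cis_measurable [measurable]: "cis \<in> borel_measurable borel"
  by (auto intro!: borel_measurable_continuous_onI continuous_intros)

lemma prob_space_uniform_unit_circle: "prob_space uniform_unit_circle"
proof -
  interpret prob_space "uniform_measure lborel {0..<2 * pi}"
    by (rule prob_space_uniform_measure) (auto simp: ennreal_eq_0_iff not_le)
  show ?thesis
    unfolding uniform_unit_circle_def by (rule prob_space_distr) simp
qed

lemma sets_uniform_unit_circle [simp, measurable_cong]: "sets uniform_unit_circle = sets borel"
  by (simp add: uniform_unit_circle_def)

lemma space_uniform_unit_circle [simp]: "space uniform_unit_circle = UNIV"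
  by (simp add: uniform_unit_circle_def)

lemma AE_uniform_unit_circle: "AE u in uniform_unit_circle. norm u = 1"
  unfolding uniform_unit_circle_def by (subst AE_distr_iff) auto

lemma integral_uniform_unit_circle:
  fixes f :: "complex \<Rightarrow> real"
  assumes [measurable]: "f \<in> borel_measurable borel"
  shows "(\<integral>u. f u \<partial>uniform_unit_circle) = (LINT x:{0..<2*pi}|lborel. f (cis x)) / (2 * pi)"
proof -
  have "(\<integral>u. f u \<partial>uniform_unit_circle) = (\<integral>x. f (cis x) \<partial>uniform_measure lborel {0..<2 * pi})"
    unfolding uniform_unit_circle_def by (subst integral_distr) auto
  also have "uniform_measure lborel {0..<2 * pi}
      = density lborel (\<lambda>x. ennreal (indicator {0..<2*pi} x / (2*pi)))"
    unfolding uniform_measure_def by (intro density_cong)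
      (auto simp: divide_ennreal[symmetric] split: split_indicator)
  also have "(\<integral>x. f (cis x) \<partial>\<dots>) = (\<integral>x. (indicator {0..<2*pi} x / (2*pi)) *\<^sub>R f (cis x) \<partial>lborel)"
    by (subst integral_density) auto
  also have "\<dots> = (\<integral>x. (indicator {0..<2*pi} x *\<^sub>R f (cis x)) / (2*pi) \<partial>lborel)"
    by simp
  finally show ?thesis by (simp add: set_lebesgue_integral_def)
qed

lemma integral_uniform_unit_circle_continuous:
  fixes f :: "complex \<Rightarrow> real"
  assumes [measurable]: "f \<in> borel_measurable borel" and cont: "continuous_on (sphere 0 1) f"
  shows "(\<integral>u. f u \<partial>uniform_unit_circle) = integral {0..2*pi} (\<lambda>x. f (cis x)) / (2 * pi)"
    and "integrable uniform_unit_circle f"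
proof -
  have c: "continuous_on {0..2*pi} (\<lambda>x. f (cis x))"
    by (intro continuous_on_compose2[OF cont] continuous_intros) auto
  have si: "set_integrable lborel {0..2*pi} (\<lambda>x. f (cis x))"
    using c by (rule borel_integrable_atLeastAtMost')
  have "(LINT x:{0..<2*pi}|lborel. f (cis x)) = (LINT x:{0..2*pi}|lborel. f (cis x))"
    unfolding set_lebesgue_integral_def
    by (intro integral_cong_AE) (use AE_lborel_singleton[of "2*pi"] in \<open>auto elim!: eventually_mono
        split: split_indicator\<close>)
  also have "\<dots> = integral {0..2*pi} (\<lambda>x. f (cis x))"
    using set_borel_integral_eq_integral(2)[OF si] .
  finally show "(\<integral>u. f u \<partial>uniform_unit_circle) = integral {0..2*pi} (\<lambda>x. f (cis x)) / (2 * pi)"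
    by (simp add: integral_uniform_unit_circle)
  interpret prob_space uniform_unit_circle by (rule prob_space_uniform_unit_circle)
  have "bounded (f ` sphere 0 1)"
    by (intro compact_imp_bounded compact_continuous_image cont) auto
  then obtain B where B: "\<forall>y\<in>f ` sphere 0 1. norm y \<le> B"
    unfolding bounded_iff by blast
  then show "integrable uniform_unit_circle f"
    by (intro integrable_const_bound[where B = B]) (use B AE_uniform_unit_circle in \<open>auto elim!:
        eventually_mono\<close>)
qed

text \<open>A holomorphic function without zeros in the closed disc has a logarithm there, whose real part has
the mean value property.\<close>

lemma circle_mean_ln:
  fixes \<alpha> \<beta> :: complex
  assumes "norm \<beta> < norm \<alpha>"
  shows "(\<integral>u. ln (norm (\<alpha> + \<beta> * u)) \<partial>uniform_unit_circle) = ln (norm \<alpha>)"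
    and "integrable uniform_unit_circle (\<lambda>u. ln (norm (\<alpha> + \<beta> * u)))"
proof -
  define \<zeta> where "\<zeta> = \<beta> / \<alpha>"
  have \<alpha>0: "\<alpha> \<noteq> 0" using assms by auto
  have z1: "norm \<zeta> < 1" using assms \<alpha>0 by (simp add: \<zeta>_def norm_divide)
  have fac: "\<alpha> + \<beta> * u = \<alpha> * (1 + \<zeta> * u)" for u
    using \<alpha>0 by (simp add: \<zeta>_def field_simps)
  have lt: "norm (\<zeta> * u) < 1" if "norm u \<le> 1" for u
    using z1 that mult_left_le[of "norm u" "norm \<zeta>"] by (simp add: norm_mult)
  have nonneg: "1 + \<zeta> * u \<notin> \<real>\<^sub>\<le>\<^sub>0" if "norm u \<le> 1" for u
  proof
    assume "1 + \<zeta> * u \<in> \<real>\<^sub>\<le>\<^sub>0"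
    then have "Re (1 + \<zeta> * u) \<le> 0" by (auto simp: complex_nonpos_Reals_iff)
    moreover have "\<bar>Re (\<zeta> * u)\<bar> \<le> norm (\<zeta> * u)" by (rule abs_Re_le_cmod)
    ultimately show False using lt[OF that] by simp
  qed
  have nz: "1 + \<zeta> * u \<noteq> 0" if "norm u \<le> 1" for u
    using nonneg[OF that] by auto
  have "(\<lambda>u. Ln (1 + \<zeta> * u)) holomorphic_on cball 0 1"
    using nonneg by (intro holomorphic_intros) auto
  from Cauchy_integral_circlepath_simple[OF this, of 0]
  have "((\<lambda>u. Ln (1 + \<zeta> * u) / u) has_contour_integral 0) (part_circlepath 0 1 0 (2*pi))"
    by (simp add: circlepath_def)
  then have "((\<lambda>t. Ln (1 + \<zeta> * cis t) / cis t * \<i> * cis t) has_integral 0) {0..2*pi}"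
    by (subst (asm) has_contour_integral_part_circlepath_iff) auto
  then have "((\<lambda>t. Ln (1 + \<zeta> * cis t) * \<i>) has_integral 0) {0..2*pi}"
    by (simp add: field_simps)
  from has_integral_linear[OF this bounded_linear_Im]
  have hi: "((\<lambda>t. ln (norm (1 + \<zeta> * cis t))) has_integral 0) {0..2*pi}"
    using nz by (simp add: o_def)
  have cont: "continuous_on (sphere 0 1) (\<lambda>u. ln (norm (1 + \<zeta> * u)))"
    using nz by (intro continuous_intros) auto
  note I = integral_uniform_unit_circle_continuous[OF _ cont]
  have eq: "AE u in uniform_unit_circle. ln (norm \<alpha>) + ln (norm (1 + \<zeta> * u)) = ln (norm (\<alpha> + \<beta> * u))"
    using AE_uniform_unit_circle
    by eventually_elim (use nz \<alpha>0 in \<open>auto simp: fac norm_mult ln_mult\<close>)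
  interpret prob_space uniform_unit_circle by (rule prob_space_uniform_unit_circle)
  have p1: "measure uniform_unit_circle UNIV = 1" using prob_space by simp
  have int: "integrable uniform_unit_circle (\<lambda>u. ln (norm \<alpha>) + ln (norm (1 + \<zeta> * u)))"
    using I(2) by auto
  have "integrable uniform_unit_circle (\<lambda>u. ln (norm \<alpha>) + ln (norm (1 + \<zeta> * u)))
      \<longleftrightarrow> integrable uniform_unit_circle (\<lambda>u. ln (norm (\<alpha> + \<beta> * u)))"
    by (intro integrable_cong_AE eq) auto
  with int show "integrable uniform_unit_circle (\<lambda>u. ln (norm (\<alpha> + \<beta> * u)))" by simp
  have "(\<integral>u. ln (norm (\<alpha> + \<beta> * u)) \<partial>uniform_unit_circle)
      = (\<integral>u. ln (norm \<alpha>) + ln (norm (1 + \<zeta> * u)) \<partial>uniform_unit_circle)"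
    by (rule integral_cong_AE[symmetric, OF _ _ eq]) auto
  also have "\<dots> = ln (norm \<alpha>) + (\<integral>u. ln (norm (1 + \<zeta> * u)) \<partial>uniform_unit_circle)"
    using I(2) p1 by (subst Bochner_Integration.integral_add) auto
  also have "(\<integral>u. ln (norm (1 + \<zeta> * u)) \<partial>uniform_unit_circle) = 0"
    using I(1) integral_unique[OF hi] by simp
  finally show "(\<integral>u. ln (norm (\<alpha> + \<beta> * u)) \<partial>uniform_unit_circle) = ln (norm \<alpha>)" by simp
qed

text \<open>For \<open>norm w < r\<close> the roles of \<open>w\<close> and \<open>r\<close> are exchanged by factoring the unimodular \<open>u\<close> out of \<open>w +
r u\<close>.\<close>

lemma circle_mean_ln_max:
  fixes w :: complex
  assumes "norm w \<noteq> r" "r > 0"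
  shows "(\<integral>u. ln (norm (w + of_real r * u)) \<partial>uniform_unit_circle) = ln (max (norm w) r)"
proof (cases "r < norm w")
  case True
  then show ?thesis using circle_mean_ln(1)[of "of_real r" w] assms by simp
next
  case False
  then have lt: "norm (cnj w) < norm (complex_of_real r)" using assms by simp
  have "(\<integral>u. ln (norm (w + of_real r * u)) \<partial>uniform_unit_circle)
      = (\<integral>u. ln (norm (of_real r + cnj w * u)) \<partial>uniform_unit_circle)"
  proof (intro integral_cong_AE)
    show "AE u in uniform_unit_circle. ln (norm (w + of_real r * u))
        = ln (norm (of_real r + cnj w * u))"
      using AE_uniform_unit_circle
    proof eventually_elim
      case (elim u)
      then have "u * cnj u = 1" by (simp add: complex_norm_square[symmetric])
      then have "w + of_real r * u = u * cnj (of_real r + cnj w * u)"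
        by (simp add: algebra_simps)
      then show ?case using elim by (simp add: norm_mult del: complex_cnj_add complex_cnj_mult)
    qed
  qed auto
  also have "\<dots> = ln r" using circle_mean_ln(1)[OF lt] assms by simp
  finally show ?thesis using False by (simp add: max_def)
qed

text \<open>Subharmonicity of \<open>ln (1 + t |z|\<^sup>2)\<close>. On the circle, \<open>1 + t |\<alpha> + \<beta> u|\<^sup>2\<close> is again the squared
modulus of an affine function \<open>c + e \<phi> u\<close>, this time with \<open>e < c\<close>, so its logarithm has mean exactly
\<open>2 ln c\<close>, and \<open>c\<^sup>2\<close> exceeds \<open>1 + t |\<alpha>|\<^sup>2\<close>. The summand 1 keeps the logarithm nonnegative, so that it
can be handled by \<open>nn_integral\<close> even where the determinants considered later vanish.\<close>

lemma ln_one_plus_le_circle_mean: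
  fixes \<alpha> \<beta> :: complex
  assumes t: "t \<ge> 0"
  shows "ennreal (ln (1 + t * (norm \<alpha>)\<^sup>2)) \<le> (\<integral>\<^sup>+u. ennreal (ln (1 + t * (norm (\<alpha> + \<beta> * u))\<^sup>2))
      \<partial>uniform_unit_circle)"
proof -
  define A B where "A = sqrt t * norm \<alpha>" and "B = sqrt t * norm \<beta>"
  have AB: "A \<ge> 0" "B \<ge> 0" using t by (auto simp: A_def B_def)
  \<comment> \<open>\<open>c\<close> and \<open>e\<close> solve \<open>c\<^sup>2 + e\<^sup>2 = 1 + A\<^sup>2 + B\<^sup>2\<close> and \<open>c e = A B\<close>\<close>
  define c where "c = (sqrt (1 + (A + B)\<^sup>2) + sqrt (1 + (A - B)\<^sup>2)) / 2"
  define e where "e = (sqrt (1 + (A + B)\<^sup>2) - sqrt (1 + (A - B)\<^sup>2)) / 2"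
  have sq: "(sqrt (1 + x\<^sup>2))\<^sup>2 = 1 + x\<^sup>2" for x :: real by simp
  have pq: "((p + q) / 2)\<^sup>2 + ((p - q) / 2)\<^sup>2 = (p\<^sup>2 + q\<^sup>2) / 2" "2 * ((p + q) / 2) * ((p - q) / 2)
      = (p\<^sup>2 - q\<^sup>2) / 2"
    for p q :: real by (simp_all add: power2_eq_square field_simps)
  have c2e2: "c\<^sup>2 + e\<^sup>2 = 1 + A\<^sup>2 + B\<^sup>2" and ce: "2 * c * e = 2 * A * B"
  proof -
    have "c\<^sup>2 + e\<^sup>2 = ((sqrt (1 + (A + B)\<^sup>2))\<^sup>2 + (sqrt (1 + (A - B)\<^sup>2))\<^sup>2) / 2"
      unfolding c_def e_def by (rule pq)
    then show "c\<^sup>2 + e\<^sup>2 = 1 + A\<^sup>2 + B\<^sup>2" unfolding sq by (simp add: power2_eq_square algebra_simps)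
    have "2 * c * e = ((sqrt (1 + (A + B)\<^sup>2))\<^sup>2 - (sqrt (1 + (A - B)\<^sup>2))\<^sup>2) / 2"
      unfolding c_def e_def by (rule pq)
    then show "2 * c * e = 2 * A * B" unfolding sq by (simp add: power2_eq_square algebra_simps)
  qed
  have gt: "sqrt (1 + x\<^sup>2) > 0" for x :: real by (simp add: add_pos_nonneg)
  have e0: "e \<ge> 0" using AB by (auto simp: e_def power2_eq_square algebra_simps)
  have ec: "e < c" "c > 0" 
  proof -
    have "p > 0 \<Longrightarrow> q > 0 \<Longrightarrow> (p - q) / 2 < (p + q) / 2 \<and> 0 < (p + q) / 2" for p q :: real by simp
    then show "e < c" "c > 0" unfolding e_def c_def using gt by blast+
  qed
  have cge: "c\<^sup>2 \<ge> 1 + A\<^sup>2"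
  proof -
    have "norm (Complex 2 (2 * A)) \<le> norm (Complex 1 (A + B)) + norm (Complex 1 (A - B))"
      using norm_triangle_ineq[of "Complex 1 (A + B)" "Complex 1 (A - B)"] by (simp add: complex_add)
    then have "sqrt (4 + 4 * A\<^sup>2) \<le> 2 * c"
      by (simp add: complex_norm c_def power_mult_distrib)
    moreover have "sqrt (4 + 4 * A\<^sup>2) = 2 * sqrt (1 + A\<^sup>2)"
      using real_sqrt_mult[of 4 "1 + A\<^sup>2"] by simp
    ultimately have "sqrt (1 + A\<^sup>2) \<le> c" by simp
    then have "(sqrt (1 + A\<^sup>2))\<^sup>2 \<le> c\<^sup>2" by (intro power_mono) auto
    then show ?thesis by simp
  qed
  define \<phi> where "\<phi> = (if \<alpha> * cnj \<beta> = 0 then 1 else sgn (\<beta> * cnj \<alpha>))"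
  have n\<phi>: "norm \<phi> = 1" by (auto simp: \<phi>_def norm_sgn)
  have key: "1 + t * (norm (\<alpha> + \<beta> * u))\<^sup>2 = (norm (of_real c + of_real e * \<phi> * u))\<^sup>2" if "norm u = 1"
      for u
  proof -
    have N: "(norm (x + y))\<^sup>2 = (norm x)\<^sup>2 + (norm y)\<^sup>2 + 2 * Re (cnj x * y)" for x y :: complex
      by (simp add: cmod_power2) (simp add: power2_eq_square algebra_simps)
    have ph: "of_real (norm \<alpha> * norm \<beta>) * \<phi> = cnj \<alpha> * \<beta>"
    proof (cases "\<alpha> * cnj \<beta> = 0")
      case False
      then have "norm (\<beta> * cnj \<alpha>) \<noteq> 0" by auto
      then show ?thesis using False by (simp add: \<phi>_def sgn_eq norm_mult mult_ac)
    qed auto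
    have "1 + t * (norm (\<alpha> + \<beta> * u))\<^sup>2 = 1 + t * ((norm \<alpha>)\<^sup>2 + (norm \<beta>)\<^sup>2 + 2 * Re (cnj \<alpha> * \<beta> * u))"
      unfolding N by (simp add: norm_mult that mult.assoc)
    also have "\<dots> = 1 + A\<^sup>2 + B\<^sup>2 + 2 * t * Re (of_real (norm \<alpha> * norm \<beta>) * \<phi> * u)"
      unfolding ph using t by (simp add: A_def B_def power_mult_distrib algebra_simps)
    also have "\<dots> = 1 + A\<^sup>2 + B\<^sup>2 + 2 * A * B * Re (\<phi> * u)"
    proof -
      have "2 * A * B = 2 * (sqrt t * sqrt t) * (norm \<alpha> * norm \<beta>)" by (simp only: A_def B_def mult_ac)
      also have "\<dots> = 2 * t * (norm \<alpha> * norm \<beta>)" using t by simp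
      finally show ?thesis by (simp add: mult.assoc)
    qed
    also have "\<dots> = c\<^sup>2 + e\<^sup>2 + 2 * c * e * Re (\<phi> * u)"
      by (simp add: c2e2 ce)
    also have "\<dots> = (norm (of_real c + of_real e * \<phi> * u))\<^sup>2"
      unfolding N using e0 ec by (simp add: norm_mult n\<phi> that mult.assoc)
    finally show ?thesis .
  qed
  interpret prob_space uniform_unit_circle by (rule prob_space_uniform_unit_circle)
  have lt: "norm (of_real e * \<phi>) < norm (complex_of_real c)" using e0 ec by (simp add: norm_mult n\<phi>)
  note I = circle_mean_ln[OF lt]
  have eq: "AE u in uniform_unit_circle. ln (1 + t * (norm (\<alpha> + \<beta> * u))\<^sup>2)
      = 2 * ln (norm (of_real c + of_real e * \<phi> * u))"
    using AE_uniform_unit_circle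
  proof eventually_elim
    case (elim u)
    have "norm (of_real e * \<phi> * u) = norm (of_real e * \<phi>)" using elim by (simp add: norm_mult)
    then have "norm (of_real c + of_real e * \<phi> * u) > 0"
      using norm_diff_ineq[of "of_real c" "of_real e * \<phi> * u"] lt by linarith
    then show ?case unfolding key[OF elim] by (simp add: ln_realpow)
  qed
  have "ln (1 + t * (norm \<alpha>)\<^sup>2) = ln (1 + A\<^sup>2)" using t by (simp add: A_def power_mult_distrib)
  also have "\<dots> \<le> ln (c\<^sup>2)" by (rule iffD2[OF ln_le_cancel_iff]) (use cge zero_le_power2[of A] in
      linarith)+
  also have "\<dots> = 2 * ln c" using ec by (simp add: ln_realpow)
  also have "\<dots> = (\<integral>u. 2 * ln (norm (of_real c + of_real e * \<phi> * u)) \<partial>uniform_unit_circle)"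
    using I ec by simp
  finally have "ennreal (ln (1 + t * (norm \<alpha>)\<^sup>2))
      \<le> ennreal (\<integral>u. 2 * ln (norm (of_real c + of_real e * \<phi> * u)) \<partial>uniform_unit_circle)"
    by (rule ennreal_leI)
  also have "\<dots> = (\<integral>\<^sup>+u. ennreal (2 * ln (norm (of_real c + of_real e * \<phi> * u))) \<partial>uniform_unit_circle)"
  proof (subst nn_integral_eq_integral)
    show "AE u in uniform_unit_circle. 0 \<le> 2 * ln (norm (of_real c + of_real e * \<phi> * u))"
      using eq by eventually_elim (use t in \<open>metis ln_ge_zero le_add_same_cancel1 mult_nonneg_nonneg
          zero_le_power2\<close>)
  qed (use I in auto)
  also have "\<dots> = (\<integral>\<^sup>+u. ennreal (ln (1 + t * (norm (\<alpha> + \<beta> * u))\<^sup>2)) \<partial>uniform_unit_circle)"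
    by (intro nn_integral_cong_AE) (use eq in \<open>auto elim!: eventually_mono\<close>)
  finally show ?thesis .
qed

section \<open>The standard complex Gaussian measure\<close>

lemma Complex_measurable [measurable]: "(\<lambda>(x, y). Complex x y) \<in> borel_measurable (borel \<Otimes>\<^sub>M borel)"
  unfolding borel_prod by (intro borel_measurable_continuous_onI) (auto simp: Complex_eq case_prod_beta
      intro!: continuous_intros)

lemma lborel_complex_eq: "lborel = distr (lborel \<Otimes>\<^sub>M lborel) borel (\<lambda>(x, y). Complex x y)"
proof (rule lborel_eqI)
  fix l u :: complex
  assume le: "\<And>b. b \<in> Basis \<Longrightarrow> l \<bullet> b \<le> u \<bullet> b"
  have *: "(\<lambda>(x, y). Complex x y) \<in> borel_measurable (lborel \<Otimes>\<^sub>M lborel)"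
    by simp
  have vi: "(\<lambda>(x, y). Complex x y) -` box l u \<inter> space (lborel \<Otimes>\<^sub>M lborel)
      = {Re l<..<Re u} \<times> {Im l<..<Im u}"
    by (auto simp: box_def Basis_complex_def inner_complex_def space_pair_measure)
  have "Re l \<le> Re u" "Im l \<le> Im u"
    using le[of 1] le[of \<i>] by (auto simp: Basis_complex_def inner_complex_def)
  then show "emeasure (distr (lborel \<Otimes>\<^sub>M lborel) borel (\<lambda>(x, y). Complex x y)) (box l u)
      = ennreal (\<Prod>b\<in>Basis. (u - l) \<bullet> b)"
    by (subst emeasure_distr[OF *])
       (auto simp: vi lborel.emeasure_pair_measure_Times ennreal_mult Basis_complex_def
           inner_complex_def)
qed simp

lemma Complex_measurable' [measurable (raw)]:
  "f \<in> borel_measurable M \<Longrightarrow> g \<in> borel_measurable M \<Longrightarrow> (\<lambda>x. Complex (f x) (g x)) \<in> borel_measurable M"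
  by (simp add: Complex_eq)

lemma nn_integral_lborel_complex:
  assumes [measurable]: "f \<in> borel_measurable borel"
  shows "(\<integral>\<^sup>+z. f z \<partial>lborel) = (\<integral>\<^sup>+x. \<integral>\<^sup>+y. f (Complex x y) \<partial>lborel \<partial>lborel)"
    and "(\<integral>\<^sup>+z. f z \<partial>lborel) = (\<integral>\<^sup>+y. \<integral>\<^sup>+x. f (Complex x y) \<partial>lborel \<partial>lborel)"
proof -
  have "(\<integral>\<^sup>+z. f z \<partial>lborel) = (\<integral>\<^sup>+p. f (Complex (fst p) (snd p)) \<partial>(lborel \<Otimes>\<^sub>M lborel))"
    by (subst lborel_complex_eq, subst nn_integral_distr) (auto simp: case_prod_beta)
  also have "\<dots> = (\<integral>\<^sup>+x. \<integral>\<^sup>+y. f (Complex x y) \<partial>lborel \<partial>lborel)"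
    by (subst lborel.nn_integral_fst[symmetric]) auto
  finally show 1: "(\<integral>\<^sup>+z. f z \<partial>lborel) = (\<integral>\<^sup>+x. \<integral>\<^sup>+y. f (Complex x y) \<partial>lborel \<partial>lborel)" .
  also have "\<dots> = (\<integral>\<^sup>+y. \<integral>\<^sup>+x. f (Complex x y) \<partial>lborel \<partial>lborel)"
    by (rule lborel_pair.Fubini') simp
  finally show "(\<integral>\<^sup>+z. f z \<partial>lborel) = (\<integral>\<^sup>+y. \<integral>\<^sup>+x. f (Complex x y) \<partial>lborel \<partial>lborel)" .
qed

lemma nn_integral_lborel_shift:
  fixes f :: "'a::euclidean_space \<Rightarrow> ennreal"
  assumes [measurable]: "f \<in> borel_measurable borel"
  shows "(\<integral>\<^sup>+x. f (c + x) \<partial>lborel) = (\<integral>\<^sup>+x. f x \<partial>lborel)"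
  by (subst (2) lborel_distr_plus[of c, symmetric], subst nn_integral_distr) auto

lemma nn_integral_shear:
  assumes [measurable]: "f \<in> borel_measurable borel"
  shows "(\<integral>\<^sup>+z. f (Complex (Re z + c * Im z) (Im z)) \<partial>lborel) = (\<integral>\<^sup>+z. f z \<partial>lborel)"
    and "(\<integral>\<^sup>+z. f (Complex (Re z) (Im z + c * Re z)) \<partial>lborel) = (\<integral>\<^sup>+z. f z \<partial>lborel)"
proof -
  have "(\<integral>\<^sup>+z. f (Complex (Re z + c * Im z) (Im z)) \<partial>lborel)
      = (\<integral>\<^sup>+y. \<integral>\<^sup>+x. f (Complex (c * y + x) y) \<partial>lborel \<partial>lborel)"
    by (subst nn_integral_lborel_complex(2)) (auto simp: add.commute)
  also have "\<dots> = (\<integral>\<^sup>+z. f z \<partial>lborel)"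
    by (subst nn_integral_lborel_shift) (auto simp: nn_integral_lborel_complex(2))
  finally show "(\<integral>\<^sup>+z. f (Complex (Re z + c * Im z) (Im z)) \<partial>lborel) = (\<integral>\<^sup>+z. f z \<partial>lborel)" .
  have "(\<integral>\<^sup>+z. f (Complex (Re z) (Im z + c * Re z)) \<partial>lborel)
      = (\<integral>\<^sup>+x. \<integral>\<^sup>+y. f (Complex x (c * x + y)) \<partial>lborel \<partial>lborel)"
    by (subst nn_integral_lborel_complex(1)) (auto simp: add.commute)
  also have "\<dots> = (\<integral>\<^sup>+z. f z \<partial>lborel)"
    by (subst nn_integral_lborel_shift) (auto simp: nn_integral_lborel_complex(1))
  finally show "(\<integral>\<^sup>+z. f (Complex (Re z) (Im z + c * Re z)) \<partial>lborel) = (\<integral>\<^sup>+z. f z \<partial>lborel)" .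
qed

text \<open>A rotation is a product of three shears, and a shear preserves the Lebesgue measure by Fubini and
translation invariance. The half turn, which is no such product, is the square of the quarter turn.\<close>

lemma nn_integral_rotate:
  fixes f :: "complex \<Rightarrow> ennreal" and u :: complex
  assumes [measurable]: "f \<in> borel_measurable borel" and u: "norm u = 1"
  shows "(\<integral>\<^sup>+z. f (u * z) \<partial>lborel) = (\<integral>\<^sup>+z. f z \<partial>lborel)"
proof -
  have gen: "(\<integral>\<^sup>+z. g (v * z) \<partial>lborel) = (\<integral>\<^sup>+z. g z \<partial>lborel)"
    if g [measurable]: "g \<in> borel_measurable borel" and v: "norm v = 1" "Re v \<noteq> -1"
        for g :: "complex \<Rightarrow> ennreal" and v
  proof -
    define a b where "a = Re v" and "b = Im v"
    \<comment> \<open>the tangent of half the angle\<close>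
    define t where "t = b / (1 + a)"
    have ab: "a\<^sup>2 + b\<^sup>2 = 1" "1 + a \<noteq> 0" using v cmod_power2[of v] by (auto simp: a_def b_def)
    have t1: "t * (1 + a) = b" using ab by (simp add: t_def)
    have t2: "b * t = 1 - a"
    proof -
      have "b * t * (1 + a) = b\<^sup>2" using t1 by (simp add: power2_eq_square mult.assoc)
      also have "\<dots> = (1 - a) * (1 + a)" using ab(1) by (simp add: power2_eq_square algebra_simps)
      finally show ?thesis using ab(2) by simp
    qed
    define S where "S z = Complex (Re z + (- t) * Im z) (Im z)" for z
    define T where "T z = Complex (Re z) (Im z + b * Re z)" for z
    have [measurable]: "S \<in> borel_measurable borel" "T \<in> borel_measurable borel"
        by (auto simp: S_def[abs_def] T_def[abs_def])
    have comp: "v * z = S (T (S z))" for z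
    proof -
      have "Re z + - t * Im z + - t * (Im z + b * (Re z + - t * Im z))
          = (1 - b * t) * Re z - t * (1 + (1 - b * t)) * Im z"
        by (simp add: algebra_simps)
      also have "\<dots> = a * Re z - b * Im z" using t1 t2 by (simp add: mult.commute)
      finally have 1: "Re (S (T (S z))) = Re (v * z)" by (simp add: S_def T_def a_def b_def)
      have "Im z + b * (Re z + - t * Im z) = b * Re z + (1 - b * t) * Im z" by (simp add: algebra_simps)
      also have "\<dots> = b * Re z + a * Im z" using t2 by simp
      finally have "Im (S (T (S z))) = Im (v * z)" by (simp add: S_def T_def a_def b_def)
      with 1 show ?thesis by (simp add: complex_eq_iff)
    qed
    have S: "(\<integral>\<^sup>+z. h (S z) \<partial>lborel) = (\<integral>\<^sup>+z. h z \<partial>lborel)" if "h \<in> borel_measurable borel"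
        for h :: "complex \<Rightarrow> ennreal"
      unfolding S_def by (rule nn_integral_shear(1)[OF that])
    have T: "(\<integral>\<^sup>+z. h (T z) \<partial>lborel) = (\<integral>\<^sup>+z. h z \<partial>lborel)" if "h \<in> borel_measurable borel"
        for h :: "complex \<Rightarrow> ennreal"
      unfolding T_def by (rule nn_integral_shear(2)[OF that])
    have "(\<integral>\<^sup>+z. g (v * z) \<partial>lborel) = (\<integral>\<^sup>+z. g (S (T (S z))) \<partial>lborel)" by (simp add: comp)
    also have "\<dots> = (\<integral>\<^sup>+z. g (S (T z)) \<partial>lborel)" by (rule S) simp
    also have "\<dots> = (\<integral>\<^sup>+z. g (S z) \<partial>lborel)" by (rule T) simp
    also have "\<dots> = (\<integral>\<^sup>+z. g z \<partial>lborel)" by (rule S) simp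
    finally show ?thesis .
  qed
  show ?thesis
  proof (cases "Re u = -1")
    case True
    then have "u = \<i> * \<i>" using u cmod_power2[of u] by (simp add: complex_eq_iff)
    then have "(\<integral>\<^sup>+z. f (u * z) \<partial>lborel) = (\<integral>\<^sup>+z. f (\<i> * (\<i> * z)) \<partial>lborel)" by (simp add: mult.assoc)
    also have "\<dots> = (\<integral>\<^sup>+z. f (\<i> * z) \<partial>lborel)" by (rule gen) auto
    also have "\<dots> = (\<integral>\<^sup>+z. f z \<partial>lborel)" by (rule gen) auto
    finally show ?thesis .
  qed (use gen u in auto)
qed

definition cgauss :: "complex measure" where
  "cgauss = density lborel (\<lambda>z. ennreal (exp (- (norm z)\<^sup>2) / pi))"

lemma sets_cgauss [simp, measurable_cong]: "sets cgauss = sets borel"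
  by (simp add: cgauss_def)

lemma space_cgauss [simp]: "space cgauss = UNIV"
  by (simp add: cgauss_def)

lemma nn_integral_cgauss:
  "f \<in> borel_measurable borel \<Longrightarrow> (\<integral>\<^sup>+z. f z \<partial>cgauss)
      = (\<integral>\<^sup>+z. ennreal (exp (- (norm (z::complex))\<^sup>2) / pi) * f z \<partial>lborel)"
  unfolding cgauss_def by (subst nn_integral_density) auto

lemma nn_integral_cgauss_rotate:
  fixes f :: "complex \<Rightarrow> ennreal" and u :: complex
  assumes [measurable]: "f \<in> borel_measurable borel" and "norm u = 1"
  shows "(\<integral>\<^sup>+z. f (u * z) \<partial>cgauss) = (\<integral>\<^sup>+z. f z \<partial>cgauss)"
proof -
  have "(\<integral>\<^sup>+z. f (u * z) \<partial>cgauss) = (\<integral>\<^sup>+z. ennreal (exp (- (norm (u * z))\<^sup>2) / pi) * f (u * z) \<partial>lborel)"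
    using assms(2) by (subst nn_integral_cgauss) (auto simp: norm_mult)
  also have "\<dots> = (\<integral>\<^sup>+z. ennreal (exp (- (norm (z::complex))\<^sup>2) / pi) * f z \<partial>lborel)"
    by (rule nn_integral_rotate[where f = "\<lambda>z. ennreal (exp (- (norm z)\<^sup>2) / pi) * f z"]) (use assms in
        auto)
  finally show ?thesis by (simp add: nn_integral_cgauss)
qed

lemma nn_integral_gauss_complex:
  assumes "s > 0"
  shows "(\<integral>\<^sup>+z. ennreal (exp (- (norm (z::complex))\<^sup>2 / (2 * s\<^sup>2))) \<partial>lborel) = ennreal (2 * pi * s\<^sup>2)"
proof -
  have one: "(\<integral>\<^sup>+x. ennreal (exp (- x\<^sup>2 / (2 * s\<^sup>2))) \<partial>lborel) = ennreal (sqrt (2 * pi * s\<^sup>2))"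
  proof -
    interpret prob_space "density lborel (normal_density 0 s)" using assms
        by (rule prob_space_normal_density)
    have "(\<integral>\<^sup>+x. ennreal (exp (- x\<^sup>2 / (2 * s\<^sup>2))) \<partial>lborel) =
      (\<integral>\<^sup>+x. ennreal (sqrt (2 * pi * s\<^sup>2)) * ennreal (normal_density 0 s x) \<partial>lborel)"
      using assms by (intro nn_integral_cong) (auto simp: normal_density_def ennreal_mult[symmetric])
    also have "\<dots> = ennreal (sqrt (2 * pi * s\<^sup>2)) * emeasure (density lborel (normal_density 0 s)) UNIV"
      by (subst nn_integral_cmult) (auto simp: emeasure_density)
    finally show ?thesis using emeasure_space_1 by simp
  qed
  have "(\<integral>\<^sup>+z. ennreal (exp (- (norm (z::complex))\<^sup>2 / (2 * s\<^sup>2))) \<partial>lborel) =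
     (\<integral>\<^sup>+z. (\<Prod>b\<in>Basis. ennreal (exp (- ((z::complex) \<bullet> b)\<^sup>2 / (2 * s\<^sup>2)))) \<partial>lborel)"
    by (intro nn_integral_cong)
       (simp add: Basis_complex_def inner_complex_def ennreal_mult[symmetric] exp_add[symmetric]
           cmod_power2 add_divide_distrib diff_divide_distrib)
  also have "\<dots> = (\<Prod>b\<in>(Basis::complex set). ennreal (sqrt (2 * pi * s\<^sup>2)))"
    by (subst nn_integral_lborel_prod) (use one in auto)
  also have "\<dots> = ennreal (2 * pi * s\<^sup>2)"
    by (simp add: ennreal_power)
  finally show ?thesis .
qed

lemma prob_space_cgauss: "prob_space cgauss"
proof
  have s: "(sqrt (1 / 2))\<^sup>2 = 1 / 2" by simp
  have "emeasure cgauss (space cgauss) = (\<integral>\<^sup>+z. ennreal (exp (- (norm (z::complex))\<^sup>2) / pi) \<partial>lborel)"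
    by (simp add: cgauss_def emeasure_density)
  also have "\<dots> = (\<integral>\<^sup>+z. ennreal (exp (- (norm (z::complex))\<^sup>2)) * ennreal (1 / pi) \<partial>lborel)"
    by (simp add: ennreal_mult[symmetric])
  also have "\<dots> = ennreal pi * ennreal (1 / pi)"
    using nn_integral_gauss_complex[of "sqrt (1 / 2)"] unfolding s by (simp add: nn_integral_multc)
  also have "\<dots> = 1" by (simp add: ennreal_mult[symmetric])
  finally show "emeasure cgauss (space cgauss) = 1" .
qed

definition gauss_var :: ennreal where
  "gauss_var = (\<integral>\<^sup>+z. ennreal ((norm z)\<^sup>2) \<partial>cgauss)"

text \<open>\<open>|z|\<^sup>2 exp(-|z|\<^sup>2)\<close> is dominated by a multiple of the wider Gaussian \<open>exp(-|z|\<^sup>2/2)\<close>.\<close>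

lemma gauss_var_finite: "gauss_var < \<infinity>"
proof -
  have "gauss_var \<le> (\<integral>\<^sup>+z. ennreal (exp (- (norm (z::complex))\<^sup>2 / (2 * 1\<^sup>2))) * ennreal 2 \<partial>lborel)"
    unfolding gauss_var_def
  proof (subst nn_integral_cgauss, simp, intro nn_integral_mono)
    fix z :: complex
    define q where "q = (norm z)\<^sup>2"
    have "q / 2 \<le> exp (q / 2)" using exp_ge_add_one_self[of "q / 2"] by linarith
    then have "exp (- q) * q \<le> exp (- q) * (2 * exp (q / 2))" by (intro mult_left_mono) auto
    also have "\<dots> = exp (- q / 2) * 2" by (simp add: exp_add[symmetric] mult.assoc[symmetric])
    finally have "exp (- q) * q \<le> exp (- q / 2) * 2" .
    moreover have "exp (- q) / pi * q \<le> exp (- q) * q"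
      using pi_ge_two by (simp add: divide_le_eq q_def mult_le_cancel_left1 not_less)
    ultimately show "ennreal (exp (- (norm z)\<^sup>2) / pi) * ennreal ((norm z)\<^sup>2)
        \<le> ennreal (exp (- (norm z)\<^sup>2 / (2 * 1\<^sup>2))) * ennreal 2"
      unfolding q_def[symmetric] by (simp add: ennreal_mult[symmetric] q_def del: ennreal_numeral)
  qed
  also have "\<dots> < \<infinity>"
    using nn_integral_gauss_complex[of 1] by (simp add: nn_integral_multc ennreal_mult_less_top del:
        ennreal_numeral)
  finally show ?thesis .
qed

section \<open>Multilinearity of determinants and the Hadamard inequality\<close>

text \<open>The determinant in terms of the entry function of a matrix: the replacement of row \<open>i\<close> becomes the
function update \<open>f(i := v)\<close>.\<close>

definition fdet :: "nat \<Rightarrow> (nat \<Rightarrow> nat \<Rightarrow> complex) \<Rightarrow> complex" where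
  "fdet n f = det (mat n n (\<lambda>(i, j). f i j))"

definition unit_row :: "nat \<Rightarrow> nat \<Rightarrow> complex" where
  "unit_row j = (\<lambda>k. if k = j then 1 else 0)"

lemma fdet_cong: "(\<And>i j. i < n \<Longrightarrow> j < n \<Longrightarrow> f i j = g i j) \<Longrightarrow> fdet n f = fdet n g"
  unfolding fdet_def by (intro arg_cong[where f = det] eq_matI) auto

lemma fdet_Leibniz: "fdet n f = (\<Sum>p | p permutes {0..<n}. signof p * (\<Prod>i = 0..<n. f i (p i)))"
proof -
  have "fdet n f = (\<Sum>p | p permutes {0..<n}. signof p * (\<Prod>i
      = 0..<n. mat n n (\<lambda>(i, j). f i j) $$ (i, p i)))"
    unfolding fdet_def by (rule det_def') auto
  also have "\<dots> = (\<Sum>p | p permutes {0..<n}. signof p * (\<Prod>i = 0..<n. f i (p i)))"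
    by (intro sum.cong refl arg_cong2[where f = "(*)"] prod.cong) (auto dest: permutes_in_image)
  finally show ?thesis .
qed

lemma fdet_measurable [measurable (raw)]:
  assumes "\<And>i j. i < n \<Longrightarrow> j < n \<Longrightarrow> (\<lambda>x. f x i j) \<in> borel_measurable M"
  shows "(\<lambda>x. fdet n (f x)) \<in> borel_measurable M"
  unfolding fdet_Leibniz
  by (intro borel_measurable_sum borel_measurable_times borel_measurable_prod assms)
     (auto dest: permutes_in_image)

text \<open>Laplace expansion: the cofactors along row \<open>i\<close> do not involve that row, so they are determinants
with unit rows in its place.\<close>

lemma fdet_row_expansion:
  assumes "i < n"
  shows "fdet n (f(i := v)) = (\<Sum>j<n. v j * fdet n (f(i := unit_row j)))"
proof -
  let ?M = "\<lambda>v. mat n n (\<lambda>(r, c). (f(i := v)) r c)"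
  have cof: "cofactor (?M v) i j = cofactor (?M w) i j" for v w j
    unfolding cofactor_def mat_delete_def
    by (intro arg_cong2[where f = "(*)"] refl arg_cong[where f = det] eq_matI) auto
  have L: "fdet n (f(i := v)) = (\<Sum>j<n. v j * cofactor (?M (\<lambda>_. 0)) i j)" for v
  proof -
    have "fdet n (f(i := v)) = (\<Sum>j<n. ?M v $$ (i, j) * cofactor (?M v) i j)"
      unfolding fdet_def by (rule laplace_expansion_row) (use assms in auto)
    also have "\<dots> = (\<Sum>j<n. v j * cofactor (?M (\<lambda>_. 0)) i j)"
      by (intro sum.cong arg_cong2[where f = "(*)"] cof) (use assms in auto)
    finally show ?thesis .
  qed
  have "fdet n (f(i := unit_row j)) = cofactor (?M (\<lambda>_. 0)) i j" if "j < n" for j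
    by (subst L) (use that in \<open>simp add: unit_row_def if_distrib[of "\<lambda>x. x * _"] del: fun_upd_apply
        cong: if_cong\<close>)
  then show ?thesis by (subst L) (intro sum.cong refl, simp del: fun_upd_apply)
qed

lemma fdet_row_linear:
  assumes "i < n"
  shows "fdet n (f(i := (\<lambda>j. u j + c * v j))) = fdet n (f(i := u)) + c * fdet n (f(i := v))"
  unfolding fdet_row_expansion[OF assms, of _ u] fdet_row_expansion[OF assms, of _ v]
      fdet_row_expansion[OF assms, of _ "\<lambda>j. u j + c * v j"]
  by (simp add: sum.distrib sum_distrib_left algebra_simps)

text \<open>Row by row, the determinant is a combination of determinants with unit rows, and is dominated by the
largest of them times the sum of the moduli of the entries of the row.\<close>

lemma fdet_le_unit_rows:
  assumes "finite R" "R \<subseteq> {..<n}" "\<And>i. i \<in> R \<Longrightarrow> (\<Sum>k<n. norm (f i k)) \<le> K"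
  shows "\<exists>j. (\<forall>i\<in>R. j i < n) \<and> norm (fdet n f) \<le> K ^ card R * norm (fdet n (\<lambda>i.
      if i \<in> R then unit_row (j i) else f i))"
  using assms
proof (induction R rule: finite_induct)
  case empty
  then show ?case by auto
next
  case (insert i R)
  then obtain j where j: "\<And>i. i \<in> R \<Longrightarrow> j i < n"
    and le: "norm (fdet n f) \<le> K ^ card R * norm (fdet n (\<lambda>i. if i \<in> R then unit_row (j i) else f i))"
    by auto
  define g where "g = (\<lambda>i. if i \<in> R then unit_row (j i) else f i)"
  have i: "i < n" using insert by auto
  have K0: "K \<ge> 0" using insert.prems(2)[of i] by (meson insertI1 norm_ge_zero order_trans sum_nonneg)
  define D where "D = (\<lambda>k. norm (fdet n (g(i := unit_row k))))"
  have "{..<n} \<noteq> {}" using i by auto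
  then obtain k where k: "k < n" "\<And>l. l < n \<Longrightarrow> D l \<le> D k"
    using Max_in[of "D ` {..<n}"] Max_ge[of "D ` {..<n}"] by fastforce
  have gi: "g = g(i := f i)" using insert(2) by (auto simp: g_def)
  have "norm (fdet n g) = norm (\<Sum>l<n. f i l * fdet n (g(i := unit_row l)))"
    using fdet_row_expansion[OF i, of g "f i"] unfolding gi[symmetric] by simp
  also have "\<dots> \<le> (\<Sum>l<n. norm (f i l) * D k)"
    by (intro sum_norm_le) (use k in \<open>auto simp: norm_mult D_def intro!: mult_left_mono\<close>)
  also have "\<dots> \<le> K * D k"
    unfolding sum_distrib_right[symmetric] using insert.prems(2)[of i]
        by (intro mult_right_mono) (auto simp: D_def)
  finally have "norm (fdet n f) \<le> K ^ card R * (K * D k)"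
    using le K0 unfolding g_def[symmetric] by (meson mult_left_mono order_trans zero_le_power)
  also have "\<dots> = K ^ card (insert i R) * D k" using insert by simp
  also have "D k = norm (fdet n (\<lambda>r. if r \<in> insert i R then unit_row ((j(i := k)) r) else f r))"
    unfolding D_def by (intro arg_cong[where f
        = "\<lambda>f. norm (fdet n f)"]) (use insert(2) in \<open>auto simp: g_def fun_eq_iff\<close>)
  finally show ?case
    by (intro exI[of _ "j(i := k)"]) (use j k in auto)
qed

lemma fdet_scale_columns: "fdet n (\<lambda>i j. f i j * c j) = fdet n f * (\<Prod>j<n. c j)"
proof -
  have "(\<Prod>i = 0..<n. c (p i)) = (\<Prod>j<n. c j)" if "p permutes {0..<n}" for p
    using prod.permute[OF that, of c] by (simp add: o_def atLeast0LessThan)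
  then show ?thesis
    unfolding fdet_Leibniz sum_distrib_right by (intro sum.cong) (auto simp: prod.distrib)
qed

lemma fdet_cnj: "fdet n (\<lambda>i j. cnj (f i j)) = cnj (fdet n f)"
  unfolding fdet_Leibniz by (simp add: sign_def)

lemma fdet_transpose: "fdet n (\<lambda>i j. f j i) = fdet n f"
proof -
  have "mat n n (\<lambda>(i, j). f j i) = transpose_mat (mat n n (\<lambda>(i, j). f i j))"
    by (intro eq_matI) auto
  then show ?thesis unfolding fdet_def by (simp add: det_transpose[of _ n])
qed

lemma fdet_mult: "fdet n (\<lambda>i j. \<Sum>k<n. f i k * g k j) = fdet n f * fdet n g"
proof -
  have "mat n n (\<lambda>(i, j). \<Sum>k<n. f i k * g k j) = mat n n (\<lambda>(i, j). f i j) * mat n n (\<lambda>(i, j). g i j)"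
    by (intro eq_matI) (auto simp: scalar_prod_def atLeast0LessThan)
  then show ?thesis unfolding fdet_def by (simp add: det_mult[of _ n])
qed

lemma fdet_diag: "fdet n (\<lambda>i j. if i = j then c i else 0) = (\<Prod>i<n. c i)"
proof -
  have "fdet n (\<lambda>i j. if i = j then c i else 0) = prod_list (diag_mat (mat n n (\<lambda>(i, j). if i
      = j then c i else 0)))"
    unfolding fdet_def by (rule det_upper_triangular[of _ n]) auto
  also have "\<dots> = (\<Prod>i<n. c i)"
    by (simp add: diag_mat_def prod.list_conv_set_nth atLeast0LessThan)
  finally show ?thesis .
qed

lemma trace_similar:
  assumes "similar_mat_wit A B P Q" "A \<in> carrier_mat n n"
  shows "(\<Sum>i<n. A $$ (i, i)) = (\<Sum>i<n. B $$ (i, i) :: complex)"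
proof -
  from similar_mat_witD2[OF assms(2,1)]
  have QP: "Q * P = 1\<^sub>m n" and A: "A = P * B * Q"
      and c: "B \<in> carrier_mat n n" "P \<in> carrier_mat n n" "Q \<in> carrier_mat n n"
    by auto
  have "(\<Sum>i<n. A $$ (i, i)) = (\<Sum>i<n. \<Sum>l<n. \<Sum>k<n. P $$ (i, l) * B $$ (l, k) * Q $$ (k, i))"
    unfolding A using c
    by (intro sum.cong refl) (auto simp: scalar_prod_def atLeast0LessThan sum_distrib_left mult.assoc)
  also have "\<dots> = (\<Sum>i<n. \<Sum>k<n. \<Sum>l<n. P $$ (i, l) * B $$ (l, k) * Q $$ (k, i))"
    by (intro sum.cong refl sum.swap)
  also have "\<dots> = (\<Sum>k<n. \<Sum>i<n. \<Sum>l<n. P $$ (i, l) * B $$ (l, k) * Q $$ (k, i))"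
    by (rule sum.swap)
  also have "\<dots> = (\<Sum>k<n. \<Sum>l<n. \<Sum>i<n. P $$ (i, l) * B $$ (l, k) * Q $$ (k, i))"
    by (intro sum.cong refl sum.swap)
  also have "\<dots> = (\<Sum>k<n. \<Sum>l<n. B $$ (l, k) * (Q * P) $$ (k, l))"
    using c by (intro sum.cong refl) (auto simp: scalar_prod_def atLeast0LessThan sum_distrib_left
        mult_ac)
  also have "\<dots> = (\<Sum>k<n. \<Sum>l<n. if l = k then B $$ (l, k) else 0)"
    unfolding QP by (intro sum.cong refl) auto
  also have "\<dots> = (\<Sum>i<n. B $$ (i, i))" by simp
  finally show ?thesis .
qed

text \<open>The inequality between arithmetic and geometric mean for the eigenvalues of \<open>f\<^sup>* f\<close>: their product
is \<open>|det f|\<^sup>2\<close> and, as Schur triangularisation preserves the trace, their sum is the squared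
Frobenius norm.\<close>

lemma norm_fdet_le_frobenius:
  assumes n: "n > 0"
  shows "(norm (fdet n f))\<^sup>2 \<le> ((\<Sum>i<n. \<Sum>j<n. (norm (f i j))\<^sup>2) / n) ^ n"
proof -
  define h where "h i j = (\<Sum>k<n. cnj (f k i) * f k j)" for i j
  define H where "H = mat n n (\<lambda>(i, j). h i j)"
  have H: "H \<in> carrier_mat n n" by (simp add: H_def)
  have "det H = fdet n h" by (simp add: H_def fdet_def)
  also have "\<dots> = fdet n (\<lambda>i k. cnj (f k i)) * fdet n f"
    unfolding h_def by (rule fdet_mult)
  also have "fdet n (\<lambda>i k. cnj (f k i)) = cnj (fdet n f)"
    using fdet_cnj[of n "\<lambda>i k. f k i"] fdet_transpose[of n f] by simp
  finally have detH: "det H = of_real ((norm (fdet n f))\<^sup>2)"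
    by (simp only: complex_norm_square mult.commute)
  obtain es where "char_poly H = (\<Prod>a\<leftarrow>es. [:- a, 1:])"
    using char_poly_factorized[OF H] by auto
  from schur_decomposition_exists[OF H this] obtain B where
    B: "B \<in> carrier_mat n n" "upper_triangular B" "similar_mat H B" by auto
  then obtain P Q where wit: "similar_mat_wit H B P Q" by (auto simp: similar_mat_def)
  have tr: "(\<Sum>i<n. H $$ (i, i)) = (\<Sum>i<n. B $$ (i, i))" by (rule trace_similar[OF wit H])
  have detB: "det H = (\<Prod>i<n. B $$ (i, i))"
    using det_similar[OF B(3)] det_upper_triangular[OF B(2,1)] B(1)
    by (simp add: diag_mat_def prod.list_conv_set_nth atLeast0LessThan)
  have cp: "char_poly H = (\<Prod>a\<leftarrow>diag_mat B. [:- a, 1:])"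
    using char_poly_similar[OF B(3)] char_poly_upper_triangular[OF B(1,2)] by simp
  have real: "\<exists>x\<ge>0. B $$ (i, i) = complex_of_real x" if i: "i < n" for i
  proof -
    define e where "e = B $$ (i, i)"
    have "e \<in> set (diag_mat B)" using i B(1) by (auto simp: diag_mat_def e_def)
    then have "poly (char_poly H) e = 0"
      unfolding cp poly_prod_list prod_list_zero_iff by (auto simp: image_iff intro!: bexI[of _ e])
    then have "eigenvalue H e" using eigenvalue_root_char_poly[OF H] by simp
    then obtain v where v: "v \<in> carrier_vec n" "v \<noteq> 0\<^sub>v n" "H *\<^sub>v v = e \<cdot>\<^sub>v v"
      using H by (auto simp: eigenvalue_def eigenvector_def)
    have ev: "(\<Sum>l<n. h k l * vec_index v l) = e * vec_index v k" if "k < n" for k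
      using arg_cong[OF v(3), of "\<lambda>u. vec_index u k"] that v(1) H
      by (simp add: H_def scalar_prod_def atLeast0LessThan)
    have "e * of_real (\<Sum>k<n. (norm (vec_index v k))\<^sup>2)
        = (\<Sum>k<n. cnj (vec_index v k) * (e * vec_index v k))"
      by (simp add: sum_distrib_left complex_norm_square mult_ac del: of_real_power)
    also have "\<dots> = (\<Sum>k<n. cnj (vec_index v k) * (\<Sum>l<n. h k l * vec_index v l))"
      by (intro sum.cong refl) (simp add: ev)
    also have "\<dots> = (\<Sum>k<n. \<Sum>l<n. \<Sum>m<n. cnj (f m k * vec_index v k) * (f m l * vec_index v l))"
      by (simp add: h_def sum_distrib_left sum_distrib_right mult_ac)
    also have "\<dots> = (\<Sum>k<n. \<Sum>m<n. \<Sum>l<n. cnj (f m k * vec_index v k) * (f m l * vec_index v l))"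
      by (intro sum.cong refl sum.swap)
    also have "\<dots> = (\<Sum>m<n. \<Sum>k<n. \<Sum>l<n. cnj (f m k * vec_index v k) * (f m l * vec_index v l))"
      by (rule sum.swap)
    also have "\<dots> = (\<Sum>m<n. cnj (\<Sum>k<n. f m k * vec_index v k) * (\<Sum>l<n. f m l * vec_index v l))"
      by (simp add: sum_distrib_left sum_distrib_right cnj_sum del: complex_cnj_mult) (rule sum.cong[OF
          refl sum.swap])
    also have "\<dots> = of_real (\<Sum>m<n. (norm (\<Sum>k<n. f m k * vec_index v k))\<^sup>2)"
      by (simp add: complex_norm_square mult.commute del: of_real_power)
    finally have eq: "e * of_real (\<Sum>k<n. (norm (vec_index v k))\<^sup>2)
        = of_real (\<Sum>m<n. (norm (\<Sum>k<n. f m k * vec_index v k))\<^sup>2)" .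
    obtain k where k: "k < n" "vec_index v k \<noteq> 0" using v(1,2)
        by (metis carrier_vecD eq_vecI index_zero_vec)
    have pos: "(\<Sum>k<n. (norm (vec_index v k))\<^sup>2) > 0"
      by (rule sum_pos2[of _ k]) (use k in auto)
    have "e = of_real ((\<Sum>m<n. (norm (\<Sum>k<n. f m k * vec_index v k))\<^sup>2) / (\<Sum>k<n. (norm (vec_index v
        k))\<^sup>2))"
      using eq pos by (simp add: field_simps del: of_real_sum)
    then show ?thesis unfolding e_def[symmetric] using pos
      by (intro exI[of _ "(\<Sum>m<n. (norm (\<Sum>k<n. f m k * vec_index v k))\<^sup>2) / (\<Sum>k<n. (norm (vec_index v
          k))\<^sup>2)"] conjI divide_nonneg_pos sum_nonneg) auto
  qed
  then obtain x where x: "\<And>i. i < n \<Longrightarrow> x i \<ge> 0" "\<And>i. i < n \<Longrightarrow> B $$ (i, i) = complex_of_real (x i)"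
    by metis
  have "complex_of_real ((norm (fdet n f))\<^sup>2) = of_real (\<Prod>i<n. x i)"
    using detH detB x(2) by simp
  then have d: "(norm (fdet n f))\<^sup>2 = (\<Prod>i<n. x i)" by (simp only: of_real_eq_iff)
  have "complex_of_real (\<Sum>i<n. x i) = (\<Sum>i<n. h i i)"
    using tr x(2) by (simp add: H_def)
  also have "\<dots> = of_real (\<Sum>i<n. \<Sum>k<n. (norm (f k i))\<^sup>2)"
    by (simp add: h_def complex_norm_square mult.commute del: of_real_power)
  finally have t: "(\<Sum>i<n. x i) = (\<Sum>i<n. \<Sum>k<n. (norm (f k i))\<^sup>2)" by (simp only: of_real_eq_iff)
  have p0: "(\<Prod>i<n. x i) \<ge> 0" using x(1) by (intro prod_nonneg) auto
  have "(\<Prod>i<n. x i) powr (1 / n) \<le> (\<Sum>i<n. x i) / n"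
    using arith_geom_mean[of "{..<n}" x] x(1) n by (simp add: sum_divide_distrib lessThan_empty_iff)
  then have "((\<Prod>i<n. x i) powr (1 / n)) ^ n \<le> ((\<Sum>i<n. x i) / n) ^ n"
    by (intro power_mono) auto
  moreover have "((\<Prod>i<n. x i) powr (1 / n)) ^ n = (\<Prod>i<n. x i)"
  proof -
    have "(y powr (1 / n)) ^ n = y" if "y \<ge> 0" for y :: real
      using that n by (cases "y = 0") (auto simp: powr_power)
    then show ?thesis using p0 by blast
  qed
  ultimately show ?thesis unfolding d t by (subst sum.swap) simp
qed

text \<open>After normalisation of the columns this is the previous inequality.\<close>

lemma hadamard_columns:
  "(norm (fdet n f))\<^sup>2 \<le> (\<Prod>j<n. \<Sum>i<n. (norm (f i j))\<^sup>2)"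
proof (cases "n = 0 \<or> (\<exists>j<n. (\<Sum>i<n. (norm (f i j))\<^sup>2) = 0)")
  case True
  then show ?thesis
  proof
    assume "n = 0" then show ?thesis by (simp add: fdet_Leibniz)
  next
    assume "\<exists>j<n. (\<Sum>i<n. (norm (f i j))\<^sup>2) = 0"
    then obtain j where j: "j < n" "\<And>i. i < n \<Longrightarrow> f i j = 0" by (auto simp: sum_nonneg_eq_0_iff)
    have "fdet n f = fdet n (\<lambda>i k. f i k * (if k = j then 0 else 1))"
        by (rule fdet_cong) (use j in auto)
    also have "\<dots> = 0" unfolding fdet_scale_columns using j by (simp add: prod_zero_iff) 
    finally show ?thesis by (simp add: prod_nonneg sum_nonneg)
  qed
next
  case False
  then have n: "n > 0" by auto
  define s where "s j = (\<Sum>i<n. (norm (f i j))\<^sup>2)" for j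
  have s: "s j > 0" if "j < n" for j using False that sum_nonneg[of "{..<n}" "\<lambda>i. (norm (f i j))\<^sup>2"]
      unfolding s_def by (metis less_eq_real_def zero_le_power2)
  define g where "g = (\<lambda>i j. f i j / of_real (sqrt (s j)))"
  have "fdet n f = fdet n (\<lambda>i j. g i j * of_real (sqrt (s j)))"
    by (rule fdet_cong) (use s in \<open>force simp: g_def\<close>)
  also have "\<dots> = fdet n g * of_real (\<Prod>j<n. sqrt (s j))" by (simp add: fdet_scale_columns)
  finally have f: "(norm (fdet n f))\<^sup>2 = (norm (fdet n g))\<^sup>2 * (\<Prod>j<n. sqrt (s j))\<^sup>2"
    by (simp add: norm_mult power_mult_distrib del: of_real_prod)
  have "(\<Sum>i<n. \<Sum>j<n. (norm (g i j))\<^sup>2) = (\<Sum>j<n. \<Sum>i<n. (norm (g i j))\<^sup>2)" by (rule sum.swap)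
  also have "\<dots> = (\<Sum>j<n. 1)"
  proof (rule sum.cong[OF refl])
    fix j assume "j \<in> {..<n}"
    then have "s j > 0" using s by auto
    then have "(\<Sum>i<n. (norm (g i j))\<^sup>2) = s j / s j"
      by (subst s_def, subst sum_divide_distrib) (simp add: g_def norm_divide power_divide)
    then show "(\<Sum>i<n. (norm (g i j))\<^sup>2) = 1" using \<open>s j > 0\<close> by simp
  qed
  finally have "(norm (fdet n g))\<^sup>2 \<le> 1" using norm_fdet_le_frobenius[OF n, of g] n by simp
  then have "(norm (fdet n f))\<^sup>2 \<le> (\<Prod>j<n. sqrt (s j))\<^sup>2"
    unfolding f by (simp add: mult_left_le_one_le)
  also have "\<dots> = (\<Prod>j<n. s j)"
    by (subst prod_power_distrib, intro prod.cong refl) (use s in \<open>auto intro: less_imp_le\<close>)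
  finally show ?thesis by (simp add: s_def)
qed

section \<open>Circulant and banded Toeplitz matrices\<close>

definition dft :: "nat \<Rightarrow> nat \<Rightarrow> nat \<Rightarrow> complex" where
  "dft N j r = cis (2 * pi * real r / real N) ^ j"

definition symbol :: "nat \<Rightarrow> (nat \<Rightarrow> complex) \<Rightarrow> complex \<Rightarrow> complex" where
  "symbol d a u = (\<Sum>k\<le>d. a k * u ^ k)"

text \<open>The eigenvalues of the circulant matrix with the given symbol.\<close>

definition nodes :: "nat \<Rightarrow> (nat \<Rightarrow> complex) \<Rightarrow> nat \<Rightarrow> nat \<Rightarrow> complex" where
  "nodes d a N r = symbol d a (cis (2 * pi * real r / real N))"

text \<open>The spectral parameter is already subtracted on the diagonal, here and for the circulant matrix.\<close>

definition toeplitz_entry :: "nat \<Rightarrow> (nat \<Rightarrow> complex) \<Rightarrow> complex \<Rightarrow> nat \<Rightarrow> nat \<Rightarrow> complex" where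
  "toeplitz_entry d a z i j = (\<Sum>k\<le>d. if j = i + k then a k else 0) - (if i = j then z else 0)"

definition circulant_entry :: "nat \<Rightarrow> (nat \<Rightarrow> complex) \<Rightarrow> nat \<Rightarrow> complex \<Rightarrow> nat \<Rightarrow> nat \<Rightarrow> complex" where
  "circulant_entry d a N z i j = (\<Sum>k\<le>d. if j = (i + k) mod N then a k else 0) - (if i
      = j then z else 0)"

definition coeff_sum :: "nat \<Rightarrow> (nat \<Rightarrow> complex) \<Rightarrow> real" where
  "coeff_sum d a = (\<Sum>k\<le>d. norm (a k))"

lemma coeff_sum_nonneg: "coeff_sum d a \<ge> 0"
  by (simp add: coeff_sum_def sum_nonneg)

lemma norm_dft [simp]: "norm (dft N j r) = 1"
  by (simp add: dft_def norm_power)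

lemma norm_symbol_le: "norm u = 1 \<Longrightarrow> norm (symbol d a u) \<le> coeff_sum d a"
  unfolding symbol_def coeff_sum_def by (intro sum_norm_le) (simp add: norm_mult norm_power)

lemma root_power_N:
  assumes "N > 0" shows "cis (2 * pi * real r / real N) ^ N = 1"
proof -
  have "real N * (2 * pi * real r / real N) = 2 * pi * real r" using assms by simp
  then show ?thesis using cis_multiple_2pi[OF Ints_of_nat, of r] by (simp add: Complex.DeMoivre)
qed

lemma dft_mod: "N > 0 \<Longrightarrow> dft N (m mod N) r = dft N m r"
proof -
  assume N: "N > 0"
  have "dft N m r = cis (2 * pi * real r / real N) ^ (N * (m div N) + m mod N)"
    by (simp add: dft_def)
  also have "\<dots> = dft N (m mod N) r"
    unfolding power_add power_mult root_power_N[OF N] by (simp add: dft_def)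
  finally show ?thesis by simp
qed

lemma dft_orthogonal:
  assumes "N > 0" "r < N" "s < N"
  shows "(\<Sum>j<N. dft N j r * cnj (dft N j s)) = (if r = s then of_nat N else 0)"
proof -
  define u where "u = (\<lambda>r. cis (2 * pi * real r / real N))"
  define z where "z = u r * cnj (u s)"
  have n: "u s * cnj (u s) = 1" for s by (simp add: u_def cis_cnj cis_mult)
  have eq: "dft N j r * cnj (dft N j s) = z ^ j" for j
    by (simp add: dft_def z_def u_def power_mult_distrib)
  have zN: "z ^ N = 1"
    using root_power_N[OF assms(1), of r] root_power_N[OF assms(1), of s]
    unfolding z_def power_mult_distrib complex_cnj_power[symmetric] by (simp add: u_def)
  have "z \<noteq> 1" if "r \<noteq> s"
  proof
    assume "z = 1"
    then have "u r * (cnj (u s) * u s) = u s" by (simp add: z_def mult.assoc[symmetric])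
    then have "u r = u s" using n[of s] by (simp add: mult.commute)
    moreover have "inj_on u {..<N}"
      using Complex.bij_betw_roots_unity[OF assms(1)] by (simp add: bij_betw_def u_def)
    ultimately show False using that assms by (auto dest: inj_onD)
  qed
  then show ?thesis
    unfolding eq using n[of r] geometric_sum[of z N] zN by (auto simp: z_def)
qed

text \<open>The columns of the Fourier matrix are orthogonal and of norm \<open>sqrt N\<close>.\<close>

lemma norm_fdet_dft:
  assumes "N > 0" shows "norm (fdet N (dft N)) = sqrt N ^ N"
proof -
  have "fdet N (dft N) * cnj (fdet N (dft N))
      = fdet N (\<lambda>i k. dft N k i) * fdet N (\<lambda>k j. cnj (dft N k j))"
    by (simp only: fdet_cnj fdet_transpose[of N "dft N"])
  also have "\<dots> = fdet N (\<lambda>i j. \<Sum>k<N. dft N k i * cnj (dft N k j))"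
    by (rule fdet_mult[symmetric])
  also have "\<dots> = fdet N (\<lambda>i j. if i = j then of_nat N else 0)"
    by (rule fdet_cong) (use assms dft_orthogonal in auto)
  also have "\<dots> = of_nat N ^ N" by (simp add: fdet_diag)
  finally have "complex_of_real ((norm (fdet N (dft N)))\<^sup>2) = of_real (real N ^ N)"
    by (simp add: complex_norm_square[symmetric] del: of_real_power) simp
  then have "(norm (fdet N (dft N)))\<^sup>2 = real N ^ N" by (simp only: of_real_eq_iff)
  also have "\<dots> = ((sqrt N)\<^sup>2) ^ N" by simp
  also have "\<dots> = (sqrt N ^ N)\<^sup>2" by (simp only: power_mult[symmetric] mult.commute[of N 2])
  finally show ?thesis by (simp add: power2_eq_iff_nonneg)
qed

text \<open>The columns of the Fourier matrix are eigenvectors of every circulant matrix.\<close>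

lemma circulant_dft:
  assumes "N > 0" "i < N"
  shows "(\<Sum>j<N. circulant_entry d a N z i j * dft N j r) = dft N i r * (nodes d a N r - z)"
proof -
  have m: "(i + k) mod N < N" for k using assms by auto
  have "(\<Sum>j<N. circulant_entry d a N z i j * dft N j r) =
      (\<Sum>j<N. (\<Sum>k\<le>d. if j = (i + k) mod N then a k * dft N j r else 0) - (if i
          = j then z * dft N j r else 0))"
    by (intro sum.cong refl) (auto simp: circulant_entry_def sum_distrib_right left_diff_distrib
        if_distrib[of "\<lambda>x. x * _"] intro!: sum.cong cong: if_cong)
  also have "\<dots> = (\<Sum>j<N. \<Sum>k\<le>d. if j = (i + k) mod N then a k * dft N j r else 0) - (if i < N then z * dft
      N i r else 0)"
    by (simp add: sum_subtractf)
  also have "(\<Sum>j<N. \<Sum>k\<le>d. if j = (i + k) mod N then a k * dft N j r else 0) =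
      (\<Sum>k\<le>d. \<Sum>j<N. if j = (i + k) mod N then a k * dft N j r else 0)"
    by (rule sum.swap)
  also have "\<dots> = (\<Sum>k\<le>d. a k * dft N (i + k) r)"
    using m by (simp add: dft_mod[OF assms(1)])
  also have "\<dots> = dft N i r * nodes d a N r"
    by (simp add: dft_def nodes_def symbol_def power_add sum_distrib_left mult_ac)
  finally show ?thesis using assms by (simp add: algebra_simps)
qed

lemma fdet_circulant:
  assumes "N > 0"
  shows "fdet N (circulant_entry d a N z) = (\<Prod>r<N. nodes d a N r - z)"
proof -
  have "fdet N (circulant_entry d a N z) * fdet N (dft N)
      = fdet N (\<lambda>i r. \<Sum>j<N. circulant_entry d a N z i j * dft N j r)"
    by (rule fdet_mult[symmetric])
  also have "\<dots> = fdet N (\<lambda>i r. dft N i r * (nodes d a N r - z))"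
    by (rule fdet_cong) (simp add: circulant_dft[OF assms])
  also have "\<dots> = fdet N (dft N) * (\<Prod>r<N. nodes d a N r - z)"
    by (rule fdet_scale_columns)
  finally have "fdet N (circulant_entry d a N z) * fdet N (dft N)
      = (\<Prod>r<N. nodes d a N r - z) * fdet N (dft N)"
    by (simp only: mult.commute)
  moreover have "fdet N (dft N) \<noteq> 0" using norm_fdet_dft[OF assms] assms
      by (metis norm_eq_zero of_nat_0_less_iff power_not_zero real_sqrt_gt_0_iff less_irrefl)
  ultimately show ?thesis by simp
qed

text \<open>The Hadamard inequality for \<open>x F\<close>, where \<open>F\<close> is the Fourier matrix. Column \<open>r\<close> of \<open>x F\<close> is an
eigenvector of the circulant matrix times its eigenvalue, plus the image of that vector under the
difference of \<open>x\<close> and the circulant matrix; the norms \<open>sqrt N\<close> of the eigenvectors cancel against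
\<open>|det F|\<close>.\<close>

lemma norm_fdet_le_fourier:
  assumes "N > 0"
  shows "norm (fdet N x) \<le> (\<Prod>r<N. norm (nodes d a N r - z)
      + L2_set (\<lambda>i. norm (\<Sum>j<N. (x i j - circulant_entry d a N z i j) * dft N j r)) {..<N} / sqrt N)"
proof -
  define R where "R r = L2_set (\<lambda>i. norm (\<Sum>j<N. (x i j - circulant_entry d a N z i j) * dft N j r))
      {..<N}" for r
  have N: "sqrt N > 0" using assms by simp
  have "(norm (fdet N x) * sqrt N ^ N)\<^sup>2 = (norm (fdet N x * fdet N (dft N)))\<^sup>2"
    by (simp add: norm_mult norm_fdet_dft[OF assms])
  also have "fdet N x * fdet N (dft N) = fdet N (\<lambda>i r. \<Sum>j<N. x i j * dft N j r)"
    by (rule fdet_mult[symmetric])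
  also have "(norm \<dots>)\<^sup>2 \<le> (\<Prod>r<N. \<Sum>i<N. (norm (\<Sum>j<N. x i j * dft N j r))\<^sup>2)"
    by (rule hadamard_columns)
  also have "\<dots> \<le> (\<Prod>r<N. (norm (nodes d a N r - z) * sqrt N + R r)\<^sup>2)"
  proof (intro prod_mono conjI sum_nonneg zero_le_power2)
    fix r assume "r \<in> {..<N}"
    have "(\<Sum>j<N. x i j * dft N j r) = (nodes d a N r - z) * dft N i r + (\<Sum>j<N. (x i j - circulant_entry
        d a N z i j) * dft N j r)"
      if "i < N" for i
      unfolding left_diff_distrib[of "x i _"] sum_subtractf circulant_dft[OF assms that] by simp
    then have "L2_set (\<lambda>i. norm (\<Sum>j<N. x i j * dft N j r)) {..<N}
        \<le> L2_set (\<lambda>i. norm (nodes d a N r - z) + norm (\<Sum>j<N. (x i j - circulant_entry d a N z i j) * dft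
            N j r)) {..<N}"
      by (intro L2_set_mono) (auto intro!: order_trans[OF norm_triangle_ineq] simp: norm_mult)
    also have "\<dots> \<le> L2_set (\<lambda>i. norm (nodes d a N r - z)) {..<N} + R r"
      unfolding R_def by (rule L2_set_triangle_ineq)
    also have "L2_set (\<lambda>i. norm (nodes d a N r - z)) {..<N} = norm (nodes d a N r - z) * sqrt N"
      by (simp add: L2_set_def real_sqrt_mult)
    finally have "(L2_set (\<lambda>i. norm (\<Sum>j<N. x i j * dft N j r)) {..<N})\<^sup>2
        \<le> (norm (nodes d a N r - z) * sqrt N + R r)\<^sup>2"
      by (intro power_mono) (auto simp: L2_set_nonneg)
    then show "(\<Sum>i<N. (norm (\<Sum>j<N. x i j * dft N j r))\<^sup>2) \<le> (norm (nodes d a N r - z) * sqrt N + R r)\<^sup>2"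
      by (simp add: L2_set_def sum_nonneg)
  qed
  also have "\<dots> = (\<Prod>r<N. norm (nodes d a N r - z) * sqrt N + R r)\<^sup>2"
    by (rule prod_power_distrib[symmetric])
  finally have "norm (fdet N x) * sqrt N ^ N \<le> (\<Prod>r<N. norm (nodes d a N r - z) * sqrt N + R r)"
    by (rule power2_le_imp_le) (auto intro!: prod_nonneg add_nonneg_nonneg simp: R_def L2_set_nonneg)
  also have "\<dots> = (\<Prod>r<N. (norm (nodes d a N r - z) + R r / sqrt N) * sqrt N)"
    using N by (intro prod.cong refl) (simp add: distrib_right)
  also have "\<dots> = (\<Prod>r<N. norm (nodes d a N r - z) + R r / sqrt N) * sqrt N ^ N"
    by (simp add: prod.distrib)
  finally show ?thesis using N by (simp add: R_def)
qed

lemma toeplitz_eq_circulant: "i + d < N \<Longrightarrow> toeplitz_entry d a z i j = circulant_entry d a N z i j"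
  by (auto simp: toeplitz_entry_def circulant_entry_def intro!: sum.cong)

text \<open>The two matrices differ only by the entries of the circulant matrix that wrap around, and these lie
in the last \<open>d\<close> rows.\<close>

lemma norm_toeplitz_minus_circulant_dft:
  assumes "N > 0" "i < N"
  shows "norm (\<Sum>j<N. (toeplitz_entry d a z i j - circulant_entry d a N z i j) * dft N j r)
      \<le> (if i + d < N then 0 else coeff_sum d a)"
proof (cases "i + d < N")
  case True
  then show ?thesis by (simp add: toeplitz_eq_circulant)
next
  case False
  have m: "(i + k) mod N < N" for k using assms by auto
  have "norm (toeplitz_entry d a z i j - circulant_entry d a N z i j) \<le> (\<Sum>k\<le>d. if j
      = (i + k) mod N then norm (a k) else 0)" if "j < N" for j
  proof -
    have "toeplitz_entry d a z i j - circulant_entry d a N z i j = (\<Sum>k\<le>d. (if j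
        = i + k then a k else 0) - (if j = (i + k) mod N then a k else 0))"
      by (simp add: toeplitz_entry_def circulant_entry_def sum_subtractf)
    also have "norm \<dots> \<le> (\<Sum>k\<le>d. if j = (i + k) mod N then norm (a k) else 0)"
      by (rule sum_norm_le) (use that in auto)
    finally show ?thesis .
  qed
  then have "norm (\<Sum>j<N. (toeplitz_entry d a z i j - circulant_entry d a N z i j) * dft N j r)
      \<le> (\<Sum>j<N. \<Sum>k\<le>d. if j = (i + k) mod N then norm (a k) else 0)"
    by (intro sum_norm_le) (auto simp: norm_mult)
  also have "\<dots> = (\<Sum>k\<le>d. \<Sum>j<N. if j = (i + k) mod N then norm (a k) else 0)"
    by (rule sum.swap)
  also have "\<dots> = coeff_sum d a" using m by (simp add: coeff_sum_def)
  finally show ?thesis using False by simp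
qed

lemma norm_fdet_toeplitz_le:
  assumes N: "N > 0" and \<delta>: "\<delta> \<ge> 0"
  shows "norm (fdet N (\<lambda>i j. toeplitz_entry d a z i j + of_real \<delta> * g i j))
      \<le> (\<Prod>r<N. norm (nodes d a N r - z)
      + (sqrt d * coeff_sum d a + \<delta> * L2_set (\<lambda>i. norm (\<Sum>j<N. g i j * dft N j r)) {..<N}) / sqrt N)"
proof -
  have "L2_set (\<lambda>i. norm (\<Sum>j<N. (toeplitz_entry d a z i j + of_real \<delta> * g i j - circulant_entry d a N z
      i j) * dft N j r)) {..<N}
      \<le> sqrt d * coeff_sum d a + \<delta> * L2_set (\<lambda>i. norm (\<Sum>j<N. g i j * dft N j r)) {..<N}" for r
  proof -
    have eq: "(\<Sum>j<N. (toeplitz_entry d a z i j + of_real \<delta> * g i j - circulant_entry d a N z i j) * dft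
        N j r) =
       (\<Sum>j<N. (toeplitz_entry d a z i j - circulant_entry d a N z i j) * dft N j r) + of_real \<delta> * (\<Sum>j<N.
           g i j * dft N j r)" for i
      by (simp add: sum_distrib_left sum.distrib[symmetric] algebra_simps)
    have "L2_set (\<lambda>i. norm (\<Sum>j<N. (toeplitz_entry d a z i j + of_real \<delta> * g i j - circulant_entry d a N
        z i j) * dft N j r)) {..<N}
      \<le> L2_set (\<lambda>i. (if i + d < N then 0 else coeff_sum d a) + \<delta> * norm (\<Sum>j<N. g i j * dft N j r))
          {..<N}"
      unfolding eq
      by (intro L2_set_mono norm_triangle_mono norm_toeplitz_minus_circulant_dft[OF N]) (auto simp:
          norm_mult \<delta>)
    also have "\<dots> \<le> L2_set (\<lambda>i. if i + d < N then 0 else coeff_sum d a) {..<N} + L2_set (\<lambda>i. \<delta> * norm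
        (\<Sum>j<N. g i j * dft N j r)) {..<N}"
      by (rule L2_set_triangle_ineq)
    also have "L2_set (\<lambda>i. \<delta> * norm (\<Sum>j<N. g i j * dft N j r)) {..<N}
        = \<delta> * L2_set (\<lambda>i. norm (\<Sum>j<N. g i j * dft N j r)) {..<N}"
      using \<delta> by (rule L2_set_right_distrib[symmetric])
    also have "L2_set (\<lambda>i. if i + d < N then 0 else coeff_sum d a) {..<N} \<le> sqrt d * coeff_sum d a"
    proof -
      have "(\<Sum>i<N. (if i + d < N then 0 else coeff_sum d a)\<^sup>2) = (\<Sum>i\<in>{N - d..<N}. (coeff_sum d a)\<^sup>2)"
        by (rule sum.mono_neutral_cong_right) auto
      also have "\<dots> \<le> d * (coeff_sum d a)\<^sup>2"
        by (simp add: mult_right_mono)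
      finally have "sqrt (\<Sum>i<N. (if i + d < N then 0 else coeff_sum d a)\<^sup>2)
          \<le> sqrt (d * (coeff_sum d a)\<^sup>2)"
        by (rule real_sqrt_le_mono)
      then show ?thesis by (simp add: L2_set_def real_sqrt_mult coeff_sum_nonneg)
    qed
    finally show ?thesis by simp
  qed
  then have "(\<Prod>r<N. norm (nodes d a N r - z)
      + L2_set (\<lambda>i. norm (\<Sum>j<N. ((toeplitz_entry d a z i j + of_real \<delta> * g i j) - circulant_entry d a N
          z i j) * dft N j r)) {..<N} / sqrt N)
    \<le> (\<Prod>r<N. norm (nodes d a N r - z)
      + (sqrt d * coeff_sum d a + \<delta> * L2_set (\<lambda>i. norm (\<Sum>j<N. g i j * dft N j r)) {..<N}) / sqrt N)"
    by (intro prod_mono conjI add_nonneg_nonneg add_left_mono divide_right_mono) (auto simp: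
        L2_set_nonneg)
  with norm_fdet_le_fourier[OF N, of "\<lambda>i j. toeplitz_entry d a z i j + of_real \<delta> * g i j"] show ?thesis
    by (rule order_trans)
qed

lemma sum_norm_circulant_le:
  assumes "N > 0" "i < N"
  shows "(\<Sum>j<N. norm (circulant_entry d a N z i j)) \<le> coeff_sum d a + norm z"
proof -
  have m: "(i + k) mod N < N" for k using assms by auto
  have "(\<Sum>j<N. norm (circulant_entry d a N z i j)) \<le> (\<Sum>j<N. (\<Sum>k\<le>d. if j
      = (i + k) mod N then norm (a k) else 0) + (if i = j then norm z else 0))"
    unfolding circulant_entry_def
    by (intro sum_mono order_trans[OF norm_triangle_ineq4] add_mono order_trans[OF norm_sum]) (auto
        intro!: sum_mono)
  also have "\<dots> = (\<Sum>j<N. \<Sum>k\<le>d. if j = (i + k) mod N then norm (a k) else 0) + norm z"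
    using assms by (simp add: sum.distrib)
  also have "(\<Sum>j<N. \<Sum>k\<le>d. if j = (i + k) mod N then norm (a k) else 0) = (\<Sum>k\<le>d. \<Sum>j<N. if j
      = (i + k) mod N then norm (a k) else 0)"
    by (rule sum.swap)
  also have "(\<Sum>k\<le>d. \<Sum>j<N. if j = (i + k) mod N then norm (a k) else 0) = coeff_sum d a"
    using m by (simp add: coeff_sum_def)
  finally show ?thesis .
qed

text \<open>This produces the large coefficient of the noisy determinant: the right-hand side is the Toeplitz
determinant in which one entry is extracted from each of the last \<open>d\<close> rows. Since only these rows
distinguish the Toeplitz from the circulant matrix, it can be compared with \<open>det (C - z)\<close>.\<close>

lemma prod_nodes_le_minor:
  assumes N: "N > 0"
  shows "\<exists>c. (\<forall>i\<in>{N - d..<N}. c i < N) \<and>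
    norm (\<Prod>r<N. nodes d a N r - z) \<le> (1 + coeff_sum d a + norm z) ^ d *
      norm (fdet N (\<lambda>i. if i \<in> {N - d..<N} then unit_row (c i) else toeplitz_entry d a z i))"
proof -
  define K where "K = 1 + coeff_sum d a + norm z"
  have K: "K \<ge> 1" using coeff_sum_nonneg[of d a] by (simp add: K_def add_nonneg_nonneg)
  have "\<exists>c. (\<forall>i\<in>{N - d..<N}. c i < N) \<and> norm (fdet N (circulant_entry d a N z))
      \<le> K ^ card {N - d..<N} * norm (fdet N (\<lambda>i.
      if i \<in> {N - d..<N} then unit_row (c i) else circulant_entry d a N z i))"
    by (rule fdet_le_unit_rows) (use sum_norm_circulant_le[OF N, of _ d a z] in \<open>fastforce simp:
        K_def\<close>)+
  then obtain c where c: "\<forall>i\<in>{N - d..<N}. c i < N"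
    and le: "norm (fdet N (circulant_entry d a N z)) \<le> K ^ card {N - d..<N} * norm (fdet N (\<lambda>i.
        if i \<in> {N - d..<N} then unit_row (c i) else circulant_entry d a N z i))"
    by auto
  have "fdet N (\<lambda>i. if i \<in> {N - d..<N} then unit_row (c i) else circulant_entry d a N z i) = fdet N (\<lambda>i.
      if i \<in> {N - d..<N} then unit_row (c i) else toeplitz_entry d a z i)"
    by (rule fdet_cong) (auto simp: toeplitz_eq_circulant not_le less_diff_conv)
  with le have "norm (fdet N (circulant_entry d a N z)) \<le> K ^ card {N - d..<N} * norm (fdet N (\<lambda>i.
      if i \<in> {N - d..<N} then unit_row (c i) else toeplitz_entry d a z i))"
    by simp
  also have "\<dots> \<le> K ^ d * norm (fdet N (\<lambda>i. if i \<in> {N - d..<N} then unit_row (c i) else toeplitz_entry d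
      a z i))"
    using K by (intro mult_right_mono power_increasing) auto
  finally have "norm (fdet N (circulant_entry d a N z)) \<le> K ^ d * norm (fdet N (\<lambda>i.
      if i \<in> {N - d..<N} then unit_row (c i) else toeplitz_entry d a z i))" .
  then show ?thesis using c unfolding fdet_circulant[OF N] K_def by blast
qed

lemma shift_mat_power: "shift_mat N ^\<^sub>m k = mat N N (\<lambda>(i, j). if j = i + k then 1 else 0)"
proof (induction k)
  case 0
  show ?case
    by (rule eq_matI) (auto simp: shift_mat_def)
next
  case (Suc k)
  have step: "shift_mat N ^\<^sub>m Suc k = mat N N (\<lambda>(i, j). if j = i + k then 1 else 0) * shift_mat N"
    unfolding Suc[symmetric] by simp
  have entry: "(shift_mat N ^\<^sub>m Suc k) $$ (i, j) = (if j = i + Suc k then 1 else 0)"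
      if ij: "i < N" "j < N" for i j
  proof -
    have "(shift_mat N ^\<^sub>m Suc k) $$ (i, j) = (\<Sum>l<N. (if l = i + k then 1 else 0) * (if j
        = l + 1 then 1 else 0))"
      unfolding step using ij by (simp add: shift_mat_def scalar_prod_def atLeast0LessThan)
    also have "\<dots> = (\<Sum>l<N. if l = i + k then (if j = l + 1 then 1 else 0) else 0)"
      by (intro sum.cong) auto
    also have "\<dots> = (if j = i + Suc k then 1 else 0)" using ij by auto
    finally show ?thesis .
  qed
  show ?case
    by (rule eq_matI) (auto simp: entry simp del: pow_mat.simps, auto simp: step shift_mat_def simp del:
        pow_mat.simps)
qed

lemma toeplitz_mat_eq: "toeplitz_mat d a N = mat N N (\<lambda>(i, j). toeplitz_entry d a 0 i j)"
proof (rule eq_matI)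
  fix i j assume "i < dim_row (mat N N (\<lambda>(i, j). toeplitz_entry d a 0 i j))" "j < dim_col (mat N N (\<lambda>(i,
      j). toeplitz_entry d a 0 i j))"
  then have ij: "i < N" "j < N" by auto
  have "toeplitz_mat d a N $$ (i, j) = (\<Sum>k\<le>d. a k * (if j = i + k then 1 else 0))"
    using ij by (simp add: toeplitz_mat_def shift_mat_power)
  also have "\<dots> = (\<Sum>k\<le>d. if j = i + k then a k else 0)"
    by (rule sum.cong) auto
  finally show "toeplitz_mat d a N $$ (i, j) = mat N N (\<lambda>(i, j). toeplitz_entry d a 0 i j) $$ (i, j)"
    using ij by (simp add: toeplitz_entry_def)
qed (simp_all add: toeplitz_mat_def)

section \<open>Coefficients of Gaussian determinants\<close>

lemma singular_1d: 
  assumes "R > 0"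
  shows "(\<integral>\<^sup>+x. ennreal (indicator {-R..R} x * \<bar>x\<bar> powr (-1/2)) \<partial>lborel) < \<infinity>"
proof -
  let ?f = "\<lambda>x::real. ennreal (indicator {0..R} x * x powr (-1/2))"
  have fin: "(\<integral>\<^sup>+x. ?f x \<partial>lborel) < \<infinity>"
  proof -
    have "((\<lambda>x. x powr (-1/2)) has_integral (R powr (-1/2 + 1) / (-1/2 + 1))) {0..R}"
      by (rule has_integral_powr_from_0) (use assms in auto)
    then have "((\<lambda>x. indicator {0..R} x * x powr (-1/2)) has_integral (R powr (-1/2 + 1) / (-1/2 + 1)))
        UNIV"
      by (subst (asm) has_integral_restrict_UNIV[symmetric]) (auto elim!: has_integral_eq[rotated]
          split: split_indicator)
    then have "(\<integral>\<^sup>+x. ?f x \<partial>lborel) = ennreal (R powr (-1/2 + 1) / (-1/2 + 1))"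
      by (intro nn_integral_has_integral_lborel) auto
    then show ?thesis by simp
  qed
  have "(\<integral>\<^sup>+x. ennreal (indicator {-R..R} x * \<bar>x\<bar> powr (-1/2)) \<partial>lborel)
      \<le> (\<integral>\<^sup>+x. ?f x + ?f (0 + (-1) * x) \<partial>lborel)"
    by (intro nn_integral_mono) (auto split: split_indicator)
  also have "\<dots> = (\<integral>\<^sup>+x. ?f x \<partial>lborel) + (\<integral>\<^sup>+x. ?f (0 + (-1) * x) \<partial>lborel)"
    by (rule nn_integral_add) auto
  also have "(\<integral>\<^sup>+x. ?f (0 + (-1) * x) \<partial>lborel) = (\<integral>\<^sup>+x. ?f x \<partial>lborel)"
    using nn_integral_real_affine[of ?f "-1" 0] by simp
  finally show ?thesis by (rule le_less_trans) (use fin in \<open>simp add: less_top[symmetric]\<close>)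
qed

text \<open>A locally integrable majorant, up to a factor 2, of \<open>- ln |z|\<close>. Its value at 0 is 0, in agreement
with \<open>ln 0 = 0\<close>.\<close>

definition sing :: "complex \<Rightarrow> real" where "sing z = 1 / sqrt (norm z)"

lemma cball_borel [measurable]: "cball (a::complex) r \<in> sets borel"
  by simp

lemma sing_nonneg [simp]: "sing z \<ge> 0" by (simp add: sing_def)

lemma sing_measurable [measurable]: "sing \<in> borel_measurable borel"
  unfolding sing_def[abs_def] by simp

definition sing_mass :: "real \<Rightarrow> ennreal" where
  "sing_mass R = (\<integral>\<^sup>+z. ennreal (sing z) * indicator (cball 0 R) z \<partial>lborel)"

text \<open>As \<open>|Re z| \<le> |z|\<close>, the integral is dominated by a product of one-dimensional integrals over an
interval.\<close>

lemma sing_mass_finite: "sing_mass R < \<infinity>"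
proof (cases "R > 0")
  case True
  define f :: "complex \<Rightarrow> real \<Rightarrow> ennreal" where
    "f b x = (if b = 1 then (if x = 0 then \<infinity> else ennreal (indicator {-R..R} x * \<bar>x\<bar> powr (-1/2))) else
        indicator {-R..R} x)" for b x
  have [measurable]: "f b \<in> borel_measurable borel" for b unfolding f_def[abs_def] by (cases "b
      = 1") auto
  have "sing_mass R \<le> (\<integral>\<^sup>+z. (\<Prod>b\<in>Basis. f b (z \<bullet> b)) \<partial>lborel)"
    unfolding sing_mass_def
  proof (intro nn_integral_mono)
    fix z :: complex
    have p: "(\<Prod>b\<in>Basis. f b (z \<bullet> b)) = f 1 (Re z) * f \<i> (Im z)"
      by (simp add: Basis_complex_def inner_complex_def)
    show "ennreal (sing z) * indicator (cball 0 R) z \<le> (\<Prod>b\<in>Basis. f b (z \<bullet> b))"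
    proof (cases "norm z \<le> R")
      case True
      have ab: "\<bar>Re z\<bar> \<le> R" "\<bar>Im z\<bar> \<le> R" using True abs_Re_le_cmod[of z] abs_Im_le_cmod[of z]
          by linarith+
      then have i: "f \<i> (Im z) = 1" by (auto simp: f_def complex_eq_iff abs_le_iff split:
          split_indicator)
      show ?thesis
      proof (cases "Re z = 0")
        case True
        then show ?thesis by (simp add: p i) (simp add: f_def)
      next
        case False
        have "sing z \<le> \<bar>Re z\<bar> powr (-1/2)"
        proof -
          have "\<bar>Re z\<bar> powr (-1/2) = 1 / sqrt \<bar>Re z\<bar>"
            using powr_minus_divide[of "\<bar>Re z\<bar>" "1/2"] powr_half_sqrt[of "\<bar>Re z\<bar>"] by simp
          moreover have "1 / sqrt (norm z) \<le> 1 / sqrt \<bar>Re z\<bar>"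
            using False abs_Re_le_cmod[of z] by (intro divide_left_mono mult_pos_pos) (auto simp:
                complex_eq_iff)
          ultimately show ?thesis by (simp add: sing_def)
        qed
        then show ?thesis using True False ab
            by (simp add: p i) (auto simp: f_def abs_le_iff intro!: ennreal_leI split: split_indicator)
      qed
    qed simp
  qed
  also have "\<dots> = (\<Prod>b\<in>Basis. \<integral>\<^sup>+x. f b x \<partial>lborel)"
    by (rule nn_integral_lborel_prod) auto
  also have "\<dots> = (\<integral>\<^sup>+x. f 1 x \<partial>lborel) * (\<integral>\<^sup>+x. f \<i> x \<partial>lborel)"
    by (simp add: Basis_complex_def)
  also have "(\<integral>\<^sup>+x. f 1 x \<partial>lborel) = (\<integral>\<^sup>+x. ennreal (indicator {-R..R} x * \<bar>x\<bar> powr (-1/2)) \<partial>lborel)"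
    by (intro nn_integral_cong_AE) (use AE_lborel_singleton[of "0::real"] in \<open>auto elim!:
        eventually_mono simp: f_def\<close>)
  also have "(\<integral>\<^sup>+x. f \<i> x \<partial>lborel) = ennreal (2 * R)"
    using \<open>R > 0\<close> by (simp add: f_def complex_eq_iff)
  finally show ?thesis
    by (rule le_less_trans) (use singular_1d[OF True] in \<open>simp add: ennreal_mult_less_top\<close>)
next
  case False
  have "sing_mass R \<le> (\<integral>\<^sup>+z. 0 \<partial>(lborel :: complex measure))"
    unfolding sing_mass_def
  proof (intro nn_integral_mono)
    fix z :: complex
    show "ennreal (sing z) * indicator (cball 0 R) z \<le> 0"
    proof (cases "norm z \<le> R")
      case True
      with False have "norm z \<le> 0" by linarith
      then show ?thesis by (simp add: sing_def)
    qed simp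
  qed
  then show ?thesis by simp
qed

text \<open>As \<open>ennreal\<close> sends negative numbers to 0, only the unit disc contributes.\<close>

definition log_sing :: ennreal where
  "log_sing = (\<integral>\<^sup>+z. ennreal (- 2 * ln (norm (z::complex))) \<partial>lborel)"

lemma minus_ln_le_sing: "0 < norm z \<Longrightarrow> - ln (norm z) \<le> 2 * sing z"
proof -
  assume z: "0 < norm z"
  have "ln (sing z) \<le> sing z" using z by (intro ln_bound) (auto simp: sing_def)
  moreover have "ln (sing z) = - ln (norm z) / 2"
    using z by (simp add: sing_def ln_div ln_sqrt)
  ultimately show ?thesis by simp
qed

lemma log_sing_finite: "log_sing < \<infinity>"
proof -
  have "log_sing \<le> (\<integral>\<^sup>+z. ennreal 4 * (ennreal (sing z) * indicator (cball 0 1) z) \<partial>lborel)"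
    unfolding log_sing_def
  proof (intro nn_integral_mono)
    fix z :: complex
    show "ennreal (- 2 * ln (norm z)) \<le> ennreal 4 * (ennreal (sing z) * indicator (cball 0 1) z)"
    proof (cases "norm z \<le> 1 \<and> z \<noteq> 0")
      case True
      then have "- 2 * ln (norm z) \<le> 4 * sing z" using minus_ln_le_sing[of z] by auto
      then show ?thesis using True by (auto simp: ennreal_mult[symmetric] intro!: ennreal_leI simp del:
          ennreal_numeral)
    next
      case False
      then have "- 2 * ln (norm z) \<le> 0" by auto
      then show ?thesis by (simp add: ennreal_neg del: mult_minus_left)
    qed
  qed
  also have "\<dots> = ennreal 4 * sing_mass 1"
    unfolding sing_mass_def by (rule nn_integral_cmult) measurable
  also have "\<dots> < \<infinity>" using sing_mass_finite[of 1]
      by (simp add: ennreal_mult_less_top del: ennreal_numeral)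
  finally show ?thesis .
qed

text \<open>The Gaussian measure is rotation invariant, so \<open>y\<close> may be averaged over circles first.\<close>

lemma gauss_drop:
  assumes t: "t \<ge> 0"
  shows "ennreal (ln (1 + t * (norm a)\<^sup>2)) \<le> (\<integral>\<^sup>+y. ennreal (ln (1 + t * (norm (a + b * y))\<^sup>2))
      \<partial>cgauss)"
proof -
  interpret S: prob_space uniform_unit_circle by (rule prob_space_uniform_unit_circle)
  interpret C: prob_space cgauss by (rule prob_space_cgauss)
  interpret pair_sigma_finite cgauss uniform_unit_circle ..
  define F where "F y = ennreal (ln (1 + t * (norm (a + b * y))\<^sup>2))" for y
  have [measurable]: "F \<in> borel_measurable borel" unfolding F_def[abs_def] by simp
  have "ennreal (ln (1 + t * (norm a)\<^sup>2)) = (\<integral>\<^sup>+y. ennreal (ln (1 + t * (norm a)\<^sup>2)) \<partial>cgauss)"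
    using C.emeasure_space_1 by simp
  also have "\<dots> \<le> (\<integral>\<^sup>+y. \<integral>\<^sup>+u. F (u * y) \<partial>uniform_unit_circle \<partial>cgauss)"
    using ln_one_plus_le_circle_mean[OF t, of a "b * _"]
        by (intro nn_integral_mono) (simp add: F_def mult_ac)
  also have "\<dots> = (\<integral>\<^sup>+u. \<integral>\<^sup>+y. F (u * y) \<partial>cgauss \<partial>uniform_unit_circle)"
    by (rule Fubini'[symmetric]) simp
  also have "\<dots> = (\<integral>\<^sup>+u. \<integral>\<^sup>+y. F y \<partial>cgauss \<partial>uniform_unit_circle)"
    by (intro nn_integral_cong_AE) (use AE_uniform_unit_circle nn_integral_cgauss_rotate[of F] in \<open>auto
        elim!: eventually_mono\<close>)
  also have "\<dots> = (\<integral>\<^sup>+y. F y \<partial>cgauss)" using S.emeasure_space_1 by simp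
  finally show ?thesis by (simp add: F_def)
qed

text \<open>Write \<open>a + b y = b (c + y)\<close>. Where \<open>|c + y| < 1\<close> the factor \<open>|c + y|\<close> costs at most \<open>- 2 ln |c +
y|\<close>, and since the Gaussian density is bounded by 1 the mean of this is bounded by the same integral
for every \<open>c\<close>.\<close>

lemma gauss_take:
  assumes t: "t \<ge> 0"
  shows "ennreal (ln (1 + t * (norm b)\<^sup>2)) \<le> (\<integral>\<^sup>+y. ennreal (ln (1 + t * (norm (a + b * y))\<^sup>2)) \<partial>cgauss)
      + log_sing"
proof (cases "b = 0")
  case False
  interpret C: prob_space cgauss by (rule prob_space_cgauss)
  define c where "c = a / b"
  have AE: "AE y in cgauss. y \<noteq> - c"
    unfolding cgauss_def using AE_lborel_singleton[of "- c"]
        by (subst AE_density) (auto elim!: eventually_mono)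
  have "ennreal (ln (1 + t * (norm b)\<^sup>2)) = (\<integral>\<^sup>+y. ennreal (ln (1 + t * (norm b)\<^sup>2)) \<partial>cgauss)"
    using C.emeasure_space_1 by simp
  also have "\<dots> \<le> (\<integral>\<^sup>+y. ennreal (ln (1 + t * (norm (a + b * y))\<^sup>2)) + ennreal (- 2 * ln (norm (c + y)))
      \<partial>cgauss)"
  proof (intro nn_integral_mono_AE, use AE in eventually_elim)
    fix y assume "y \<noteq> - c"
    then have n: "norm (c + y) > 0" by (auto simp: add_eq_0_iff)
    have eq: "norm (a + b * y) = norm b * norm (c + y)"
      using False by (simp add: c_def norm_mult[symmetric] distrib_left)
    define s where "s = norm (c + y)"
    have "ln (1 + t * (norm b)\<^sup>2) \<le> ln (1 + t * (norm b * s)\<^sup>2) + max 0 (- 2 * ln s)"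
    proof (cases "s \<ge> 1")
      case True
      have "(norm b)\<^sup>2 \<le> (norm b * s)\<^sup>2" using True
          by (intro power_mono) (auto simp: mult_le_cancel_left1)
      then have "1 + t * (norm b)\<^sup>2 \<le> 1 + t * (norm b * s)\<^sup>2" using t by (simp add: mult_left_mono)
      then have "ln (1 + t * (norm b)\<^sup>2) \<le> ln (1 + t * (norm b * s)\<^sup>2)"
        using t by (subst ln_le_cancel_iff) (auto simp: add_pos_nonneg)
      then show ?thesis by linarith
    next
      case s1: False
      have "s\<^sup>2 \<le> 1" using s1 n by (simp add: s_def power_le_one)
      then have "s\<^sup>2 * (1 + t * (norm b)\<^sup>2) \<le> 1 + t * (norm b * s)\<^sup>2"
        by (simp add: algebra_simps power_mult_distrib)
      moreover have "0 < s\<^sup>2 * (1 + t * (norm b)\<^sup>2)" using t n by (simp add: s_def add_pos_nonneg)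
      ultimately have "ln (s\<^sup>2 * (1 + t * (norm b)\<^sup>2)) \<le> ln (1 + t * (norm b * s)\<^sup>2)"
        by (subst ln_le_cancel_iff) auto
      moreover have "ln (s\<^sup>2 * (1 + t * (norm b)\<^sup>2)) = 2 * ln s + ln (1 + t * (norm b)\<^sup>2)"
      proof -
        have "0 < 1 + t * (norm b)\<^sup>2" using t by (simp add: add_pos_nonneg)
        then show ?thesis using n by (subst ln_mult) (auto simp: s_def ln_realpow)
      qed
      ultimately show ?thesis by linarith
    qed
    then have "ennreal (ln (1 + t * (norm b)\<^sup>2))
        \<le> ennreal (ln (1 + t * (norm b * s)\<^sup>2) + max 0 (- 2 * ln s))"
      by (rule ennreal_leI)
    also have "\<dots> = ennreal (ln (1 + t * (norm b * s)\<^sup>2)) + ennreal (max 0 (- 2 * ln s))"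
      using t by (intro ennreal_plus) auto
    also have "ennreal (max 0 (- 2 * ln s)) = ennreal (- 2 * ln s)"
      by (auto simp: max_def ennreal_neg)
    finally show "ennreal (ln (1 + t * (norm b)\<^sup>2))
        \<le> ennreal (ln (1 + t * (norm (a + b * y))\<^sup>2)) + ennreal (- 2 * ln (norm (c + y)))"
      by (simp add: eq s_def)
  qed
  also have "\<dots> = (\<integral>\<^sup>+y. ennreal (ln (1 + t * (norm (a + b * y))\<^sup>2)) \<partial>cgauss) + (\<integral>\<^sup>+y. ennreal (- 2 * ln
      (norm (c + y))) \<partial>cgauss)"
    by (rule nn_integral_add) auto
  also have "(\<integral>\<^sup>+y. ennreal (- 2 * ln (norm (c + y))) \<partial>cgauss)
      \<le> (\<integral>\<^sup>+y. ennreal (- 2 * ln (norm (c + y))) \<partial>lborel)"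
  proof (subst nn_integral_cgauss, simp, intro nn_integral_mono)
    fix y :: complex
    have "exp (- (norm y)\<^sup>2) \<le> 1" by simp
    then have "exp (- (norm y)\<^sup>2) \<le> pi" using pi_ge_two by linarith
    then have "exp (- (norm y)\<^sup>2) / pi \<le> 1" by (simp add: divide_le_eq)
    then have "ennreal (exp (- (norm y)\<^sup>2) / pi) \<le> 1" by (simp add: ennreal_le_1)
    then show "ennreal (exp (- (norm y)\<^sup>2) / pi) * ennreal (- 2 * ln (norm (c + y)))
        \<le> ennreal (- 2 * ln (norm (c + y)))"
      using mult_right_mono[of "ennreal (exp (- (norm y)\<^sup>2) / pi)" 1 "ennreal (- 2 * ln (norm (c +
          y)))"] by simp
  qed
  also have "\<dots> = log_sing"
    unfolding log_sing_def by (rule nn_integral_lborel_shift) simp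
  finally show ?thesis by (simp add: add_left_mono)
qed simp

definition gauss_entries :: "nat \<Rightarrow> (nat \<times> nat \<Rightarrow> complex) measure" where
  "gauss_entries n = (\<Pi>\<^sub>M p\<in>{..<n} \<times> {..<n}. cgauss)"

lemma product_sigma_finite_cgauss: "product_sigma_finite (\<lambda>p::'i. cgauss)"
  by (intro product_sigma_finite.intro prob_space_imp_sigma_finite prob_space_cgauss)

text \<open>The variances of independent centred variables add up: the cross terms cancel between \<open>y\<close> and \<open>-y\<close>.\<close>

lemma nn_integral_gauss_linear:
  assumes "finite I"
  shows "(\<integral>\<^sup>+x. ennreal ((norm (b + (\<Sum>p\<in>I. c p * x p)))\<^sup>2) \<partial>(\<Pi>\<^sub>M p\<in>I. cgauss))
      = ennreal ((norm b)\<^sup>2) + (\<Sum>p\<in>I. ennreal ((norm (c p))\<^sup>2) * gauss_var)"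
  using assms
proof (induction I arbitrary: b rule: finite_induct)
  interpret P: product_sigma_finite "\<lambda>p::'a. cgauss" by (rule product_sigma_finite_cgauss)
  {
    case empty
    then show ?case by (simp add: PiM_empty nn_integral_count_space_finite)
  next
    case (insert p I)
    interpret C: prob_space cgauss by (rule prob_space_cgauss)
    have one: "(\<integral>\<^sup>+y. ennreal ((norm (a + c p * y))\<^sup>2) \<partial>cgauss)
        = ennreal ((norm a)\<^sup>2) + ennreal ((norm (c p))\<^sup>2) * gauss_var" for a
    proof -
      let ?F = "\<lambda>y. ennreal ((norm (a + c p * y))\<^sup>2)"
      have "2 * (\<integral>\<^sup>+y. ?F y \<partial>cgauss) = (\<integral>\<^sup>+y. ?F y \<partial>cgauss) + (\<integral>\<^sup>+y. ?F ((-1) * y) \<partial>cgauss)"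
        by (subst nn_integral_cgauss_rotate) (auto simp: mult_2)
      also have "\<dots> = (\<integral>\<^sup>+y. ?F y + ?F ((-1) * y) \<partial>cgauss)"
        by (rule nn_integral_add[symmetric]) auto
      also have "\<dots> = (\<integral>\<^sup>+y. 2 * (ennreal ((norm a)\<^sup>2) + ennreal ((norm (c p))\<^sup>2) * ennreal ((norm y)\<^sup>2))
          \<partial>cgauss)"
      proof (intro nn_integral_cong)
        fix y
        have N: "(norm (a + z))\<^sup>2 + (norm (a - z))\<^sup>2 = 2 * ((norm a)\<^sup>2 + (norm z)\<^sup>2)" for z
          by (simp add: cmod_power2) (simp add: power2_eq_square algebra_simps)
        have "?F y + ?F ((-1) * y) = ennreal (2 * ((norm a)\<^sup>2 + (norm (c p * y))\<^sup>2))"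
          unfolding N[symmetric] by (simp add: ennreal_plus[symmetric] del: ennreal_plus)
        also have "\<dots> = 2 * (ennreal ((norm a)\<^sup>2) + ennreal ((norm (c p))\<^sup>2) * ennreal ((norm y)\<^sup>2))"
          by (simp add: ennreal_mult norm_mult power_mult_distrib)
        finally show "?F y + ?F ((-1) * y) = 2 * (ennreal ((norm a)\<^sup>2) + ennreal ((norm (c p))\<^sup>2) *
            ennreal ((norm y)\<^sup>2))" .
      qed
      also have "\<dots> = 2 * (ennreal ((norm a)\<^sup>2) + ennreal ((norm (c p))\<^sup>2) * gauss_var)"
        using C.emeasure_space_1 by (simp add: nn_integral_cmult nn_integral_add gauss_var_def)
      finally have "2 * (\<integral>\<^sup>+y. ?F y \<partial>cgauss) = 2 * (ennreal ((norm a)\<^sup>2) + ennreal ((norm (c p))\<^sup>2) *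
          gauss_var)" .
      then show ?thesis unfolding ennreal_mult_cancel_left by auto
    qed
    have "(\<integral>\<^sup>+x. ennreal ((norm (b + (\<Sum>q\<in>insert p I. c q * x q)))\<^sup>2) \<partial>(\<Pi>\<^sub>M q\<in>insert p I. cgauss)) =
       (\<integral>\<^sup>+x. \<integral>\<^sup>+y. ennreal ((norm (b + (\<Sum>q\<in>insert p I. c q * (x(p := y)) q)))\<^sup>2) \<partial>cgauss \<partial>(\<Pi>\<^sub>M q\<in>I.
           cgauss))"
      by (rule P.product_nn_integral_insert) (use insert in auto)
    also have "\<dots> = (\<integral>\<^sup>+x. \<integral>\<^sup>+y. ennreal ((norm ((b + (\<Sum>q\<in>I. c q * x q)) + c p * y))\<^sup>2) \<partial>cgauss \<partial>(\<Pi>\<^sub>M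
        q\<in>I. cgauss))"
    proof -
      have "(\<Sum>q\<in>I. c q * (x(p := y)) q) = (\<Sum>q\<in>I. c q * x q)" for x y
        using insert by (intro sum.cong) auto
      then show ?thesis using insert by (simp add: add_ac)
    qed
    also have "\<dots> = (\<integral>\<^sup>+x. ennreal ((norm (b + (\<Sum>q\<in>I. c q * x q)))\<^sup>2) + ennreal ((norm (c p))\<^sup>2) *
        gauss_var \<partial>(\<Pi>\<^sub>M q\<in>I. cgauss))"
      by (simp only: one)
    also have "\<dots> = (\<integral>\<^sup>+x. ennreal ((norm (b + (\<Sum>q\<in>I. c q * x q)))\<^sup>2) \<partial>(\<Pi>\<^sub>M q\<in>I. cgauss)) + ennreal
        ((norm (c p))\<^sup>2) * gauss_var"
    proof -
      interpret PP: prob_space "\<Pi>\<^sub>M q\<in>I. cgauss" by (intro prob_space_PiM prob_space_cgauss)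
      show ?thesis using PP.emeasure_space_1 by (subst nn_integral_add) auto
    qed
    finally show ?case using insert by (simp add: add_ac)
  }
qed

text \<open>The logarithm of a coefficient of the determinant, as a polynomial in the Gaussian entries, bounds
the mean from below, up to one constant \<open>log_sing\<close> for each variable of the monomial. Here the
monomial takes the entry \<open>(i, c i)\<close> from each row \<open>i \<in> R\<close>, so its coefficient is the determinant in
which these rows are replaced by multiples of unit rows. The variables are integrated out one at a
time, and each is either dropped or taken. The scaling matrix \<open>V\<close> of the noise is arbitrary to let
the induction pass to \<open>V = 0\<close> on a row from which an entry has been taken.\<close>

lemma gauss_matrix_lower:
  assumes t: "t \<ge> 0" and "finite I" "I \<subseteq> {..<n} \<times> {..<n}" "R \<subseteq> {..<n}" "\<And>i. i \<in> R \<Longrightarrow> (i, c i) \<in> I"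
  shows "ennreal (ln (1 + t * (norm (fdet n (\<lambda>i.
      if i \<in> R then (\<lambda>j. V i (c i) * unit_row (c i) j) else B i)))\<^sup>2))
    \<le> (\<integral>\<^sup>+x. ennreal (ln (1 + t * (norm (fdet n (\<lambda>i j. B i j + (if (i, j) \<in> I then V i j * x (i, j) else
        0))))\<^sup>2)) \<partial>(\<Pi>\<^sub>M p\<in>I. cgauss)) + of_nat (card R) * log_sing"
  using assms(2-)
proof (induction I arbitrary: R V B rule: finite_induct)
  case empty
  then have "R = {}" by auto
  then show ?case by (simp add: PiM_empty nn_integral_count_space_finite)
next
  case (insert p I)
  interpret P: product_sigma_finite "\<lambda>p::nat \<times> nat. cgauss" by (rule product_sigma_finite_cgauss)
  obtain i0 j0 where p: "p = (i0, j0)" by (cases p)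
  have i0: "i0 < n" "j0 < n" using insert.prems p by auto
  define X where "X I B V x = (\<lambda>i j. B i j + (if (i, j) \<in> I then V i j * x (i, j) else (0::complex)))"
    for I :: "(nat \<times> nat) set" and B V :: "nat \<Rightarrow> nat \<Rightarrow> complex" and x
  define B' where "B' = B(i0 := (\<lambda>j. V i0 j0 * unit_row j0 j))"
  define V' where "V' = V(i0 := (\<lambda>_. 0))"
  have meas: "(\<lambda>x. fdet n (X J B V x)) \<in> borel_measurable (\<Pi>\<^sub>M p\<in>J. cgauss)" for J B V
  proof (rule fdet_measurable)
    show "(\<lambda>x. X J B V x i j) \<in> borel_measurable (\<Pi>\<^sub>M p\<in>J. cgauss)" for i j
      unfolding X_def by (cases "(i, j) \<in> J") auto
  qed
  \<comment> \<open>the determinant is affine in the entry \<open>p\<close>, and its slope is a determinant of the same kind\<close>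
  have split: "fdet n (X (insert p I) B V (x(p := y))) = fdet n (X I B V x) + fdet n (X I B' V' x) * y"
      for x y
  proof -
    define Y where "Y = X I B V x"
    have 1: "X (insert p I) B V (x(p := y)) = Y(i0 := (\<lambda>j. Y i0 j + y * (V i0 j0 * unit_row j0 j)))"
      using insert(2) by (auto simp: X_def Y_def p unit_row_def fun_eq_iff)
    have 2: "fdet n (Y(i0 := (\<lambda>j. Y i0 j + y * (V i0 j0 * unit_row j0 j))))
        = fdet n (Y(i0 := Y i0)) + y * fdet n (Y(i0 := (\<lambda>j. V i0 j0 * unit_row j0 j)))"
      by (rule fdet_row_linear[OF i0(1)])
    have 3: "Y(i0 := (\<lambda>j. V i0 j0 * unit_row j0 j)) = X I B' V' x"
      by (auto simp: X_def Y_def B'_def V'_def fun_eq_iff)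
    show ?thesis unfolding 1 2 3 by (simp add: Y_def mult.commute)
  qed
  let ?I = "\<lambda>x. \<integral>\<^sup>+y. ennreal (ln (1 + t * (norm (fdet n (X I B V x) + fdet n (X I B' V' x) * y))\<^sup>2))
      \<partial>cgauss"
  have eq: "(\<integral>\<^sup>+x. ennreal (ln (1 + t * (norm (fdet n (X (insert p I) B V x)))\<^sup>2)) \<partial>(\<Pi>\<^sub>M p\<in>insert p I.
      cgauss))
     = (\<integral>\<^sup>+x. ?I x \<partial>(\<Pi>\<^sub>M p\<in>I. cgauss))"
    using meas[of "insert p I" B V]
    by (subst P.product_nn_integral_insert) (use insert in \<open>auto simp: split\<close>)
  show ?case
  proof (cases "i0 \<in> R \<and> c i0 = j0")
    case True
    have "ennreal (ln (1 + t * (norm (fdet n (\<lambda>i.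
        if i \<in> R - {i0} then (\<lambda>j. V' i (c i) * unit_row (c i) j) else B' i)))\<^sup>2))
      \<le> (\<integral>\<^sup>+x. ennreal (ln (1 + t * (norm (fdet n (X I B' V' x)))\<^sup>2)) \<partial>(\<Pi>\<^sub>M p\<in>I. cgauss)) + of_nat (card
          (R - {i0})) * log_sing"
      unfolding X_def
    proof (rule insert.IH)
      show "(i, c i) \<in> I" if "i \<in> R - {i0}" for i using insert.prems(3)[of i] that p by auto
    qed (use insert.prems in auto)
    also have "(\<lambda>i. if i \<in> R - {i0} then (\<lambda>j. V' i (c i) * unit_row (c i) j) else B' i) = (\<lambda>i.
        if i \<in> R then (\<lambda>j. V i (c i) * unit_row (c i) j) else B i)"
      using True by (auto simp: B'_def V'_def fun_eq_iff)
    also have "(\<integral>\<^sup>+x. ennreal (ln (1 + t * (norm (fdet n (X I B' V' x)))\<^sup>2)) \<partial>(\<Pi>\<^sub>M p\<in>I. cgauss))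
        \<le> (\<integral>\<^sup>+x. ?I x + log_sing \<partial>(\<Pi>\<^sub>M p\<in>I. cgauss))"
      by (intro nn_integral_mono gauss_take t)
    also have "(\<integral>\<^sup>+x. ?I x + log_sing \<partial>(\<Pi>\<^sub>M p\<in>I. cgauss)) = (\<integral>\<^sup>+x. ?I x \<partial>(\<Pi>\<^sub>M p\<in>I. cgauss)) + log_sing"
    proof -
      interpret PP: prob_space "\<Pi>\<^sub>M q\<in>I. cgauss" by (intro prob_space_PiM prob_space_cgauss)
      interpret C: prob_space cgauss by (rule prob_space_cgauss)
      have [measurable]: "(\<lambda>x. fdet n (X I B V x))
          \<in> borel_measurable (\<Pi>\<^sub>M p\<in>I. cgauss)" "(\<lambda>x. fdet n (X I B' V' x))
          \<in> borel_measurable (\<Pi>\<^sub>M p\<in>I. cgauss)"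
        by (rule meas)+
      show ?thesis using PP.emeasure_space_1 by (subst nn_integral_add) auto
    qed
    finally have "ennreal (ln (1 + t * (norm (fdet n (\<lambda>i.
        if i \<in> R then (\<lambda>j. V i (c i) * unit_row (c i) j) else B i)))\<^sup>2))
       \<le> (\<integral>\<^sup>+x. ?I x \<partial>(\<Pi>\<^sub>M p\<in>I. cgauss)) + (log_sing + of_nat (card (R - {i0})) * log_sing)"
      by (simp add: add.assoc)
    also have "log_sing + of_nat (card (R - {i0})) * log_sing = of_nat (card R) * log_sing"
    proof -
      have "finite R" using insert.prems(2) finite_subset by blast
      then have "card R = Suc (card (R - {i0}))" using True by (metis card_Suc_Diff1)
      then show ?thesis by (simp add: distrib_right)
    qed
    finally show ?thesis unfolding X_def[symmetric] eq .
  next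
    case False
    have "ennreal (ln (1 + t * (norm (fdet n (\<lambda>i.
        if i \<in> R then (\<lambda>j. V i (c i) * unit_row (c i) j) else B i)))\<^sup>2))
      \<le> (\<integral>\<^sup>+x. ennreal (ln (1 + t * (norm (fdet n (X I B V x)))\<^sup>2)) \<partial>(\<Pi>\<^sub>M p\<in>I. cgauss)) + of_nat (card
          R) * log_sing"
      unfolding X_def
    proof (rule insert.IH)
      show "(i, c i) \<in> I" if "i \<in> R" for i using insert.prems(3)[of i] that p False by auto
    qed (use insert.prems in auto)
    also have "(\<integral>\<^sup>+x. ennreal (ln (1 + t * (norm (fdet n (X I B V x)))\<^sup>2)) \<partial>(\<Pi>\<^sub>M p\<in>I. cgauss))
        \<le> (\<integral>\<^sup>+x. ?I x \<partial>(\<Pi>\<^sub>M p\<in>I. cgauss))"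
      by (intro nn_integral_mono gauss_drop t)
    finally show ?thesis unfolding X_def[symmetric] eq by (simp add: add_right_mono)
  qed
qed

section \<open>The ratio of the noisy determinant to the circulant determinant\<close>

lemma ln_quotient_tendsto:
  assumes "w > 0"
  shows "(\<lambda>n. ln (1 + real n * w\<^sup>2) - ln (1 + real n)) \<longlonglongrightarrow> 2 * ln w"
proof -
  have "(\<lambda>n. ln (1 + real n * w\<^sup>2) - ln (1 + real n)) \<longlonglongrightarrow> ln (w\<^sup>2)"
    using assms by real_asymp
  then show ?thesis using assms by (simp add: ln_realpow)
qed

text \<open>\<open>E|X| = 2 E X\<^sup>+ - E X\<close> for \<open>X = ln w\<close>. As \<open>X\<close> may be \<open>-\<infinity>\<close>, this is applied to the regularisations \<open>L
t = ln ((1 + t w\<^sup>2) / (1 + t))\<close>, which are bounded below and tend to \<open>2 ln w\<close> as \<open>t\<close> grows; Fatou's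
lemma gives the limit.\<close>

lemma (in prob_space) abs_ln_le_of_lower_bounds:
  fixes w :: "'a \<Rightarrow> real" and u :: ennreal
  assumes [measurable]: "w \<in> borel_measurable M"
    and w0: "\<And>x. w x \<ge> 0" and \<rho>: "0 < \<rho>" "\<rho> \<le> 1" and \<kappa>: "\<kappa> \<ge> 0"
    and lower: "\<And>t. t \<ge> 0 \<Longrightarrow> ennreal (ln (1 + t * \<rho>\<^sup>2))
        \<le> (\<integral>\<^sup>+x. ennreal (ln (1 + t * (w x)\<^sup>2)) \<partial>M) + ennreal \<kappa>"
    and upper: "(\<integral>\<^sup>+x. ennreal (ln (w x)) \<partial>M) \<le> u"
  shows "(\<integral>\<^sup>+x. ennreal \<bar>ln (w x)\<bar> \<partial>M) \<le> 2 * u + ennreal (ln (1 / \<rho>) + \<kappa> / 2)"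
proof -
  define L where "L t x = ln (1 + t * (w x)\<^sup>2) - ln (1 + t)" for t x
  have meas [measurable]: "L t \<in> borel_measurable M" for t unfolding L_def[abs_def] by simp
  have l\<rho>: "ln (1 / \<rho>) \<ge> 0" using \<rho> by simp
  have pos: "(\<integral>\<^sup>+x. ennreal (L t x) \<partial>M) \<le> 2 * u" if t: "t \<ge> 0" for t
  proof -
    have "L t x \<le> 2 * max 0 (ln (w x))" for x
    proof (cases "w x \<le> 1")
      case True
      have "(w x)\<^sup>2 \<le> 1" using True w0[of x] by (simp add: power_le_one)
      then have "1 + t * (w x)\<^sup>2 \<le> 1 + t" using t by (simp add: mult_left_le)
      then have "ln (1 + t * (w x)\<^sup>2) \<le> ln (1 + t)"
        using t by (subst ln_le_cancel_iff) (auto simp: add_pos_nonneg)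
      then have "L t x \<le> 0" by (simp add: L_def)
      then show ?thesis by linarith
    next
      case False
      then have "1 \<le> (w x)\<^sup>2" by (simp add: one_le_power)
      then have "1 + t * (w x)\<^sup>2 \<le> (1 + t) * (w x)\<^sup>2" by (simp add: algebra_simps)
      then have "ln (1 + t * (w x)\<^sup>2) \<le> ln ((1 + t) * (w x)\<^sup>2)"
        using t False by (subst ln_le_cancel_iff) (auto simp: add_pos_nonneg)
      also have "\<dots> = ln (1 + t) + 2 * ln (w x)"
        using t False by (subst ln_mult) (auto simp: ln_realpow)
      finally have "L t x \<le> 2 * ln (w x)" by (simp add: L_def)
      then show ?thesis by linarith
    qed
    then have "(\<integral>\<^sup>+x. ennreal (L t x) \<partial>M) \<le> (\<integral>\<^sup>+x. ennreal (2 * max 0 (ln (w x))) \<partial>M)"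
      by (intro nn_integral_mono ennreal_leI)
    also have "\<dots> = (\<integral>\<^sup>+x. 2 * ennreal (ln (w x)) \<partial>M)"
      by (intro nn_integral_cong) (auto simp: max_def ennreal_neg ennreal_mult)
    also have "\<dots> \<le> 2 * u" using upper by (simp add: nn_integral_cmult mult_left_mono)
    finally show ?thesis .
  qed
  have key: "(\<integral>\<^sup>+x. ennreal \<bar>L t x\<bar> \<partial>M) \<le> 4 * u + ennreal (2 * ln (1 / \<rho>) + \<kappa>)" if t: "t \<ge> 0" for t
  proof -
    let ?X = "\<integral>\<^sup>+x. ennreal (ln (1 + t * (w x)\<^sup>2)) \<partial>M"
    let ?P = "\<integral>\<^sup>+x. ennreal (L t x) \<partial>M"
    let ?N = "\<integral>\<^sup>+x. ennreal (- L t x) \<partial>M"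
    have "?X + ?N = (\<integral>\<^sup>+x. ennreal (ln (1 + t * (w x)\<^sup>2)) + ennreal (- L t x) \<partial>M)"
      by (rule nn_integral_add[symmetric]) auto
    also have "\<dots> = (\<integral>\<^sup>+x. ennreal (ln (1 + t)) + ennreal (L t x) \<partial>M)"
    proof (rule nn_integral_cong)
      fix x
      have n: "ln (1 + t * (w x)\<^sup>2) \<ge> 0" "ln (1 + t) \<ge> 0" using t by auto
      show "ennreal (ln (1 + t * (w x)\<^sup>2)) + ennreal (- L t x) = ennreal (ln (1 + t)) + ennreal (L t x)"
      proof (cases "L t x \<ge> 0")
        case True
        then have "ennreal (ln (1 + t)) + ennreal (L t x) = ennreal (ln (1 + t) + L t x)"
          using n by simp
        then show ?thesis using True by (simp add: ennreal_neg L_def)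
      next
        case False
        then have "ennreal (ln (1 + t * (w x)\<^sup>2)) + ennreal (- L t x)
            = ennreal (ln (1 + t * (w x)\<^sup>2) - L t x)"
          using n by (subst ennreal_plus[symmetric]) auto
        then show ?thesis using False by (simp add: ennreal_neg L_def)
      qed
    qed
    also have "\<dots> = ennreal (ln (1 + t)) + ?P"
      using emeasure_space_1 by (subst nn_integral_add) auto
    finally have XN: "?X + ?N = ennreal (ln (1 + t)) + ?P" .
    define e where "e = ln (1 + t) - ln (1 + t * \<rho>\<^sup>2)"
    have p1: "0 < 1 + t * \<rho>\<^sup>2" using t by (simp add: add_pos_nonneg)
    have rho1: "\<rho>\<^sup>2 \<le> 1" using \<rho> by (simp add: power_le_one)
    then have "1 + t * \<rho>\<^sup>2 \<le> 1 + t" using t by (simp add: mult_left_le)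
    then have e0: "e \<ge> 0" using p1 by (simp add: e_def)
    have "\<rho>\<^sup>2 * (1 + t) \<le> 1 + t * \<rho>\<^sup>2" using rho1 by (simp add: algebra_simps)
    then have "ln (\<rho>\<^sup>2 * (1 + t)) \<le> ln (1 + t * \<rho>\<^sup>2)" using p1 \<rho> t by (subst ln_le_cancel_iff) auto
    moreover have "ln (\<rho>\<^sup>2 * (1 + t)) = 2 * ln \<rho> + ln (1 + t)" using \<rho> t
        by (subst ln_mult) (auto simp: ln_realpow)
    ultimately have e1: "e \<le> 2 * ln (1 / \<rho>)" using \<rho> by (simp add: e_def ln_div)
    have "ennreal (ln (1 + t * \<rho>\<^sup>2)) + ?N \<le> ?X + ennreal \<kappa> + ?N" using lower[OF t]
        by (rule add_right_mono)
    also have "\<dots> = ennreal (ln (1 + t)) + ?P + ennreal \<kappa>" using XN by (simp add: add_ac)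
    also have "ennreal (ln (1 + t)) = ennreal (ln (1 + t * \<rho>\<^sup>2)) + ennreal e"
      using e0 t by (subst ennreal_plus[symmetric]) (auto simp: e_def)
    finally have "ennreal (ln (1 + t * \<rho>\<^sup>2)) + ?N
        \<le> ennreal (ln (1 + t * \<rho>\<^sup>2)) + (ennreal e + ?P + ennreal \<kappa>)"
      by (simp add: add_ac)
    then have N: "?N \<le> ennreal e + ?P + ennreal \<kappa>" by (simp add: ennreal_add_left_cancel_le)
    have "(\<integral>\<^sup>+x. ennreal \<bar>L t x\<bar> \<partial>M) = (\<integral>\<^sup>+x. ennreal (L t x) + ennreal (- L t x) \<partial>M)"
      by (intro nn_integral_cong) (auto simp: abs_if ennreal_neg)
    also have "\<dots> = ?P + ?N" by (rule nn_integral_add) auto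
    also have "\<dots> \<le> 2 * u + (ennreal e + 2 * u + ennreal \<kappa>)"
      using N pos[OF t] by (meson add_mono order_trans order_refl)
    also have "\<dots> = 4 * u + (ennreal e + ennreal \<kappa>)"
    proof -
      have "2 * u + 2 * u = 4 * u" by (simp add: distrib_right[symmetric])
      then show ?thesis by (metis (no_types, lifting) add.assoc add.commute)
    qed
    also have "ennreal e + ennreal \<kappa> \<le> ennreal (2 * ln (1 / \<rho>) + \<kappa>)"
      using e0 e1 \<kappa> by (subst ennreal_plus[symmetric]) (auto intro!: ennreal_leI)
    finally show ?thesis by (simp add: add_left_mono)
  qed
  have "2 * (\<integral>\<^sup>+x. ennreal \<bar>ln (w x)\<bar> \<partial>M) = (\<integral>\<^sup>+x. ennreal (2 * \<bar>ln (w x)\<bar>) \<partial>M)"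
    by (subst nn_integral_cmult[symmetric]) (auto simp: ennreal_mult)
  also have "\<dots> \<le> (\<integral>\<^sup>+x. liminf (\<lambda>n. ennreal \<bar>L (real n) x\<bar>) \<partial>M)"
  proof (intro nn_integral_mono)
    fix x
    show "ennreal (2 * \<bar>ln (w x)\<bar>) \<le> liminf (\<lambda>n. ennreal \<bar>L (real n) x\<bar>)"
    proof (cases "w x > 0")
      case True
      have "(\<lambda>n. ennreal \<bar>L (real n) x\<bar>) \<longlonglongrightarrow> ennreal \<bar>2 * ln (w x)\<bar>"
        using ln_quotient_tendsto[OF True] unfolding L_def by (intro tendsto_ennrealI tendsto_rabs)
      then have "liminf (\<lambda>n. ennreal \<bar>L (real n) x\<bar>) = ennreal \<bar>2 * ln (w x)\<bar>"
        by (intro lim_imp_Liminf) auto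
      then show ?thesis by (simp add: abs_mult)
    next
      case False
      then show ?thesis using w0[of x] by simp
    qed
  qed
  also have "\<dots> \<le> liminf (\<lambda>n. \<integral>\<^sup>+x. ennreal \<bar>L (real n) x\<bar> \<partial>M)"
    by (rule nn_integral_liminf) simp
  also have "\<dots> \<le> liminf (\<lambda>n::nat. 4 * u + ennreal (2 * ln (1 / \<rho>) + \<kappa>))"
    by (intro Liminf_mono always_eventually allI key) simp
  also have "\<dots> = 4 * u + ennreal (2 * ln (1 / \<rho>) + \<kappa>)" by (simp add: Liminf_const)
  also have "\<dots> = 2 * (2 * u + ennreal (ln (1 / \<rho>) + \<kappa> / 2))"
  proof -
    have "2 * ln (1 / \<rho>) + \<kappa> = 2 * (ln (1 / \<rho>) + \<kappa> / 2)" by simp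
    then have "ennreal (2 * ln (1 / \<rho>) + \<kappa>) = 2 * ennreal (ln (1 / \<rho>) + \<kappa> / 2)"
      by (simp only:) (subst ennreal_mult, auto simp: l\<rho> \<kappa>)
    then show ?thesis by (simp add: distrib_left mult.assoc[symmetric])
  qed
  finally have "2 * (\<integral>\<^sup>+x. ennreal \<bar>ln (w x)\<bar> \<partial>M) \<le> 2 * (2 * u + ennreal (ln (1 / \<rho>) + \<kappa> / 2))" .
  then show ?thesis by (subst (asm) ennreal_mult_le_mult_iff) auto
qed

lemma fdet_scale_rows: "fdet n (\<lambda>i j. c i * f i j) = (\<Prod>i<n. c i) * fdet n f"
proof -
  have "fdet n (\<lambda>i j. c i * f i j) = fdet n (\<lambda>j i. c i * f i j)"
    by (rule fdet_transpose[symmetric])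
  also have "\<dots> = fdet n (\<lambda>j i. f i j) * (\<Prod>i<n. c i)"
    using fdet_scale_columns[of n "\<lambda>j i. f i j" c] by (simp add: mult.commute)
  also have "fdet n (\<lambda>j i. f i j) = fdet n f" by (rule fdet_transpose)
  finally show ?thesis by (simp only: mult.commute)
qed

text \<open>Its logarithm is \<open>N\<close> times the difference of the logarithmic potentials of the noisy eigenvalues and
of the nodes at \<open>z\<close>. At a node the division by zero gives the value 0; the nodes form a null set for
the integrals over \<open>z\<close>.\<close>

definition det_ratio :: "nat \<Rightarrow> (nat \<Rightarrow> complex) \<Rightarrow> nat \<Rightarrow> real \<Rightarrow> complex \<Rightarrow> (nat \<times> nat \<Rightarrow> complex) \<Rightarrow> real"
    where
  "det_ratio d a N \<delta> z x = norm (fdet N (\<lambda>i j. toeplitz_entry d a z i j + of_real \<delta> * x (i, j))) / norm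
      (\<Prod>r<N. nodes d a N r - z)"

lemma det_ratio_nonneg [simp]: "det_ratio d a N \<delta> z x \<ge> 0"
  by (simp add: det_ratio_def)

lemma toeplitz_entry_measurable [measurable (raw)]:
  "f \<in> borel_measurable M \<Longrightarrow> (\<lambda>x. toeplitz_entry d a (f x) i j) \<in> borel_measurable M"
  unfolding toeplitz_entry_def by simp

lemma det_ratio_measurable:
  "(\<lambda>p. det_ratio d a N \<delta> (fst p) (snd p)) \<in> borel_measurable (borel \<Otimes>\<^sub>M gauss_entries N)"
proof -
  have "(\<lambda>p. fdet N (\<lambda>i j. toeplitz_entry d a (fst p) i j + of_real \<delta> * snd p (i, j)))
      \<in> borel_measurable (borel \<Otimes>\<^sub>M gauss_entries N)"
  proof (rule fdet_measurable)
    fix i j assume ij: "i < N" "j < N"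
    have "(\<lambda>x. x (i, j)) \<in> borel_measurable (gauss_entries N)"
      unfolding gauss_entries_def using ij measurable_component_singleton[of "(i, j)" "{..<N} \<times> {..<N}"
          "\<lambda>_. cgauss"] by simp
    then show "(\<lambda>p. toeplitz_entry d a (fst p) i j + of_real \<delta> * snd p (i, j))
        \<in> borel_measurable (borel \<Otimes>\<^sub>M gauss_entries N)"
      by (intro borel_measurable_add borel_measurable_times toeplitz_entry_measurable
          measurable_compose[OF measurable_snd]) auto
  qed
  then show ?thesis unfolding det_ratio_def by measurable
qed

lemma det_ratio_measurable' [measurable]: "det_ratio d a N \<delta> z \<in> borel_measurable (gauss_entries N)"
  using measurable_compose[OF measurable_Pair1' det_ratio_measurable, of z] by simp

lemma prob_space_gauss_entries: "prob_space (gauss_entries N)"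
  unfolding gauss_entries_def by (intro prob_space_PiM prob_space_cgauss)

text \<open>The coefficient bound, applied to a monomial with one entry in each of the last \<open>d\<close> rows.\<close>

lemma det_ratio_lower:
  assumes N: "N > 0" and \<delta>: "0 < \<delta>" "\<delta> \<le> 1" and z: "\<And>r. r < N \<Longrightarrow> nodes d a N r \<noteq> z" and t: "t \<ge> 0"
  defines "\<rho> \<equiv> (\<delta> / (1 + coeff_sum d a + norm z)) ^ d"
  shows "ennreal (ln (1 + t * \<rho>\<^sup>2)) \<le> (\<integral>\<^sup>+x. ennreal (ln (1 + t * (det_ratio d a N \<delta> z x)\<^sup>2))
      \<partial>gauss_entries N) + of_nat d * log_sing"
proof -
  define K where "K = 1 + coeff_sum d a + norm z"
  have K: "K > 0" using coeff_sum_nonneg[of d a] by (simp add: K_def add_pos_nonneg)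
  define D where "D = norm (\<Prod>r<N. nodes d a N r - z)"
  have D: "D > 0" using z by (auto simp: D_def prod_zero_iff)
  obtain c where c: "\<forall>i\<in>{N - d..<N}. c i < N"
    and le: "D \<le> K ^ d * norm (fdet N (\<lambda>i. if i \<in> {N - d..<N} then unit_row (c i) else toeplitz_entry d
        a z i))"
    using prod_nodes_le_minor[OF N, of d a z] unfolding D_def K_def by blast
  define m where "m = norm (fdet N (\<lambda>i. if i \<in> {N - d..<N} then unit_row (c i) else toeplitz_entry d a z
      i))"
  have "fdet N (\<lambda>i. if i \<in> {N - d..<N} then (\<lambda>j. of_real \<delta> * unit_row (c i) j) else toeplitz_entry d a z
      i)
     = fdet N (\<lambda>i j. (if i \<in> {N - d..<N} then of_real \<delta> else 1) * (if i \<in> {N - d..<N} then unit_row (c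
         i) else toeplitz_entry d a z i) j)"
    by (intro arg_cong[where f = "fdet N"]) (auto simp: fun_eq_iff)
  also have "\<dots> = (\<Prod>i<N. if i \<in> {N - d..<N} then of_real \<delta> else 1) * fdet N (\<lambda>i.
      if i \<in> {N - d..<N} then unit_row (c i) else toeplitz_entry d a z i)"
    by (rule fdet_scale_rows)
  also have "(\<Prod>i<N. if i \<in> {N - d..<N} then complex_of_real \<delta> else 1)
      = (\<Prod>i\<in>{N - d..<N}. complex_of_real \<delta>)"
    by (rule prod.mono_neutral_cong_right) auto
  also have "\<dots> = of_real (\<delta> ^ card {N - d..<N})" by simp
  finally have n: "norm (fdet N (\<lambda>i. if i \<in> {N - d..<N} then (\<lambda>j. of_real \<delta> * unit_row (c i) j) else
      toeplitz_entry d a z i)) = \<delta> ^ card {N - d..<N} * m"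
    using \<delta> by (simp add: norm_mult norm_power m_def)
  have "\<delta> ^ d * m \<le> \<delta> ^ card {N - d..<N} * m"
    using \<delta> by (intro mult_right_mono power_decreasing) (auto simp: m_def)
  moreover have "\<rho> * D \<le> \<delta> ^ d * m"
  proof -
    have eq: "\<rho> * K ^ d = \<delta> ^ d" using K by (simp add: \<rho>_def K_def[symmetric] power_divide)
    have "\<rho> * D \<le> \<rho> * (K ^ d * m)"
      using le K \<delta> unfolding m_def by (intro mult_left_mono) (auto simp: \<rho>_def K_def[symmetric])
    then show ?thesis by (simp add: mult.assoc[symmetric] eq)
  qed
  ultimately have ge: "\<rho> * D \<le> \<delta> ^ card {N - d..<N} * m" by linarith
  have \<rho>0: "\<rho> \<ge> 0" using \<delta> K by (simp add: \<rho>_def K_def[symmetric])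
  have "(\<rho> * D)\<^sup>2 \<le> (\<delta> ^ card {N - d..<N} * m)\<^sup>2" using ge \<rho>0 D by (intro power_mono) auto
  then have "\<rho>\<^sup>2 \<le> (\<delta> ^ card {N - d..<N} * m)\<^sup>2 / D\<^sup>2" using D
      by (simp add: power_mult_distrib field_simps)
  then have "t * \<rho>\<^sup>2 \<le> t * ((\<delta> ^ card {N - d..<N} * m)\<^sup>2 / D\<^sup>2)" using t by (intro mult_left_mono)
  then have "t * \<rho>\<^sup>2 \<le> t / D\<^sup>2 * (\<delta> ^ card {N - d..<N} * m)\<^sup>2"
      by (simp only: times_divide_eq_left times_divide_eq_right)
  then have "ln (1 + t * \<rho>\<^sup>2) \<le> ln (1 + t / D\<^sup>2 * (\<delta> ^ card {N - d..<N} * m)\<^sup>2)"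
    using t by (subst ln_le_cancel_iff) (auto simp: add_pos_nonneg)
  then have "ennreal (ln (1 + t * \<rho>\<^sup>2)) \<le> ennreal (ln (1 + t / D\<^sup>2 * (norm (fdet N (\<lambda>i.
      if i \<in> {N - d..<N} then (\<lambda>j. of_real \<delta> * unit_row (c i) j) else toeplitz_entry d a z i)))\<^sup>2))"
    unfolding n by (rule ennreal_leI)
  also have "\<dots> \<le> (\<integral>\<^sup>+x. ennreal (ln (1 + t / D\<^sup>2 * (norm (fdet N (\<lambda>i j. toeplitz_entry d a z i j + (if
      (i, j) \<in> {..<N} \<times> {..<N} then of_real \<delta> * x (i, j) else 0))))\<^sup>2)) \<partial>(\<Pi>\<^sub>M p\<in>{..<N} \<times> {..<N}.
      cgauss)) + of_nat (card {N - d..<N}) * log_sing"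
    by (rule gauss_matrix_lower[where V = "\<lambda>_ _. of_real \<delta>"]) (use t c in auto)
  also have "(\<integral>\<^sup>+x. ennreal (ln (1 + t / D\<^sup>2 * (norm (fdet N (\<lambda>i j. toeplitz_entry d a z i j + (if (i,
      j) \<in> {..<N} \<times> {..<N} then of_real \<delta> * x (i, j) else 0))))\<^sup>2)) \<partial>(\<Pi>\<^sub>M p\<in>{..<N} \<times> {..<N}. cgauss))
    = (\<integral>\<^sup>+x. ennreal (ln (1 + t * (det_ratio d a N \<delta> z x)\<^sup>2)) \<partial>gauss_entries N)"
    unfolding gauss_entries_def
  proof (intro nn_integral_cong)
    fix x
    have "fdet N (\<lambda>i j. toeplitz_entry d a z i j + (if (i, j) \<in> {..<N} \<times> {..<N} then of_real \<delta> * x (i,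
        j) else 0)) = fdet N (\<lambda>i j. toeplitz_entry d a z i j + of_real \<delta> * x (i, j))"
      by (rule fdet_cong) auto
    then show "ennreal (ln (1 + t / D\<^sup>2 * (norm (fdet N (\<lambda>i j. toeplitz_entry d a z i j + (if (i, j) \<in>
        {..<N} \<times> {..<N} then of_real \<delta> * x (i, j) else 0))))\<^sup>2)) =
      ennreal (ln (1 + t * (det_ratio d a N \<delta> z x)\<^sup>2))"
      by (simp add: det_ratio_def D_def[symmetric] power_divide)
  qed
  also have "of_nat (card {N - d..<N}) * log_sing \<le> of_nat d * log_sing"
    by (intro mult_right_mono) auto
  finally show ?thesis by (simp add: add_left_mono)
qed

lemma nn_integral_dft_noise:
  assumes "i < N"
  shows "(\<integral>\<^sup>+x. ennreal ((norm (\<Sum>j<N. x (i, j) * dft N j r))\<^sup>2) \<partial>gauss_entries N)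
      = of_nat N * gauss_var"
proof -
  let ?c = "\<lambda>p. if fst p = i then dft N (snd p) r else 0"
  have "(\<Sum>p\<in>{..<N} \<times> {..<N}. ?c p * x p) = (\<Sum>j<N. x (i, j) * dft N j r)" for x
  proof -
    have "(\<Sum>p\<in>{..<N} \<times> {..<N}. ?c p * x p) = (\<Sum>k<N. \<Sum>j<N. ?c (k, j) * x (k, j))"
      unfolding sum.cartesian_product by (intro sum.cong refl) auto
    also have "\<dots> = (\<Sum>k<N. if k = i then (\<Sum>j<N. x (i, j) * dft N j r) else 0)"
      by (intro sum.cong refl) (auto simp: mult.commute)
    finally show ?thesis using assms by simp
  qed
  then have "(\<integral>\<^sup>+x. ennreal ((norm (\<Sum>j<N. x (i, j) * dft N j r))\<^sup>2) \<partial>gauss_entries N)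
     = (\<integral>\<^sup>+x. ennreal ((norm (0 + (\<Sum>p\<in>{..<N} \<times> {..<N}. ?c p * x p)))\<^sup>2) \<partial>(\<Pi>\<^sub>M p\<in>{..<N} \<times> {..<N}.
         cgauss))"
    by (simp add: gauss_entries_def)
  also have "\<dots> = (\<Sum>p\<in>{..<N} \<times> {..<N}. ennreal ((norm (?c p))\<^sup>2) * gauss_var)"
    by (subst nn_integral_gauss_linear) auto
  also have "\<dots> = (\<Sum>k<N. \<Sum>j<N. ennreal ((norm (?c (k, j)))\<^sup>2) * gauss_var)"
    unfolding sum.cartesian_product by (intro sum.cong refl) auto
  also have "\<dots> = (\<Sum>k<N. if k = i then of_nat N * gauss_var else 0)"
    by (intro sum.cong refl) auto
  finally show ?thesis using assms by simp
qed

text \<open>\<open>ln (1 + y) \<le> 2 sqrt y\<close> because \<open>1 + y \<le> (1 + sqrt y)\<^sup>2\<close>.\<close>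

lemma ln_prod_le_sum:
  assumes "finite A" "\<And>r. r \<in> A \<Longrightarrow> y r \<ge> 0" "w \<le> (\<Prod>r\<in>A. 1 + y r)" "w \<ge> 0"
  shows "ln w \<le> (\<Sum>r\<in>A. 2 * sqrt (y r))"
proof (cases "w = 0")
  case False
  have p: "1 + y r > 0" if "r \<in> A" for r using assms(2)[OF that] by linarith
  have "(\<Prod>r\<in>A. 1 + y r) > 0" using p by (intro prod_pos) auto
  then have "ln w \<le> ln (\<Prod>r\<in>A. 1 + y r)" using False assms by (subst ln_le_cancel_iff) auto
  also have "\<dots> = (\<Sum>r\<in>A. ln (1 + y r))" using assms(1) by (intro ln_prod) (use p in fastforce)+
  also have "\<dots> \<le> (\<Sum>r\<in>A. 2 * sqrt (y r))"
  proof (rule sum_mono)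
    fix r assume r: "r \<in> A"
    have y: "y r \<ge> 0" using assms r by auto
    have "1 + y r \<le> (1 + sqrt (y r))\<^sup>2" using y by (simp add: power2_eq_square algebra_simps)
    then have "ln (1 + y r) \<le> ln ((1 + sqrt (y r))\<^sup>2)" using y
        by (subst ln_le_cancel_iff) (auto simp: add_pos_nonneg)
    also have "\<dots> = 2 * ln (1 + sqrt (y r))" using y by (subst ln_realpow) (auto simp: add_pos_nonneg)
    also have "\<dots> \<le> 2 * sqrt (y r)" using y by (simp add: ln_add_one_self_le_self)
    finally show "ln (1 + y r) \<le> 2 * sqrt (y r)" .
  qed
  finally show ?thesis .
qed (use assms in \<open>auto intro!: sum_nonneg\<close>)

lemma sqrt_le_scaled:
  assumes "y \<ge> 0" "\<tau> > 0"
  shows "sqrt y \<le> sqrt \<tau> * (1 + y\<^sup>2 / \<tau>\<^sup>2)"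
proof -
  define q where "q = y / \<tau>"
  have q: "q \<ge> 0" using assms by (simp add: q_def)
  have "sqrt q \<le> 1 + q\<^sup>2"
  proof (cases "q \<le> 1")
    case True
    then have "sqrt q \<le> 1" by simp
    then show ?thesis by (smt (verit) zero_le_power2)
  next
    case False
    then have "sqrt q \<le> sqrt (q\<^sup>2)" by (intro real_sqrt_le_mono) (simp add: power2_eq_square)
    also have "\<dots> = q" using q by simp
    also have "q \<le> q\<^sup>2" using False by (simp add: power2_eq_square)
    finally show ?thesis by simp
  qed
  then have "sqrt \<tau> * sqrt q \<le> sqrt \<tau> * (1 + q\<^sup>2)" using assms by (intro mult_left_mono) auto
  then show ?thesis using assms by (simp add: q_def real_sqrt_mult[symmetric] power_divide)
qed

text \<open>By the Fourier-Hadamard bound the ratio is at most the product of \<open>1 + Y r / |p(\<omega>^r) - z|\<close>, where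
the second moment of the perturbation \<open>Y r\<close> is at most \<open>\<tau>\<^sup>2\<close>.\<close>

lemma det_ratio_upper:
  assumes N: "N > 0" and \<delta>: "0 \<le> \<delta>" and z: "\<And>r. r < N \<Longrightarrow> nodes d a N r \<noteq> z"
    and \<tau>: "\<tau> > 0" "ennreal (2 * d * (coeff_sum d a)\<^sup>2 / N) + ennreal (2 * N * \<delta>\<^sup>2) * gauss_var
        \<le> ennreal (\<tau>\<^sup>2)"
  shows "(\<integral>\<^sup>+x. ennreal (ln (det_ratio d a N \<delta> z x)) \<partial>gauss_entries N)
      \<le> ennreal (4 * sqrt \<tau>) * (\<Sum>r<N. ennreal (sing (nodes d a N r - z)))"
proof -
  interpret prob_space "gauss_entries N" by (rule prob_space_gauss_entries)
  define D where "D = norm (\<Prod>r<N. nodes d a N r - z)"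
  have D: "D > 0" using z by (auto simp: D_def prod_zero_iff)
  define b where "b r = norm (nodes d a N r - z)" for r
  have b: "b r > 0" if "r < N" for r using z[OF that] by (simp add: b_def)
  define S where "S r x = (\<Sum>i<N. (norm (\<Sum>j<N. x (i, j) * dft N j r))\<^sup>2)" for r x
  define Y where "Y r x = (sqrt d * coeff_sum d a + \<delta> * sqrt (S r x)) / sqrt N" for r x
  have comp [measurable]: "(\<lambda>x. x (i, j)) \<in> borel_measurable (gauss_entries N)" if "i < N" "j < N"
      for i j
    unfolding gauss_entries_def using that measurable_component_singleton[of "(i, j)" "{..<N} \<times> {..<N}"
        "\<lambda>_. cgauss"] by simp
  have lin [measurable]: "(\<lambda>x. \<Sum>j<N. x (i, j) * dft N j r) \<in> borel_measurable (gauss_entries N)"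
      if "i < N" for i r
    using that by (intro borel_measurable_sum borel_measurable_times comp) auto
  have S_meas [measurable]: "S r \<in> borel_measurable (gauss_entries N)" for r
    unfolding S_def[abs_def] by (intro borel_measurable_sum borel_measurable_power borel_measurable_norm
        lin) auto
  have Y_meas [measurable]: "Y r \<in> borel_measurable (gauss_entries N)" for r unfolding Y_def[abs_def]
      by simp
  have S0: "S r x \<ge> 0" for r x by (simp add: S_def sum_nonneg)
  have Y0: "Y r x \<ge> 0" for r x using \<delta> S0 by (auto simp: Y_def coeff_sum_nonneg intro!:
      divide_nonneg_nonneg add_nonneg_nonneg mult_nonneg_nonneg)
  have pointwise: "ln (det_ratio d a N \<delta> z x) \<le> (\<Sum>r<N. 2 * sqrt (Y r x) * sing (nodes d a N r - z))"
      for x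
  proof -
    have "norm (fdet N (\<lambda>i j. toeplitz_entry d a z i j + of_real \<delta> * x (i, j))) \<le> (\<Prod>r<N. b r + Y r x)"
      using norm_fdet_toeplitz_le[OF N \<delta>, of d a z "\<lambda>i j. x (i, j)"]
      by (simp add: b_def Y_def S_def L2_set_def)
    also have "\<dots> = (\<Prod>r<N. b r * (1 + Y r x / b r))"
      by (intro prod.cong refl) (use b in \<open>force simp: field_simps\<close>)
    also have "\<dots> = D * (\<Prod>r<N. 1 + Y r x / b r)"
      by (simp add: prod.distrib D_def b_def prod_norm)
    finally have "det_ratio d a N \<delta> z x \<le> (\<Prod>r<N. 1 + Y r x / b r)"
      using D by (simp add: det_ratio_def D_def[symmetric] divide_le_eq mult.commute)
    then have "ln (det_ratio d a N \<delta> z x) \<le> (\<Sum>r<N. 2 * sqrt (Y r x / b r))"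
      by (intro ln_prod_le_sum) (auto simp: det_ratio_def Y0 b_def)
    also have "\<dots> = (\<Sum>r<N. 2 * sqrt (Y r x) * sing (nodes d a N r - z))"
      by (simp add: sing_def b_def real_sqrt_divide)
    finally show ?thesis .
  qed
  have EY: "(\<integral>\<^sup>+x. ennreal ((Y r x)\<^sup>2) \<partial>gauss_entries N) \<le> ennreal (\<tau>\<^sup>2)" for r
  proof -
    have "(Y r x)\<^sup>2 \<le> 2 * d * (coeff_sum d a)\<^sup>2 / N + (2 * \<delta>\<^sup>2 / N) * S r x" for x
    proof -
      have sq: "(p + q)\<^sup>2 \<le> 2 * p\<^sup>2 + 2 * q\<^sup>2" for p q :: real
        using zero_le_power2[of "p - q"] by (simp add: power2_eq_square algebra_simps)
      have "(Y r x)\<^sup>2 = (sqrt d * coeff_sum d a + \<delta> * sqrt (S r x))\<^sup>2 / N"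
        by (simp add: Y_def power_divide)
      also have "\<dots> \<le> (2 * (sqrt d * coeff_sum d a)\<^sup>2 + 2 * (\<delta> * sqrt (S r x))\<^sup>2) / N"
        by (intro divide_right_mono sq) simp
      also have "\<dots> = 2 * d * (coeff_sum d a)\<^sup>2 / N + (2 * \<delta>\<^sup>2 / N) * S r x"
        using S0 by (simp add: power_mult_distrib add_divide_distrib)
      finally show ?thesis .
    qed
    then have "(\<integral>\<^sup>+x. ennreal ((Y r x)\<^sup>2) \<partial>gauss_entries N)
        \<le> (\<integral>\<^sup>+x. ennreal (2 * d * (coeff_sum d a)\<^sup>2 / N) + ennreal (2 * \<delta>\<^sup>2 / N) * ennreal (S r x)
        \<partial>gauss_entries N)"
      using S0 by (intro nn_integral_mono) (auto simp: ennreal_mult[symmetric] ennreal_plus[symmetric]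
          simp del: ennreal_plus intro!: ennreal_leI)
    also have "\<dots> = ennreal (2 * d * (coeff_sum d a)\<^sup>2 / N) + ennreal (2 * \<delta>\<^sup>2 / N) * (\<integral>\<^sup>+x. ennreal (S r
        x) \<partial>gauss_entries N)"
      using emeasure_space_1 by (simp add: nn_integral_add nn_integral_cmult)
    also have "(\<integral>\<^sup>+x. ennreal (S r x) \<partial>gauss_entries N)
        = (\<integral>\<^sup>+x. (\<Sum>i<N. ennreal ((norm (\<Sum>j<N. x (i, j) * dft N j r))\<^sup>2)) \<partial>gauss_entries N)"
      by (intro nn_integral_cong) (simp add: S_def)
    also have "\<dots> = (\<Sum>i<N. \<integral>\<^sup>+x. ennreal ((norm (\<Sum>j<N. x (i, j) * dft N j r))\<^sup>2) \<partial>gauss_entries N)"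
      by (intro nn_integral_sum measurable_compose[OF _ measurable_ennreal] borel_measurable_power
          borel_measurable_norm lin) auto
    also have "\<dots> = of_nat N * (of_nat N * gauss_var)"
      by (simp add: nn_integral_dft_noise)
    also have "ennreal (2 * \<delta>\<^sup>2 / N) * (of_nat N * (of_nat N * gauss_var))
        = ennreal (2 * \<delta>\<^sup>2 / N * N * N) * gauss_var"
    proof -
      have "ennreal (2 * \<delta>\<^sup>2 / N * N * N) = ennreal (2 * \<delta>\<^sup>2 / N) * ennreal N * ennreal N"
        by (subst ennreal_mult, simp, simp, subst ennreal_mult) simp_all
      then show ?thesis by (simp only: ennreal_of_nat_eq_real_of_nat mult.assoc)
    qed
    also have "2 * \<delta>\<^sup>2 / N * N * N = 2 * N * \<delta>\<^sup>2" using N by simp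
    finally show ?thesis using \<tau>(2) unfolding of_nat_mult of_nat_numeral by (rule order_trans)
  qed
  have EsY: "(\<integral>\<^sup>+x. ennreal (sqrt (Y r x)) \<partial>gauss_entries N) \<le> ennreal (2 * sqrt \<tau>)" for r
  proof -
    have "(\<integral>\<^sup>+x. ennreal (sqrt (Y r x)) \<partial>gauss_entries N)
        \<le> (\<integral>\<^sup>+x. ennreal (sqrt \<tau>) + ennreal (sqrt \<tau> / \<tau>\<^sup>2) * ennreal ((Y r x)\<^sup>2) \<partial>gauss_entries N)"
      using sqrt_le_scaled[OF Y0 \<tau>(1)] \<tau>(1)
      by (intro nn_integral_mono) (auto simp: ennreal_mult[symmetric] ennreal_plus[symmetric]
          distrib_left simp del: ennreal_plus intro!: ennreal_leI)
    also have "\<dots> = ennreal (sqrt \<tau>) + ennreal (sqrt \<tau> / \<tau>\<^sup>2) * (\<integral>\<^sup>+x. ennreal ((Y r x)\<^sup>2) \<partial>gauss_entries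
        N)"
      using emeasure_space_1 by (simp add: nn_integral_add nn_integral_cmult)
    also have "\<dots> \<le> ennreal (sqrt \<tau>) + ennreal (sqrt \<tau> / \<tau>\<^sup>2) * ennreal (\<tau>\<^sup>2)"
      by (intro add_left_mono mult_left_mono EY) simp
    also have "\<dots> = ennreal (2 * sqrt \<tau>)"
      using \<tau>(1) by (simp add: ennreal_mult[symmetric] ennreal_plus[symmetric] del: ennreal_plus)
    finally show ?thesis .
  qed
  have "(\<integral>\<^sup>+x. ennreal (ln (det_ratio d a N \<delta> z x)) \<partial>gauss_entries N)
    \<le> (\<integral>\<^sup>+x. (\<Sum>r<N. ennreal (2 * sing (nodes d a N r - z)) * ennreal (sqrt (Y r x))) \<partial>gauss_entries N)"
  proof (intro nn_integral_mono)
    fix x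
    have "ennreal (ln (det_ratio d a N \<delta> z x))
        \<le> ennreal (\<Sum>r<N. 2 * sqrt (Y r x) * sing (nodes d a N r - z))"
      by (rule ennreal_leI[OF pointwise])
    also have "\<dots> = (\<Sum>r<N. ennreal (2 * sqrt (Y r x) * sing (nodes d a N r - z)))"
      using Y0 by (subst sum_ennreal) auto
    also have "\<dots> = (\<Sum>r<N. ennreal (2 * sing (nodes d a N r - z)) * ennreal (sqrt (Y r x)))"
      using Y0 by (intro sum.cong refl) (simp add: ennreal_mult[symmetric] mult_ac)
    finally show "ennreal (ln (det_ratio d a N \<delta> z x))
        \<le> (\<Sum>r<N. ennreal (2 * sing (nodes d a N r - z)) * ennreal (sqrt (Y r x)))" .
  qed
  also have "\<dots> = (\<Sum>r<N. ennreal (2 * sing (nodes d a N r - z)) * (\<integral>\<^sup>+x. ennreal (sqrt (Y r x))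
      \<partial>gauss_entries N))"
    by (subst nn_integral_sum) (auto simp: nn_integral_cmult)
  also have "\<dots> \<le> (\<Sum>r<N. ennreal (2 * sing (nodes d a N r - z)) * ennreal (2 * sqrt \<tau>))"
    by (intro sum_mono mult_left_mono EsY) simp
  also have "\<dots> = (\<Sum>r<N. ennreal (4 * sqrt \<tau>) * ennreal (sing (nodes d a N r - z)))"
    using \<tau>(1) by (intro sum.cong refl) (simp add: ennreal_mult[symmetric] mult_ac)
  also have "\<dots> = ennreal (4 * sqrt \<tau>) * (\<Sum>r<N. ennreal (sing (nodes d a N r - z)))"
    by (rule sum_distrib_left[symmetric])
  finally show ?thesis .
qed

lemma det_ratio_L1:
  assumes N: "N > 0" and \<delta>: "0 < \<delta>" "\<delta> \<le> 1" and z: "\<And>r. r < N \<Longrightarrow> nodes d a N r \<noteq> z"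
    and \<tau>: "\<tau> > 0" "ennreal (2 * d * (coeff_sum d a)\<^sup>2 / N) + ennreal (2 * N * \<delta>\<^sup>2) * gauss_var
        \<le> ennreal (\<tau>\<^sup>2)"
    and R: "norm z \<le> R"
  shows "(\<integral>\<^sup>+x. ennreal \<bar>ln (det_ratio d a N \<delta> z x)\<bar> \<partial>gauss_entries N) \<le>
     ennreal (8 * sqrt \<tau>) * (\<Sum>r<N. ennreal (sing (nodes d a N r - z))) +
     ennreal (d * (ln (1 + coeff_sum d a + R) - ln \<delta> + enn2real log_sing / 2))"
proof -
  interpret prob_space "gauss_entries N" by (rule prob_space_gauss_entries)
  define K where "K = 1 + coeff_sum d a + norm z"
  have K: "K \<ge> 1" using coeff_sum_nonneg[of d a] by (simp add: K_def)
  define \<rho> where "\<rho> = (\<delta> / K) ^ d"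
  have \<rho>: "0 < \<rho>" "\<rho> \<le> 1" using \<delta> K by (auto simp: \<rho>_def intro!: power_le_one)
  have ls: "of_nat d * log_sing = ennreal (d * enn2real log_sing)"
    using log_sing_finite by (simp add: ennreal_mult ennreal_of_nat_eq_real_of_nat less_top)
  have "(\<integral>\<^sup>+x. ennreal \<bar>ln (det_ratio d a N \<delta> z x)\<bar> \<partial>gauss_entries N)
    \<le> 2 * (ennreal (4 * sqrt \<tau>) * (\<Sum>r<N. ennreal (sing (nodes d a N r - z)))) + ennreal (ln (1 / \<rho>) + d
        * enn2real log_sing / 2)"
  proof (rule abs_ln_le_of_lower_bounds[OF _ _ \<rho>])
    show "ennreal (ln (1 + t * \<rho>\<^sup>2)) \<le> (\<integral>\<^sup>+x. ennreal (ln (1 + t * (det_ratio d a N \<delta> z x)\<^sup>2))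
        \<partial>gauss_entries N) + ennreal (d * enn2real log_sing)"
      if "t \<ge> 0" for t
      using det_ratio_lower[OF N \<delta> z that] unfolding \<rho>_def K_def ls by blast
    show "(\<integral>\<^sup>+x. ennreal (ln (det_ratio d a N \<delta> z x)) \<partial>gauss_entries N)
        \<le> ennreal (4 * sqrt \<tau>) * (\<Sum>r<N. ennreal (sing (nodes d a N r - z)))"
      by (rule det_ratio_upper[OF N _ z \<tau>]) (use \<delta> in auto)
  qed simp_all
  also have "2 * (ennreal (4 * sqrt \<tau>) * (\<Sum>r<N. ennreal (sing (nodes d a N r - z))))
      = ennreal (8 * sqrt \<tau>) * (\<Sum>r<N. ennreal (sing (nodes d a N r - z)))"
  proof -
    have "8 * sqrt \<tau> = 2 * (4 * sqrt \<tau>)" by simp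
    then have "ennreal (8 * sqrt \<tau>) = 2 * ennreal (4 * sqrt \<tau>)"
      using \<tau>(1) by (simp only:) (subst ennreal_mult, auto)
    then show ?thesis by (simp add: mult.assoc)
  qed
  also have "ln (1 / \<rho>) + d * enn2real log_sing / 2 = d * (ln K - ln \<delta> + enn2real log_sing / 2)"
    using \<delta> K by (simp add: \<rho>_def ln_div ln_realpow algebra_simps)
  also have "ennreal \<dots> \<le> ennreal (d * (ln (1 + coeff_sum d a + R) - ln \<delta> + enn2real log_sing / 2))"
  proof -
    have "ln K \<le> ln (1 + coeff_sum d a + R)" using K R by (subst ln_le_cancel_iff) (auto simp: K_def)
    then show ?thesis by (intro ennreal_leI mult_left_mono) auto
  qed
  finally show ?thesis by (simp add: add_left_mono)
qed

section \<open>Integration over the spectral parameter\<close>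

lemma norm_nodes_le: "norm (nodes d a N r) \<le> coeff_sum d a"
  unfolding nodes_def by (rule norm_symbol_le) simp

lemma nn_integral_sing_shift:
  assumes "norm p \<le> S"
  shows "(\<integral>\<^sup>+z. ennreal (sing (p - z)) * indicator (cball 0 R) z \<partial>lborel) \<le> sing_mass (R + S)"
proof -
  have "(\<integral>\<^sup>+z. ennreal (sing (p - z)) * indicator (cball 0 R) z \<partial>lborel)
      = (\<integral>\<^sup>+z. ennreal (sing (p - (p + z))) * indicator (cball 0 R) (p + z) \<partial>lborel)"
    by (rule nn_integral_lborel_shift[symmetric]) measurable
  also have "\<dots> \<le> sing_mass (R + S)"
    unfolding sing_mass_def
  proof (intro nn_integral_mono)
    fix z :: complex
    have "norm z \<le> R + S" if "norm (p + z) \<le> R"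
      using that assms norm_triangle_ineq4[of "p + z" p] by simp
    then show "ennreal (sing (p - (p + z))) * indicator (cball 0 R) (p + z)
        \<le> ennreal (sing z) * indicator (cball 0 (R + S)) z"
      by (auto simp: sing_def split: split_indicator)
  qed
  finally show ?thesis .
qed

lemma emeasure_cball_finite: "emeasure lborel (cball (0::complex) R) < \<infinity>"
  by (intro emeasure_bounded_finite) simp

lemma det_ratio_measurable_integral [measurable]:
  "(\<lambda>z. \<integral>\<^sup>+x. ennreal \<bar>ln (det_ratio d a N \<delta> z x)\<bar> \<partial>gauss_entries N) \<in> borel_measurable borel"
proof -
  interpret prob_space "gauss_entries N" by (rule prob_space_gauss_entries)
  have "(\<lambda>p. ennreal \<bar>ln (det_ratio d a N \<delta> (fst p) (snd p))\<bar>)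
      \<in> borel_measurable (borel \<Otimes>\<^sub>M gauss_entries N)"
    using det_ratio_measurable by measurable
  from borel_measurable_nn_integral_fst[OF this] show ?thesis by simp
qed

text \<open>The singularities of the previous bound at the nodes are integrable in \<open>z\<close>, uniformly in the
position of the nodes.\<close>

lemma det_ratio_spatial_L1:
  assumes N: "N > 0" and \<delta>: "0 < \<delta>" "\<delta> \<le> 1" and R: "R \<ge> 0"
    and \<tau>: "\<tau> > 0" "ennreal (2 * real d * (coeff_sum d a)\<^sup>2 / N) + ennreal (2 * real N * \<delta>\<^sup>2) *
        gauss_var \<le> ennreal (\<tau>\<^sup>2)"
  shows "(\<integral>\<^sup>+z. (\<integral>\<^sup>+x. ennreal \<bar>ln (det_ratio d a N \<delta> z x)\<bar> \<partial>gauss_entries N) * indicator (cball 0 R) z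
      \<partial>lborel) \<le>
     ennreal (8 * sqrt \<tau>) * (of_nat N * sing_mass (R + coeff_sum d a)) +
     ennreal (d * (ln (1 + coeff_sum d a + R) - ln \<delta> + enn2real log_sing / 2)) * emeasure lborel (cball
         (0::complex) R)"
proof -
  let ?c = "ennreal (d * (ln (1 + coeff_sum d a + R) - ln \<delta> + enn2real log_sing / 2))"
  have AE: "AE z in lborel. \<forall>r\<in>{..<N}. nodes d a N r \<noteq> z"
  proof (subst AE_finite_all)
    show "\<forall>r\<in>{..<N}. AE z in lborel. nodes d a N r \<noteq> z"
    proof
      fix r show "AE z in lborel. nodes d a N r \<noteq> z"
        using AE_lborel_singleton[of "nodes d a N r"] by (auto elim!: eventually_mono)
    qed
  qed simp
  have "(\<integral>\<^sup>+z. (\<integral>\<^sup>+x. ennreal \<bar>ln (det_ratio d a N \<delta> z x)\<bar> \<partial>gauss_entries N) * indicator (cball 0 R) z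
      \<partial>lborel)
    \<le> (\<integral>\<^sup>+z. ennreal (8 * sqrt \<tau>) * (\<Sum>r<N. ennreal (sing (nodes d a N r - z)) * indicator (cball 0 R) z)
        + ?c * indicator (cball 0 R) z \<partial>lborel)"
  proof (intro nn_integral_mono_AE, use AE in eventually_elim)
    fix z :: complex assume "\<forall>r\<in>{..<N}. nodes d a N r \<noteq> z"
    then have z: "\<And>r. r < N \<Longrightarrow> nodes d a N r \<noteq> z" by auto
    show "(\<integral>\<^sup>+x. ennreal \<bar>ln (det_ratio d a N \<delta> z x)\<bar> \<partial>gauss_entries N) * indicator (cball 0 R) z
      \<le> ennreal (8 * sqrt \<tau>) * (\<Sum>r<N. ennreal (sing (nodes d a N r - z)) * indicator (cball 0 R) z) + ?c
          * indicator (cball 0 R) z"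
    proof (cases "norm z \<le> R")
      case True
      then have ind: "indicator (cball 0 R) z = (1::ennreal)" by simp
      show ?thesis unfolding ind mult_1_right by (rule det_ratio_L1[OF N \<delta> z \<tau> True])
    qed simp
  qed
  also have "\<dots> = (\<integral>\<^sup>+z. ennreal (8 * sqrt \<tau>) * (\<Sum>r<N. ennreal (sing (nodes d a N r - z)) * indicator
      (cball 0 R) z) \<partial>lborel) + ?c * emeasure lborel (cball (0::complex) R)"
    by (subst nn_integral_add) (auto simp: nn_integral_cmult_indicator)
  also have "(\<integral>\<^sup>+z. ennreal (8 * sqrt \<tau>) * (\<Sum>r<N. ennreal (sing (nodes d a N r - z)) * indicator (cball
      0 R) z) \<partial>lborel)
     = ennreal (8 * sqrt \<tau>) * (\<Sum>r<N. \<integral>\<^sup>+z. ennreal (sing (nodes d a N r - z)) * indicator (cball 0 R) z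
         \<partial>lborel)"
    by (subst nn_integral_cmult, measurable, subst nn_integral_sum) auto
  also have "\<dots> \<le> ennreal (8 * sqrt \<tau>) * (\<Sum>r<N. sing_mass (R + coeff_sum d a))"
    by (intro mult_left_mono sum_mono nn_integral_sing_shift norm_nodes_le) simp
  finally show ?thesis by (simp add: add_right_mono)
qed

text \<open>The size \<open>\<tau>\<close> of the perturbation in \<open>det_ratio_upper\<close> for \<open>\<delta> = N^(-\<gamma>)\<close>; the summand \<open>1/N\<close> only makes
it positive.\<close>

definition noise_rate :: "nat \<Rightarrow> (nat \<Rightarrow> complex) \<Rightarrow> real \<Rightarrow> nat \<Rightarrow> real" where
  "noise_rate d a \<gamma> N = sqrt (2 * real d * (coeff_sum d a)\<^sup>2 / N + 2 * real N * (N powr - \<gamma>)\<^sup>2 *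
      enn2real gauss_var + 1 / N)"

definition error_rate :: "nat \<Rightarrow> (nat \<Rightarrow> complex) \<Rightarrow> real \<Rightarrow> real \<Rightarrow> nat \<Rightarrow> real" where
  "error_rate d a \<gamma> R N = 8 * sqrt (noise_rate d a \<gamma> N) * enn2real (sing_mass (R + coeff_sum d a)) +
     d * (ln (1 + coeff_sum d a + R) + \<gamma> * ln N + enn2real log_sing / 2) * measure lborel (cball
         (0::complex) R) / N"

lemma noise_rate_tendsto:
  assumes "\<gamma> > 1/2" shows "noise_rate d a \<gamma> \<longlonglongrightarrow> 0"
proof -
  have p: "(\<lambda>N. 2 * real N * (real N powr - \<gamma>)\<^sup>2) \<longlonglongrightarrow> 0"
  proof -
    have "(\<lambda>N. 2 * (real N powr (1 - 2 * \<gamma>))) \<longlonglongrightarrow> 2 * 0"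
      by (intro tendsto_mult tendsto_const tendsto_neg_powr filterlim_real_sequentially) (use assms in
          auto)
    moreover have "\<forall>\<^sub>F N in sequentially. 2 * (real N powr (1 - 2 * \<gamma>))
        = 2 * real N * (real N powr - \<gamma>)\<^sup>2"
      using eventually_gt_at_top[of 0]
    proof eventually_elim
      case (elim N)
      have "(real N powr - \<gamma>)\<^sup>2 = real N powr (- 2 * \<gamma>)"
        by (simp add: power2_eq_square powr_add[symmetric])
      moreover have "real N powr (1 - 2 * \<gamma>) = real N * real N powr (- 2 * \<gamma>)"
        using elim powr_add[of "real N" 1 "- 2 * \<gamma>"] by simp
      ultimately show ?case by simp
    qed
    ultimately show ?thesis using Lim_transform_eventually by fastforce
  qed
  have "(\<lambda>N. sqrt (2 * real d * (coeff_sum d a)\<^sup>2 / N + 2 * real N * (N powr - \<gamma>)\<^sup>2 * enn2real gauss_var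
      + 1 / N)) \<longlonglongrightarrow> sqrt (0 + 0 * enn2real gauss_var + 0)"
    by (intro tendsto_intros p lim_const_over_n lim_1_over_n)
  then show ?thesis by (simp add: noise_rate_def[abs_def])
qed

lemma error_rate_tendsto:
  assumes "\<gamma> > 1/2" shows "error_rate d a \<gamma> R \<longlonglongrightarrow> 0"
proof -
  have l: "(\<lambda>N. ln (real N) / real N) \<longlonglongrightarrow> 0" by real_asymp
  define A where "A = d * (ln (1 + coeff_sum d a + R) + enn2real log_sing / 2) * measure lborel (cball
      (0::complex) R)"
  define B where "B = d * \<gamma> * measure lborel (cball (0::complex) R)"
  have "(\<lambda>N. 8 * sqrt (noise_rate d a \<gamma> N) * enn2real (sing_mass (R + coeff_sum d a)) + (A / N + B * (ln
      (real N) / real N))) \<longlonglongrightarrow>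
     8 * sqrt 0 * enn2real (sing_mass (R + coeff_sum d a)) + (0 + B * 0)"
    by (intro tendsto_intros noise_rate_tendsto[OF assms] lim_const_over_n l)
  moreover have "error_rate d a \<gamma> R N = 8 * sqrt (noise_rate d a \<gamma> N) * enn2real (sing_mass (R +
      coeff_sum d a)) + (A / N + B * (ln (real N) / real N))" for N
    by (simp add: error_rate_def A_def B_def add_divide_distrib[symmetric] algebra_simps)
  ultimately show ?thesis by (simp add: error_rate_def[abs_def])
qed

lemma det_ratio_spatial_rate:
  assumes N: "N > 0" and \<gamma>: "\<gamma> > 1/2" and R: "R \<ge> 0"
  shows "(\<integral>\<^sup>+z. (\<integral>\<^sup>+x. ennreal \<bar>ln (det_ratio d a N (N powr - \<gamma>) z x)\<bar> \<partial>gauss_entries N) * indicator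
      (cball 0 R) z \<partial>lborel) \<le> ennreal (N * error_rate d a \<gamma> R N)"
proof -
  define \<delta> where "\<delta> = real N powr - \<gamma>"
  define \<tau> where "\<tau> = noise_rate d a \<gamma> N"
  have \<delta>: "0 < \<delta>" "\<delta> \<le> 1" using N \<gamma> by (auto simp: \<delta>_def powr_minus field_simps ge_one_powr_ge_zero)
  have arg: "2 * real d * (coeff_sum d a)\<^sup>2 / N + 2 * real N * \<delta>\<^sup>2 * enn2real gauss_var \<ge> 0" by simp
  have \<tau>: "\<tau> > 0" using N arg by (simp add: \<tau>_def noise_rate_def \<delta>_def[symmetric] add_nonneg_pos)
  have \<tau>2: "\<tau>\<^sup>2 = 2 * real d * (coeff_sum d a)\<^sup>2 / N + 2 * real N * \<delta>\<^sup>2 * enn2real gauss_var + 1 / N"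
    using arg by (simp add: \<tau>_def noise_rate_def \<delta>_def[symmetric])
  have "ennreal (2 * real d * (coeff_sum d a)\<^sup>2 / N) + ennreal (2 * real N * \<delta>\<^sup>2) * gauss_var
      = ennreal (2 * real d * (coeff_sum d a)\<^sup>2 / N) + ennreal (2 * real N * \<delta>\<^sup>2) * ennreal (enn2real
      gauss_var)"
    using gauss_var_finite by (simp add: less_top)
  also have "\<dots> = ennreal (2 * real d * (coeff_sum d a)\<^sup>2 / N + 2 * real N * \<delta>\<^sup>2 * enn2real gauss_var)"
    by (simp add: ennreal_mult[symmetric] ennreal_plus[symmetric] del: ennreal_plus)
  also have "\<dots> \<le> ennreal (\<tau>\<^sup>2)" unfolding \<tau>2 by (intro ennreal_leI) simp
  finally have le: "ennreal (2 * real d * (coeff_sum d a)\<^sup>2 / N) + ennreal (2 * real N * \<delta>\<^sup>2) *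
      gauss_var \<le> ennreal (\<tau>\<^sup>2)" .
  have ln\<delta>: "- ln \<delta> = \<gamma> * ln N" using N by (simp add: \<delta>_def ln_powr)
  define c where "c = d * (ln (1 + coeff_sum d a + R) + \<gamma> * ln N + enn2real log_sing / 2)"
  have c0: "c \<ge> 0" using N \<gamma> R coeff_sum_nonneg[of d a]
      by (auto simp: c_def intro!: mult_nonneg_nonneg add_nonneg_nonneg)
  have em: "emeasure lborel (cball (0::complex) R) = ennreal (measure lborel (cball (0::complex) R))"
    using emeasure_cball_finite by (intro emeasure_eq_ennreal_measure) (auto simp: less_top)
  have sm: "sing_mass (R + coeff_sum d a) = ennreal (enn2real (sing_mass (R + coeff_sum d a)))"
    using sing_mass_finite[of "R + coeff_sum d a"] by (simp add: less_top)
  have "(\<integral>\<^sup>+z. (\<integral>\<^sup>+x. ennreal \<bar>ln (det_ratio d a N \<delta> z x)\<bar> \<partial>gauss_entries N) * indicator (cball 0 R) z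
      \<partial>lborel) \<le>
     ennreal (8 * sqrt \<tau>) * (of_nat N * sing_mass (R + coeff_sum d a)) +
     ennreal (d * (ln (1 + coeff_sum d a + R) - ln \<delta> + enn2real log_sing / 2)) * emeasure lborel (cball
         (0::complex) R)"
    by (rule det_ratio_spatial_L1[OF N \<delta> R \<tau> le])
  also have "d * (ln (1 + coeff_sum d a + R) - ln \<delta> + enn2real log_sing / 2) = c"
    using ln\<delta> by (simp add: c_def)
  also have "ennreal (8 * sqrt \<tau>) * (of_nat N * sing_mass (R + coeff_sum d a)) + ennreal c * emeasure
      lborel (cball (0::complex) R)
    = ennreal (8 * sqrt \<tau> * (N * enn2real (sing_mass (R + coeff_sum d a))) + c * measure lborel (cball
        (0::complex) R))"
    unfolding em using \<tau> c0
    by (subst sm) (simp add: ennreal_mult ennreal_of_nat_eq_real_of_nat ennreal_plus)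
  also have "8 * sqrt \<tau> * (N * enn2real (sing_mass (R + coeff_sum d a))) + c * measure lborel (cball
      (0::complex) R) = N * error_rate d a \<gamma> R N"
    using N by (simp add: error_rate_def \<tau>_def c_def distrib_left)
  finally show ?thesis by (simp only: \<delta>_def)
qed


definition pot :: "(complex \<Rightarrow> real) \<Rightarrow> complex \<Rightarrow> real" where
  "pot h \<mu> = (\<integral>z. h z * ln (norm (z - \<mu>)) \<partial>lborel)"

lemma abs_ln_norm_le: "\<bar>ln (norm u)\<bar> \<le> norm u + 2 * sing u"
proof (cases "u = 0")
  case False
  show ?thesis
  proof (cases "norm u \<ge> 1")
    case True
    then have "\<bar>ln (norm u)\<bar> = ln (norm u)" by simp
    also have "\<dots> \<le> norm u" using True by (intro ln_bound) auto
    finally show ?thesis using sing_nonneg[of u] by linarith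
  next
    case 2: False
    then have "\<bar>ln (norm u)\<bar> = - ln (norm u)" using False by simp
    also have "\<dots> \<le> 2 * sing u" using False by (intro minus_ln_le_sing) auto
    finally show ?thesis using norm_ge_zero[of u] by linarith
  qed
qed simp

text \<open>A bound, uniform over \<open>norm \<mu> \<le> S\<close>, for the integral of \<open>|ln |z - \<mu>||\<close> over the disc of radius \<open>R\<close>.\<close>

definition log_mass :: "real \<Rightarrow> real \<Rightarrow> ennreal" where
  "log_mass R S = ennreal (R + S) * emeasure lborel (cball (0::complex) R) + 2 * sing_mass (R + S)"

lemma log_mass_finite: "log_mass R S < \<infinity>"
  unfolding log_mass_def using emeasure_cball_finite[of R] sing_mass_finite[of "R + S"]
  by (simp add: ennreal_mult_less_top)

lemma nn_integral_ln_norm_le: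
  fixes \<mu> :: complex
  assumes "norm \<mu> \<le> S"
  shows "(\<integral>\<^sup>+z. ennreal \<bar>ln (norm (z - \<mu>))\<bar> * indicator (cball 0 R) z \<partial>lborel) \<le> log_mass R S"
proof -
  have "(\<integral>\<^sup>+z. ennreal \<bar>ln (norm (z - \<mu>))\<bar> * indicator (cball 0 R) z \<partial>lborel)
    \<le> (\<integral>\<^sup>+z. ennreal (R + S) * indicator (cball 0 R) z + 2 * (ennreal (sing (\<mu> - z)) * indicator (cball
        0 R) z) \<partial>lborel)"
  proof (intro nn_integral_mono)
    fix z :: complex
    show "ennreal \<bar>ln (norm (z - \<mu>))\<bar> * indicator (cball 0 R) z
        \<le> ennreal (R + S) * indicator (cball 0 R) z + 2 * (ennreal (sing (\<mu> - z)) * indicator (cball 0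
        R) z)"
    proof (cases "norm z \<le> R")
      case True
      have "\<bar>ln (norm (z - \<mu>))\<bar> \<le> norm (z - \<mu>) + 2 * sing (z - \<mu>)" by (rule abs_ln_norm_le)
      also have "norm (z - \<mu>) \<le> R + S" using norm_triangle_ineq4[of z \<mu>] True assms by linarith
      also have "sing (z - \<mu>) = sing (\<mu> - z)" by (simp add: sing_def norm_minus_commute)
      finally have "ennreal \<bar>ln (norm (z - \<mu>))\<bar> \<le> ennreal ((R + S) + 2 * sing (\<mu> - z))"
        by (intro ennreal_leI) simp
      also have "\<dots> = ennreal (R + S) + 2 * ennreal (sing (\<mu> - z))"
        using True assms by (subst ennreal_plus) (auto simp: ennreal_mult intro: order_trans[OF
            norm_ge_zero] add_nonneg_nonneg)
      finally show ?thesis using True by simp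
    qed simp
  qed
  also have "\<dots> = ennreal (R + S) * emeasure lborel (cball (0::complex) R) + 2 * (\<integral>\<^sup>+z. ennreal (sing (\<mu>
      - z)) * indicator (cball 0 R) z \<partial>lborel)"
    by (subst nn_integral_add, measurable, subst nn_integral_cmult_indicator, simp, subst
        nn_integral_cmult) auto
  also have "\<dots> \<le> log_mass R S"
    unfolding log_mass_def by (intro add_left_mono mult_left_mono nn_integral_sing_shift assms) simp
  finally show ?thesis .
qed

definition test_density :: "real \<Rightarrow> real \<Rightarrow> (complex \<Rightarrow> real) \<Rightarrow> bool" where
  "test_density H R h \<longleftrightarrow> h \<in> borel_measurable borel \<and> H \<ge> 0 \<and> R \<ge> 0 \<and> (\<forall>z. \<bar>h z\<bar>
      \<le> H) \<and> (\<forall>z. norm z > R \<longrightarrow> h z = 0)"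

lemma test_density_bound: "test_density H R h \<Longrightarrow> ennreal \<bar>h z * y\<bar>
    \<le> ennreal H * (ennreal \<bar>y\<bar> * indicator (cball 0 R) z)"
  by (cases "norm z \<le> R") (auto simp: test_density_def abs_mult ennreal_mult[symmetric] intro!:
      ennreal_leI mult_right_mono)

lemma integrable_pot:
  assumes "test_density H R h"
  shows "integrable lborel (\<lambda>z. h z * ln (norm (z - \<mu>)))"
proof (rule integrableI_bounded)
  have [measurable]: "h \<in> borel_measurable borel" using assms by (simp add: test_density_def)
  show "(\<lambda>z. h z * ln (norm (z - \<mu>))) \<in> borel_measurable lborel" by simp
  have "(\<integral>\<^sup>+z. ennreal (norm (h z * ln (norm (z - \<mu>)))) \<partial>lborel)
      \<le> (\<integral>\<^sup>+z. ennreal H * (ennreal \<bar>ln (norm (z - \<mu>))\<bar> * indicator (cball 0 R) z) \<partial>lborel)"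
    using test_density_bound[OF assms] by (intro nn_integral_mono) simp
  also have "\<dots> = ennreal H * (\<integral>\<^sup>+z. ennreal \<bar>ln (norm (z - \<mu>))\<bar> * indicator (cball 0 R) z \<partial>lborel)"
    by (rule nn_integral_cmult) measurable
  also have "\<dots> \<le> ennreal H * log_mass R (norm \<mu>)"
    by (intro mult_left_mono nn_integral_ln_norm_le) auto
  also have "\<dots> < \<infinity>" using log_mass_finite by (simp add: ennreal_mult_less_top)
  finally show "(\<integral>\<^sup>+z. ennreal (norm (h z * ln (norm (z - \<mu>)))) \<partial>lborel) < \<infinity>" .
qed

text \<open>The sum of a potential over a multiset depends only on the modulus of the monic polynomial with
these roots. The exceptional \<open>z\<close>, at which \<open>ln 0 = 0\<close> breaks the additivity of the logarithm, form a
finite set.\<close>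

lemma pot_mset:
  assumes h: "test_density H R h"
  shows "integrable lborel (\<lambda>z. h z * ln (norm (\<Prod>\<mu>\<in>#m. z - \<mu>))) \<and> (\<Sum>\<mu>\<in>#m. pot h \<mu>)
      = (\<integral>z. h z * ln (norm (\<Prod>\<mu>\<in>#m. z - \<mu>)) \<partial>lborel)"
proof (induction m)
  case (add \<mu> m)
  have [measurable]: "h \<in> borel_measurable borel" using h by (simp add: test_density_def)
  have meas [measurable]: "(\<lambda>z. \<Prod>\<mu>\<in>#m. z - \<mu>) \<in> borel_measurable borel" for m :: "complex multiset"
    by (induction m) auto
  have AE: "AE z in lborel. \<forall>\<nu>\<in>set_mset (add_mset \<mu> m). z \<noteq> \<nu>"
    by (subst AE_finite_all) (auto intro: AE_lborel_singleton)
  have eq: "AE z in lborel. h z * ln (norm (z - \<mu>)) + h z * ln (norm (\<Prod>\<mu>\<in>#m. z - \<mu>))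
      = h z * ln (norm (\<Prod>\<mu>\<in>#add_mset \<mu> m. z - \<mu>))"
    using AE
  proof eventually_elim
    case (elim z)
    then have "(\<Prod>\<mu>\<in>#m. z - \<mu>) \<noteq> 0" by (auto simp: prod_mset_zero_iff)
    then show ?case using elim by (simp add: norm_mult ln_mult distrib_left)
  qed
  have i: "integrable lborel (\<lambda>z. h z * ln (norm (z - \<mu>)) + h z * ln (norm (\<Prod>\<mu>\<in>#m. z - \<mu>)))"
    using integrable_pot[OF h] add by auto
  have "integrable lborel (\<lambda>z. h z * ln (norm (\<Prod>\<mu>\<in>#add_mset \<mu> m. z - \<mu>)))"
    by (rule integrable_cong_AE_imp[OF i _ eq]) measurable
  moreover have "(\<Sum>\<mu>\<in>#add_mset \<mu> m. pot h \<mu>) = (\<integral>z. h z * ln (norm (z - \<mu>)) + h z * ln (norm (\<Prod>\<mu>\<in>#m. z -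
      \<mu>)) \<partial>lborel)"
    using integrable_pot[OF h] add by (simp add: pot_def)
  moreover have "\<dots> = (\<integral>z. h z * ln (norm (\<Prod>\<mu>\<in>#add_mset \<mu> m. z - \<mu>)) \<partial>lborel)"
    by (intro integral_cong_AE eq) measurable
  ultimately show ?case by simp
qed simp

section \<open>Approximation of test functions by logarithmic potentials\<close>

definition circle_avg :: "real \<Rightarrow> (complex \<Rightarrow> real) \<Rightarrow> complex \<Rightarrow> real" where
  "circle_avg r f z = (\<integral>u. f (z - of_real r * u) \<partial>uniform_unit_circle)"

lemma pair_sigma_finite_lborel_circle: "pair_sigma_finite (lborel :: complex measure)
    uniform_unit_circle"
proof -
  interpret S: prob_space uniform_unit_circle by (rule prob_space_uniform_unit_circle)
  show ?thesis ..
qed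

lemma integrable_lborel_circle:
  fixes g :: "complex \<times> complex \<Rightarrow> real"
  assumes g [measurable]: "g \<in> borel_measurable (borel \<Otimes>\<^sub>M borel)"
    and le: "\<And>u. norm u = 1 \<Longrightarrow> (\<integral>\<^sup>+z. ennreal \<bar>g (z, u)\<bar> \<partial>lborel) \<le> C" and C: "C < \<infinity>"
  shows "integrable (lborel \<Otimes>\<^sub>M uniform_unit_circle) g"
proof (rule integrableI_bounded)
  interpret S: prob_space uniform_unit_circle by (rule prob_space_uniform_unit_circle)
  interpret pair_sigma_finite "lborel :: complex measure" uniform_unit_circle
      by (rule pair_sigma_finite_lborel_circle)
  show "g \<in> borel_measurable (lborel \<Otimes>\<^sub>M uniform_unit_circle)" by measurable
  have "(\<integral>\<^sup>+p. ennreal (norm (g p)) \<partial>(lborel \<Otimes>\<^sub>M uniform_unit_circle))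
      = (\<integral>\<^sup>+u. \<integral>\<^sup>+z. ennreal (norm (g (z, u))) \<partial>lborel \<partial>uniform_unit_circle)"
    by (rule nn_integral_snd[symmetric]) measurable
  also have "\<dots> \<le> (\<integral>\<^sup>+u. C \<partial>uniform_unit_circle)"
    by (intro nn_integral_mono_AE) (use AE_uniform_unit_circle le in \<open>auto elim!: eventually_mono\<close>)
  also have "\<dots> = C" using S.emeasure_space_1 by simp
  finally show "(\<integral>\<^sup>+p. ennreal (norm (g p)) \<partial>(lborel \<Otimes>\<^sub>M uniform_unit_circle)) < \<infinity>" using C
      by (rule le_less_trans)
qed

lemma lborel_integral_shift:
  fixes f :: "'a::euclidean_space \<Rightarrow> real"
  assumes [measurable]: "f \<in> borel_measurable borel"
  shows "(\<integral>x. f (c + x) \<partial>lborel) = (\<integral>x. f x \<partial>lborel)"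
  by (subst (2) lborel_distr_plus[of c, symmetric], subst integral_distr) auto

lemma test_density_circle_avg:
  assumes f: "test_density H R f" and r: "r \<ge> 0"
  shows "test_density H (R + r) (circle_avg r f)"
proof -
  interpret S: prob_space uniform_unit_circle by (rule prob_space_uniform_unit_circle)
  have [measurable]: "f \<in> borel_measurable borel" and f0: "H \<ge> 0" "R \<ge> 0" "\<And>z. \<bar>f z\<bar>
      \<le> H" "\<And>z. norm z > R \<Longrightarrow> f z = 0"
    using f by (auto simp: test_density_def)
  have "circle_avg r f \<in> borel_measurable borel"
    unfolding circle_avg_def[abs_def] by measurable
  moreover have "\<bar>circle_avg r f z\<bar> \<le> H" for z
  proof -
    have "integrable uniform_unit_circle (\<lambda>u. f (z - of_real r * u))"
      by (intro S.integrable_const_bound[where B = H]) (use f0 in auto)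
    then have "\<bar>circle_avg r f z\<bar> \<le> (\<integral>u. \<bar>f (z - of_real r * u)\<bar> \<partial>uniform_unit_circle)"
      unfolding circle_avg_def by (intro integral_abs_bound)
    also have "\<dots> \<le> (\<integral>u. H \<partial>uniform_unit_circle)"
      by (intro integral_mono S.integrable_const_bound[where B = H]) (use f0 in auto)
    also have "\<dots> = H" using S.prob_space by simp
    finally show ?thesis .
  qed
  moreover have "circle_avg r f z = 0" if "norm z > R + r" for z
  proof -
    have "AE u in uniform_unit_circle. f (z - of_real r * u) = 0"
      using AE_uniform_unit_circle
    proof eventually_elim
      case (elim u)
      have "norm (z - of_real r * u) \<ge> norm z - norm (of_real r * u)" by (rule norm_triangle_ineq2)
      then have "norm (z - of_real r * u) > R" using elim that r by (simp add: norm_mult)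
      then show ?case by (rule f0(4))
    qed
    then show ?thesis unfolding circle_avg_def by (simp add: integral_eq_zero_AE)
  qed
  ultimately show ?thesis using f0 r by (auto simp: test_density_def)
qed

lemma AE_norm_neq: "AE w in lborel. norm (w - \<mu>) \<noteq> r" for \<mu> :: complex
proof -
  have "sphere \<mu> r \<in> null_sets lebesgue" using negligible_sphere[of \<mu> r]
      by (simp add: negligible_iff_null_sets)
  then have "sphere \<mu> r \<in> null_sets lborel" by (auto simp: null_sets_def)
  then show ?thesis by (rule AE_I') (auto simp: dist_norm norm_minus_commute)
qed

text \<open>Averaging the density over circles replaces the kernel \<open>ln |z - \<mu>|\<close> by its circle averages, by
Fubini and translation invariance of the Lebesgue measure.\<close>

lemma pot_circle_avg:
  assumes f: "test_density H R f" and r: "r > 0"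
  shows "integrable lborel (\<lambda>w. f w * ln (max (norm (w - \<mu>)) r))"
    and "pot (circle_avg r f) \<mu> = (\<integral>w. f w * ln (max (norm (w - \<mu>)) r) \<partial>lborel)"
proof -
  interpret S: prob_space uniform_unit_circle by (rule prob_space_uniform_unit_circle)
  interpret pair_sigma_finite "lborel :: complex measure" uniform_unit_circle
      by (rule pair_sigma_finite_lborel_circle)
  have fm [measurable]: "f \<in> borel_measurable borel" and f0: "H \<ge> 0" "R \<ge> 0" "\<And>z. \<bar>f z\<bar>
      \<le> H" "\<And>z. norm z > R \<Longrightarrow> f z = 0"
    using f by (auto simp: test_density_def)
  define g1 where "g1 = (\<lambda>(z, u). f (z - of_real r * u) * ln (norm (z - \<mu>)))"
  define g2 where "g2 = (\<lambda>(w, u). f w * ln (norm (w + of_real r * u - \<mu>)))"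
  have [measurable]: "g1 \<in> borel_measurable (borel \<Otimes>\<^sub>M borel)" "g2 \<in> borel_measurable (borel \<Otimes>\<^sub>M borel)"
    by (auto simp: g1_def g2_def)
  have shift: "g1 (of_real r * u + w, u) = g2 (w, u)" for w u by (simp add: g1_def g2_def add.commute)
  have b2: "(\<integral>\<^sup>+w. ennreal \<bar>g2 (w, u)\<bar> \<partial>lborel) \<le> ennreal H * log_mass R (norm \<mu> + r)" if "norm u = 1"
      for u
  proof -
    have "(\<integral>\<^sup>+w. ennreal \<bar>g2 (w, u)\<bar> \<partial>lborel)
        \<le> (\<integral>\<^sup>+w. ennreal H * (ennreal \<bar>ln (norm (w - (\<mu> - of_real r * u)))\<bar> * indicator (cball 0 R) w)
        \<partial>lborel)"
    proof (intro nn_integral_mono)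
      fix w
      have eq: "g2 (w, u) = f w * ln (norm (w - (\<mu> - of_real r * u)))"
          by (simp add: g2_def algebra_simps)
      show "ennreal \<bar>g2 (w, u)\<bar> \<le> ennreal H * (ennreal \<bar>ln (norm (w - (\<mu> - of_real r * u)))\<bar> * indicator
          (cball 0 R) w)"
        unfolding eq by (rule test_density_bound[OF f])
    qed
    also have "\<dots> = ennreal H * (\<integral>\<^sup>+w. ennreal \<bar>ln (norm (w - (\<mu> - of_real r * u)))\<bar> * indicator (cball 0
        R) w \<partial>lborel)"
      by (rule nn_integral_cmult) measurable
    also have "\<dots> \<le> ennreal H * log_mass R (norm \<mu> + r)"
      using norm_triangle_ineq4[of \<mu> "of_real r * u"] that r
      by (intro mult_left_mono nn_integral_ln_norm_le) (auto simp: norm_mult)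
    finally show ?thesis .
  qed
  have b1: "(\<integral>\<^sup>+z. ennreal \<bar>g1 (z, u)\<bar> \<partial>lborel) \<le> ennreal H * log_mass R (norm \<mu> + r)" if "norm u = 1"
      for u
  proof -
    have "(\<integral>\<^sup>+z. ennreal \<bar>g1 (z, u)\<bar> \<partial>lborel) = (\<integral>\<^sup>+w. ennreal \<bar>g1 (of_real r * u + w, u)\<bar> \<partial>lborel)"
      by (rule nn_integral_lborel_shift[symmetric]) measurable
    then show ?thesis using b2[OF that] by (simp add: shift)
  qed
  have fin: "ennreal H * log_mass R (norm \<mu> + r) < \<infinity>" using log_mass_finite
      by (simp add: ennreal_mult_less_top)
  have i1: "integrable (lborel \<Otimes>\<^sub>M uniform_unit_circle) g1"
      by (rule integrable_lborel_circle[OF _ b1 fin]) auto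
  have i2: "integrable (lborel \<Otimes>\<^sub>M uniform_unit_circle) g2"
      by (rule integrable_lborel_circle[OF _ b2 fin]) auto
  have inner: "AE w in lborel. (\<integral>u. g2 (w, u) \<partial>uniform_unit_circle) = f w * ln (max (norm (w - \<mu>)) r)"
    using AE_norm_neq[of \<mu> r]
  proof eventually_elim
    case (elim w)
    have "(\<integral>u. g2 (w, u) \<partial>uniform_unit_circle)
        = (\<integral>u. f w * ln (norm ((w - \<mu>) + of_real r * u)) \<partial>uniform_unit_circle)"
      by (simp add: g2_def algebra_simps)
    also have "\<dots> = f w * ln (max (norm (w - \<mu>)) r)"
      using circle_mean_ln_max[OF elim r] by simp
    finally show ?case .
  qed
  have i3: "integrable lborel (\<lambda>w. \<integral>u. g2 (w, u) \<partial>uniform_unit_circle)"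
    using integrable_fst[of "\<lambda>w u. g2 (w, u)"] i2 by simp
  show "integrable lborel (\<lambda>w. f w * ln (max (norm (w - \<mu>)) r))"
    by (rule integrable_cong_AE_imp[OF i3 _ inner]) measurable
  have "pot (circle_avg r f) \<mu> = (\<integral>z. \<integral>u. g1 (z, u) \<partial>uniform_unit_circle \<partial>lborel)"
    by (simp add: pot_def circle_avg_def g1_def)
  also have "\<dots> = (\<integral>u. \<integral>z. g1 (z, u) \<partial>lborel \<partial>uniform_unit_circle)"
    using Fubini_integral[of "\<lambda>z u. g1 (z, u)"] i1 by simp
  also have "\<dots> = (\<integral>u. \<integral>w. g2 (w, u) \<partial>lborel \<partial>uniform_unit_circle)"
  proof (rule Bochner_Integration.integral_cong[OF refl])
    fix u
    show "(\<integral>z. g1 (z, u) \<partial>lborel) = (\<integral>w. g2 (w, u) \<partial>lborel)"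
      using lborel_integral_shift[of "\<lambda>z. g1 (z, u)" "of_real r * u"] by (simp add: shift)
  qed
  also have "\<dots> = (\<integral>w. \<integral>u. g2 (w, u) \<partial>uniform_unit_circle \<partial>lborel)"
    using Fubini_integral[of "\<lambda>w u. g2 (w, u)"] i2 by simp
  also have "\<dots> = (\<integral>w. f w * ln (max (norm (w - \<mu>)) r) \<partial>lborel)"
    by (rule integral_cong_AE[OF _ _ inner]) measurable
  finally show "pot (circle_avg r f) \<mu> = (\<integral>w. f w * ln (max (norm (w - \<mu>)) r) \<partial>lborel)" .
qed

text \<open>The difference of two truncated logarithms is a radial bump supported in the disc of radius \<open>r\<close>.\<close>

definition ln_bump :: "real \<Rightarrow> complex \<Rightarrow> real" where
  "ln_bump r w = ln (max (norm w) r) - ln (max (norm w) (r / 2))"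

lemma ln_bump_nonneg: "r > 0 \<Longrightarrow> ln_bump r w \<ge> 0"
proof -
  assume r: "r > 0"
  have "max (norm w) (r / 2) \<le> max (norm w) r" using r by (intro max.mono) auto
  then have "ln (max (norm w) (r / 2)) \<le> ln (max (norm w) r)"
    using r by (subst ln_le_cancel_iff) (auto simp: less_max_iff_disj)
  then show ?thesis by (simp add: ln_bump_def)
qed

lemma ln_bump_eq_0: "r > 0 \<Longrightarrow> norm w \<ge> r \<Longrightarrow> ln_bump r w = 0"
  by (auto simp: ln_bump_def max_def)

lemma ln_bump_measurable [measurable]: "ln_bump r \<in> borel_measurable borel"
  unfolding ln_bump_def[abs_def] by simp

lemma ln_bump_le: "r > 0 \<Longrightarrow> ln_bump r w \<le> ln 2"
proof -
  assume r: "r > 0"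
  have "max (norm w) r \<le> 2 * max (norm w) (r / 2)"
    using r norm_ge_zero[of w] unfolding max_def by (smt (verit) field_sum_of_halves)
  then have "ln (max (norm w) r) \<le> ln (2 * max (norm w) (r / 2))" using r
      by (subst ln_le_cancel_iff) (auto simp: less_max_iff_disj)
  also have "\<dots> = ln 2 + ln (max (norm w) (r / 2))" using r
      by (subst ln_mult) (auto simp: less_max_iff_disj)
  finally show ?thesis by (simp add: ln_bump_def)
qed

lemma ln_bump_integral:
  assumes r: "r > 0"
  shows "integrable lborel (ln_bump r)" "(\<integral>w. ln_bump r w \<partial>lborel) > 0"
proof -
  have i: "integrable lborel (\<lambda>w. c * indicator (cball (0::complex) s) w)" for s c :: real
    using emeasure_cball_finite by (intro integrable_mult_right integrable_real_indicator) auto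
  show int: "integrable lborel (ln_bump r)"
  proof (rule Bochner_Integration.integrable_bound[OF i[of "ln 2" r]])
    show "AE w in lborel. norm (ln_bump r w) \<le> norm ((ln 2 :: real) * indicator (cball 0 r) w)"
    proof (rule AE_I2)
      fix w show "norm (ln_bump r w) \<le> norm ((ln 2 :: real) * indicator (cball 0 r) w)"
        using ln_bump_nonneg[OF r, of w] ln_bump_le[OF r, of w] ln_bump_eq_0[OF r, of w]
        by (cases "norm w \<le> r") auto
    qed
  qed simp
  have "0 < ln 2 * measure lborel (cball (0::complex) (r / 2))"
    using content_cball_pos[of "r / 2" "0::complex"] r by simp
  also have "\<dots> = (\<integral>w. ln 2 * indicator (cball (0::complex) (r / 2)) w \<partial>lborel)" by simp
  also have "\<dots> \<le> (\<integral>w. ln_bump r w \<partial>lborel)"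
  proof (intro integral_mono i int)
    fix w :: complex
    show "ln 2 * indicator (cball 0 (r / 2)) w \<le> ln_bump r w"
    proof (cases "norm w \<le> r / 2")
      case True
      then have "ln_bump r w = ln 2" using r by (simp add: ln_bump_def max_def ln_div)
      then show ?thesis by (simp split: split_indicator)
    next
      case False
      then show ?thesis using ln_bump_nonneg[OF r] by simp
    qed
  qed
  finally show "(\<integral>w. ln_bump r w \<partial>lborel) > 0" .
qed

text \<open>The normalised bump is an approximate identity, and the convolution of \<open>f\<close> with it is a logarithmic
potential by \<open>pot_circle_avg\<close>.\<close>

lemma uniform_approx_by_pot:
  assumes f: "test_density H R f" and cont: "continuous_on UNIV f" and \<epsilon>: "\<epsilon> > 0"
  shows "\<exists>h H' R'. test_density H' R' h \<and> (\<forall>\<mu>. \<bar>pot h \<mu> - f \<mu>\<bar> \<le> \<epsilon>)"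
proof -
  have fm [measurable]: "f \<in> borel_measurable borel" and f0: "H \<ge> 0" "R \<ge> 0" "\<And>z. \<bar>f z\<bar>
      \<le> H" "\<And>z. norm z > R \<Longrightarrow> f z = 0"
    using f by (auto simp: test_density_def)
  have "uniformly_continuous_on (cball 0 (R + 1)) f"
    by (intro compact_uniformly_continuous continuous_on_subset[OF cont]) auto
  then obtain s where s: "s > 0" "\<And>x y. x \<in> cball 0 (R + 1) \<Longrightarrow> y \<in> cball 0 (R + 1) \<Longrightarrow> dist y x < s
      \<Longrightarrow> dist (f y) (f x) < \<epsilon>"
    using \<epsilon> unfolding uniformly_continuous_on_def by metis
  define r where "r = min s 1"
  have r: "r > 0" "r \<le> s" "r \<le> 1" using s by (auto simp: r_def)
  have near: "\<bar>f (\<mu> + w) - f \<mu>\<bar> \<le> \<epsilon>" if w: "norm w < r" for \<mu> w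
  proof (cases "norm (\<mu> + w) > R \<and> norm \<mu> > R")
    case True
    then show ?thesis using f0(4) \<epsilon> by simp
  next
    case False
    have "norm (\<mu> + w) \<le> norm \<mu> + norm w" "norm \<mu> \<le> norm (\<mu> + w) + norm w"
      using norm_triangle_ineq[of \<mu> w] norm_triangle_ineq4[of "\<mu> + w" w] by auto
    then have "\<mu> + w \<in> cball 0 (R + 1)" "\<mu> \<in> cball 0 (R + 1)" using False w r by auto
    then have "dist (f (\<mu> + w)) (f \<mu>) < \<epsilon>" using w r by (intro s(2)) (auto simp: dist_norm)
    then show ?thesis by (simp add: dist_norm)
  qed
  define m where "m = (\<integral>w. ln_bump r w \<partial>lborel)"
  note bi = ln_bump_integral[OF r(1)]
  have m: "m > 0" using bi(2) by (simp add: m_def)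
  define h where "h z = (circle_avg r f z - circle_avg (r / 2) f z) / m" for z
  have d1: "test_density H (R + r) (circle_avg r f)"
      and d2: "test_density H (R + r / 2) (circle_avg (r / 2) f)"
    using r by (auto intro!: test_density_circle_avg f)
  have "test_density (2 * H / m) (R + r) h"
    unfolding test_density_def
  proof (intro conjI allI impI)
    have [measurable]: "circle_avg r f \<in> borel_measurable borel" "circle_avg (r / 2) f
        \<in> borel_measurable borel"
      using d1 d2 by (auto simp: test_density_def)
    show "h \<in> borel_measurable borel" unfolding h_def[abs_def] by simp
    show "\<bar>h z\<bar> \<le> 2 * H / m" for z
    proof -
      have "\<bar>circle_avg r f z\<bar> \<le> H" "\<bar>circle_avg (r / 2) f z\<bar> \<le> H" using d1 d2
          by (auto simp: test_density_def)
      then have "\<bar>circle_avg r f z - circle_avg (r / 2) f z\<bar> \<le> 2 * H" by linarith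
      then show ?thesis using m by (simp add: h_def divide_right_mono)
    qed
    show "h z = 0" if "norm z > R + r" for z
    proof -
      have "norm z > R + r / 2" using that r by linarith
      then show ?thesis using d1 d2 that by (simp add: test_density_def h_def)
    qed
  qed (use f0 r m in auto)
  moreover have "\<bar>pot h \<mu> - f \<mu>\<bar> \<le> \<epsilon>" for \<mu>
  proof -
    have "pot h \<mu> = (\<integral>z. (circle_avg r f z * ln (norm (z - \<mu>)) - circle_avg (r / 2) f z * ln (norm (z -
        \<mu>))) / m \<partial>lborel)"
      unfolding pot_def h_def by (intro Bochner_Integration.integral_cong refl) (simp add: field_simps)
    also have "\<dots> = (pot (circle_avg r f) \<mu> - pot (circle_avg (r / 2) f) \<mu>) / m"
      using integrable_pot[OF d1, of \<mu>] integrable_pot[OF d2, of \<mu>] by (simp add: pot_def)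
    also have "pot (circle_avg r f) \<mu> - pot (circle_avg (r / 2) f) \<mu>
        = (\<integral>w. f w * ln (max (norm (w - \<mu>)) r) - f w * ln (max (norm (w - \<mu>)) (r / 2)) \<partial>lborel)"
      using pot_circle_avg[OF f, of r \<mu>] pot_circle_avg[OF f, of "r / 2" \<mu>] r by simp
    also have "\<dots> = (\<integral>w. f w * ln_bump r (w - \<mu>) \<partial>lborel)"
      by (simp add: ln_bump_def right_diff_distrib)
    also have "\<dots> = (\<integral>w. f (\<mu> + w) * ln_bump r w \<partial>lborel)"
      using lborel_integral_shift[of "\<lambda>w. f w * ln_bump r (w - \<mu>)" \<mu>] by simp
    finally have p: "pot h \<mu> = (\<integral>w. f (\<mu> + w) * ln_bump r w \<partial>lborel) / m" .
    have int: "integrable lborel (\<lambda>w. f (\<mu> + w) * ln_bump r w)"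
    proof (rule Bochner_Integration.integrable_bound)
      show "integrable lborel (\<lambda>w. H * ln_bump r w)" using bi by simp
      show "AE w in lborel. norm (f (\<mu> + w) * ln_bump r w) \<le> norm (H * ln_bump r w)"
        using f0 by (intro AE_I2) (auto simp: abs_mult intro!: mult_right_mono)
    qed simp
    have "f \<mu> = (\<integral>w. f \<mu> * ln_bump r w \<partial>lborel) / m" using m by (simp add: m_def)
    then have "pot h \<mu> - f \<mu> = ((\<integral>w. f (\<mu> + w) * ln_bump r w \<partial>lborel) - (\<integral>w. f \<mu> * ln_bump r w \<partial>lborel))
        / m"
      using p by (simp add: diff_divide_distrib)
    also have "(\<integral>w. f (\<mu> + w) * ln_bump r w \<partial>lborel) - (\<integral>w. f \<mu> * ln_bump r w \<partial>lborel)
        = (\<integral>w. (f (\<mu> + w) - f \<mu>) * ln_bump r w \<partial>lborel)"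
      using int bi by (simp add: left_diff_distrib)
    finally have eq: "pot h \<mu> - f \<mu> = (\<integral>w. (f (\<mu> + w) - f \<mu>) * ln_bump r w \<partial>lborel) / m" .
    have "\<bar>\<integral>w. (f (\<mu> + w) - f \<mu>) * ln_bump r w \<partial>lborel\<bar>
        \<le> (\<integral>w. \<bar>(f (\<mu> + w) - f \<mu>) * ln_bump r w\<bar> \<partial>lborel)"
      by (rule integral_abs_bound)
    also have "\<dots> \<le> (\<integral>w. \<epsilon> * ln_bump r w \<partial>lborel)"
    proof (intro integral_mono)
      show "integrable lborel (\<lambda>w. \<bar>(f (\<mu> + w) - f \<mu>) * ln_bump r w\<bar>)"
        using int bi by (simp add: left_diff_distrib)
      show "\<bar>(f (\<mu> + w) - f \<mu>) * ln_bump r w\<bar> \<le> \<epsilon> * ln_bump r w" for w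
      proof (cases "norm w < r")
        case True
        then show ?thesis using near ln_bump_nonneg[OF r(1), of w]
            by (simp add: abs_mult mult_right_mono)
      next
        case False
        then show ?thesis using ln_bump_eq_0[OF r(1), of w] by simp
      qed
    qed (use bi in simp)
    also have "\<dots> = \<epsilon> * m" by (simp add: m_def)
    finally show ?thesis using m by (simp add: eq divide_le_eq)
  qed
  ultimately show ?thesis by blast
qed

section \<open>Eigenvalue statistics\<close>

lemma riemann_sum_tendsto:
  fixes F :: "real \<Rightarrow> real"
  assumes T: "T > 0" and cont: "continuous_on {0..T} F"
  shows "(\<lambda>N. T / real N * (\<Sum>r<N. F (T * real r / real N))) \<longlonglongrightarrow> integral {0..T} F"
proof (rule LIMSEQ_I)
  fix e :: real assume e: "e > 0"
  define \<epsilon> where "\<epsilon> = e / (2 * T)"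
  have \<epsilon>: "\<epsilon> > 0" using e T by (simp add: \<epsilon>_def)
  have "uniformly_continuous_on {0..T} F" using cont by (rule compact_uniformly_continuous) simp
  then obtain s where s: "s > 0" "\<And>x y. x \<in> {0..T} \<Longrightarrow> y \<in> {0..T} \<Longrightarrow> dist y x < s \<Longrightarrow> dist (F y) (F x) < \<epsilon>"
    using \<epsilon> unfolding uniformly_continuous_on_def by metis
  obtain N0 :: nat where N0: "T / s < N0" using reals_Archimedean2 by blast
  show "\<exists>N0. \<forall>N\<ge>N0. norm (T / real N * (\<Sum>r<N. F (T * real r / real N)) - integral {0..T} F) < e"
  proof (rule exI[of _ "Suc N0"], intro allI impI)
    fix N :: nat assume "Suc N0 \<le> N"
    then have N: "N > 0" "real N > T / s" using N0 by linarith+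
    then have small: "T / N < s" using s(1) T by (simp add: field_simps)
    \<comment> \<open>the endpoints of the \<open>N\<close> pieces\<close>
    define x where "x r = T * real r / N" for r :: nat
    have x_mono: "x r \<le> x (Suc r)" for r using T by (simp add: x_def divide_right_mono)
    have x_step: "x (Suc r) - x r = T / N" for r
        by (simp add: x_def diff_divide_distrib[symmetric] algebra_simps)
    have x0: "x r \<ge> 0" for r using T by (simp add: x_def)
    have xT: "x r \<le> T" if "r \<le> N" for r using T N that by (simp add: x_def field_simps)
    have int: "F integrable_on {a..b}" if "0 \<le> a" "b \<le> T" for a b
      by (rule integrable_continuous_interval, rule continuous_on_subset[OF cont]) (use that in auto)
    have split: "integral {0..x n} F = (\<Sum>r<n. integral {x r..x (Suc r)} F)" if "n \<le> N" for n
      using that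
    proof (induction n)
      case 0
      then show ?case by (simp add: x_def)
    next
      case (Suc n)
      have "integral {0..x n} F + integral {x n..x (Suc n)} F = integral {0..x (Suc n)} F"
        by (rule Henstock_Kurzweil_Integration.integral_combine) (use Suc.prems x0 x_mono xT[of "Suc n"]
            in \<open>auto intro!: int\<close>)
      then show ?case using Suc by simp
    qed
    have piece: "\<bar>T / N * F (x r) - integral {x r..x (Suc r)} F\<bar> \<le> \<epsilon> * (T / N)" if r: "r < N" for r
    proof -
      have sub: "x r \<ge> 0" "x (Suc r) \<le> T" using x0 xT[of "Suc r"] r by auto
      have c: "continuous_on {x r..x (Suc r)} F"
          by (rule continuous_on_subset[OF cont]) (use sub in auto)
      have "norm (integral {x r..x (Suc r)} (\<lambda>t. F (x r) - F t)) \<le> \<epsilon> * (x (Suc r) - x r)"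
      proof (rule integral_bound[OF x_mono])
        show "continuous_on {x r..x (Suc r)} (\<lambda>t. F (x r) - F t)" by (intro continuous_intros c)
        fix t assume t: "t \<in> {x r..x (Suc r)}"
        have "dist (F (x r)) (F t) < \<epsilon>"
          by (rule s(2)) (use t sub x_step[of r] x_mono[of r] small in \<open>auto simp: dist_real_def\<close>)
        then show "norm (F (x r) - F t) \<le> \<epsilon>" by (simp add: dist_real_def)
      qed
      moreover have "integral {x r..x (Suc r)} (\<lambda>t. F (x r) - F t)
          = T / N * F (x r) - integral {x r..x (Suc r)} F"
      proof -
        have "integral {x r..x (Suc r)} (\<lambda>t. F (x r) - F t)
            = integral {x r..x (Suc r)} (\<lambda>t. F (x r)) - integral {x r..x (Suc r)} F"
          by (rule Henstock_Kurzweil_Integration.integral_diff) (use sub in \<open>auto intro!: int\<close>)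
        then show ?thesis using x_step[of r] x_mono[of r] by (simp add: mult.commute)
      qed
      ultimately show ?thesis by (simp add: x_step)
    qed
    have "x N = T" using N by (simp add: x_def)
    then have "T / N * (\<Sum>r<N. F (x r)) - integral {0..T} F
        = (\<Sum>r<N. T / N * F (x r) - integral {x r..x (Suc r)} F)"
      using split[of N] by (simp add: sum_subtractf sum_distrib_left)
    also have "\<bar>\<dots>\<bar> \<le> (\<Sum>r<N. \<epsilon> * (T / N))"
      by (intro order_trans[OF sum_abs] sum_mono piece) simp
    also have "\<dots> = e / 2" using N T by (simp add: \<epsilon>_def)
    finally show "norm (T / real N * (\<Sum>r<N. F (T * real r / real N)) - integral {0..T} F) < e"
      using e by (simp add: x_def)
  qed
qed

lemma circle_riemann_sum:
  fixes g :: "complex \<Rightarrow> real"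
  assumes cont: "continuous_on UNIV g"
  shows "(\<lambda>N. (\<Sum>r<N. g (cis (2 * pi * real r / real N))) / N) \<longlonglongrightarrow> (\<integral>u. g u \<partial>uniform_unit_circle)"
proof -
  have [measurable]: "g \<in> borel_measurable borel" using cont by (rule borel_measurable_continuous_onI)
  have c: "continuous_on {0..2 * pi} (\<lambda>x. g (cis x))"
    by (intro continuous_on_compose2[OF cont] continuous_intros) auto
  have "(\<lambda>N. (2 * pi / real N * (\<Sum>r<N. g (cis (2 * pi * real r / real N)))) / (2 * pi))
      \<longlonglongrightarrow> integral {0..2 * pi} (\<lambda>x. g (cis x)) / (2 * pi)"
    by (rule tendsto_divide[OF riemann_sum_tendsto[OF _ c] tendsto_const]) auto
  moreover have "(2 * pi / real N * (\<Sum>r<N. g (cis (2 * pi * real r / real N)))) / (2 * pi)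
      = (\<Sum>r<N. g (cis (2 * pi * real r / real N))) / N" for N :: nat
    by simp
  moreover have "(\<integral>u. g u \<partial>uniform_unit_circle) = integral {0..2 * pi} (\<lambda>x. g (cis x)) / (2 * pi)"
    by (rule integral_uniform_unit_circle_continuous(1)) (auto intro: continuous_on_subset[OF cont])
  ultimately show ?thesis by simp
qed


definition eig_sum :: "complex mat \<Rightarrow> (complex \<Rightarrow> real) \<Rightarrow> real" where
  "eig_sum A f = (\<Sum>\<mu>\<in>#proots (char_poly A). f \<mu>)"

lemma size_eigenvalues: "(A :: complex mat) \<in> carrier_mat N N \<Longrightarrow> size (proots (char_poly A)) = N"
  using degree_monic_char_poly[of A N] size_proots_complex[of "char_poly A"] by auto

lemma sum_mset_set_mset: "(\<Sum>z\<in>#M. f z) = (\<Sum>z\<in>set_mset M. real (count M z) * (f z :: real))"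
proof (induction M)
  case (add x M)
  have "(\<Sum>z\<in>set_mset (add_mset x M). real (count (add_mset x M) z) * f z)
      = (\<Sum>z\<in>insert x (set_mset M). real (count M z) * f z + (if z = x then f z else 0))"
    by (intro sum.cong) (auto simp: algebra_simps)
  also have "\<dots> = (\<Sum>z\<in>insert x (set_mset M). real (count M z) * f z) + f x"
    by (simp add: sum.distrib)
  also have "(\<Sum>z\<in>insert x (set_mset M). real (count M z) * f z)
      = (\<Sum>z\<in>set_mset M. real (count M z) * f z)"
    by (rule sum.mono_neutral_right) (auto simp: not_in_iff)
  finally show ?case using add by simp
qed simp

lemma integral_empirical:
  fixes f :: "complex \<Rightarrow> real"
  assumes A: "A \<in> carrier_mat N N" and N: "N > 0" and [measurable]: "f \<in> borel_measurable borel"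
  shows "(\<integral>z. f z \<partial>empirical_eigenvalue_measure A) = eig_sum A f / N"
proof -
  define m where "m = proots (char_poly A)"
  have sz: "size m = N" using size_eigenvalues[OF A] by (simp add: m_def)
  then have ne: "m \<noteq> {#}" using N by auto
  have "(\<integral>z. f z \<partial>empirical_eigenvalue_measure A) = measure_pmf.expectation (pmf_of_multiset m) f"
    unfolding empirical_eigenvalue_measure_def m_def by (subst integral_distr) auto
  also have "\<dots> = (\<Sum>z\<in>set_mset m. f z * (real (count m z) / real N))"
    using ne sz by (subst integral_measure_pmf_real[where A = "set_mset m"]) auto
  also have "\<dots> = eig_sum A f / N"
    unfolding eig_sum_def m_def[symmetric] sum_mset_set_mset sum_divide_distrib by (intro sum.cong) auto
  finally show ?thesis .
qed

lemma sum_mset_diff_le: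
  fixes f g :: "'a \<Rightarrow> real"
  assumes "\<And>\<mu>. \<bar>f \<mu> - g \<mu>\<bar> \<le> (\<epsilon>::real)"
  shows "\<bar>(\<Sum>\<mu>\<in>#m. f \<mu>) - (\<Sum>\<mu>\<in>#m. g \<mu>)\<bar> \<le> real (size m) * \<epsilon>"
proof (induction m)
  case (add x m)
  then show ?case using assms[of x] by (simp add: algebra_simps)
qed simp

lemma eig_sum_diff_le:
  fixes f g :: "complex \<Rightarrow> real" and \<epsilon> :: real
  assumes "A \<in> carrier_mat N N" "\<And>\<mu>. \<bar>f \<mu> - g \<mu>\<bar> \<le> \<epsilon>"
  shows "\<bar>eig_sum A f - eig_sum A g\<bar> \<le> real N * \<epsilon>"
  using sum_mset_diff_le[of f g \<epsilon> "proots (char_poly A)"] assms(2) size_eigenvalues[OF assms(1)]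
      by (simp add: eig_sum_def)

definition noisy :: "nat \<Rightarrow> (nat \<Rightarrow> complex) \<Rightarrow> real \<Rightarrow> nat \<Rightarrow> complex mat \<Rightarrow> complex mat" where
  "noisy d a \<delta> N g = toeplitz_mat d a N + complex_of_real \<delta> \<cdot>\<^sub>m g"

lemma noisy_carrier: "g \<in> carrier_mat N N \<Longrightarrow> noisy d a \<delta> N g \<in> carrier_mat N N"
  by (simp add: noisy_def toeplitz_mat_def)

definition entries :: "nat \<Rightarrow> complex mat \<Rightarrow> nat \<times> nat \<Rightarrow> complex" where
  "entries N g = (\<lambda>p\<in>{..<N} \<times> {..<N}. g $$ p)"

text \<open>The eigenvalues enter only through the characteristic polynomial, hence through a determinant that
is an explicit polynomial in the entries.\<close>

lemma norm_char_poly_noisy: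
  assumes g: "g \<in> carrier_mat N N"
  shows "norm (\<Prod>\<mu>\<in>#proots (char_poly (noisy d a \<delta> N g)). z - \<mu>)
      = norm (fdet N (\<lambda>i j. toeplitz_entry d a z i j + of_real \<delta> * entries N g (i, j)))"
proof -
  let ?A = "noisy d a \<delta> N g"
  have A: "?A \<in> carrier_mat N N" using g by (rule noisy_carrier)
  have "poly (char_poly ?A) z = poly (Polynomial.smult (lead_coeff (char_poly ?A)) (\<Prod>x\<in>#proots
      (char_poly ?A). [:-x, 1:])) z"
    by (simp only: complex_poly_decompose_multiset)
  also have "\<dots> = (\<Prod>\<mu>\<in>#proots (char_poly ?A). z - \<mu>)"
    using degree_monic_char_poly[OF A] by (simp add: poly_prod_mset)
  finally have 1: "(\<Prod>\<mu>\<in>#proots (char_poly ?A). z - \<mu>) = det (- (char_matrix ?A z))"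
    by (simp add: char_poly_matrix[OF A])
  have "- (char_matrix ?A z) = mat N N (\<lambda>(i, j). (- 1) * (toeplitz_entry d a z i j + of_real \<delta> * entries
      N g (i, j)))"
    using g by (intro eq_matI) (auto simp: char_matrix_def noisy_def toeplitz_mat_eq toeplitz_entry_def
        entries_def)
  then have "det (- (char_matrix ?A z)) = fdet N (\<lambda>i j. (- 1) * (toeplitz_entry d a z i j + of_real \<delta> *
      entries N g (i, j)))"
    by (simp add: fdet_def)
  also have "\<dots> = (\<Prod>i<N. - 1) * fdet N (\<lambda>i j. toeplitz_entry d a z i j + of_real \<delta> * entries N g (i, j))"
    by (rule fdet_scale_rows)
  finally show ?thesis unfolding 1 by (simp add: norm_mult norm_power)
qed

lemma sum_nodes_eq: "(\<Sum>r<N. pot h (nodes d a N r))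
    = (\<Sum>\<mu>\<in>#image_mset (nodes d a N) (mset_set {..<N}). pot h \<mu>)"
  by (simp add: sum_unfold_sum_mset image_mset.compositionality o_def)

lemma norm_prod_nodes: "norm (\<Prod>\<mu>\<in>#image_mset (nodes d a N) (mset_set {..<N}). z - \<mu>)
    = norm (\<Prod>r<N. nodes d a N r - z)"
proof -
  have "(\<Prod>\<mu>\<in>#image_mset (nodes d a N) (mset_set {..<N}). z - \<mu>) = (\<Prod>r<N. z - nodes d a N r)"
    by (simp add: prod_unfold_prod_mset image_mset.compositionality o_def)
  then show ?thesis by (simp add: prod_norm[symmetric] norm_minus_commute)
qed

lemma eig_sum_pot_diff:
  assumes h: "test_density H R h" and g: "g \<in> carrier_mat N N"
  shows "ennreal \<bar>eig_sum (noisy d a \<delta> N g) (pot h) - (\<Sum>r<N. pot h (nodes d a N r))\<bar> \<le>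
     ennreal H * (\<integral>\<^sup>+z. ennreal \<bar>ln (det_ratio d a N \<delta> z (entries N g))\<bar> * indicator (cball 0 R) z
         \<partial>lborel)"
proof -
  define m1 where "m1 = proots (char_poly (noisy d a \<delta> N g))"
  define m2 where "m2 = image_mset (nodes d a N) (mset_set {..<N})"
  have [measurable]: "h \<in> borel_measurable borel" using h by (simp add: test_density_def)
  note p1 = pot_mset[OF h, of m1] and p2 = pot_mset[OF h, of m2]
  have AE: "AE z in lborel. \<forall>\<mu>\<in>set_mset (m1 + m2). z \<noteq> \<mu>"
    by (subst AE_finite_all) (auto intro: AE_lborel_singleton)
  define D where "D z = h z * ln (norm (\<Prod>\<mu>\<in>#m1. z - \<mu>)) - h z * ln (norm (\<Prod>\<mu>\<in>#m2. z - \<mu>))" for z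
  have Dint: "integrable lborel D" using p1 p2 unfolding D_def[abs_def] by auto
  have eq: "eig_sum (noisy d a \<delta> N g) (pot h) - (\<Sum>r<N. pot h (nodes d a N r)) = (\<integral>z. D z \<partial>lborel)"
    using p1 p2 unfolding eig_sum_def sum_nodes_eq m1_def[symmetric] m2_def[symmetric] D_def by simp
  have "ennreal \<bar>\<integral>z. D z \<partial>lborel\<bar> \<le> (\<integral>\<^sup>+z. ennreal \<bar>D z\<bar> \<partial>lborel)"
    using integral_norm_bound_ennreal[OF Dint] by simp
  also have "\<dots> \<le> (\<integral>\<^sup>+z. ennreal H * (ennreal \<bar>ln (det_ratio d a N \<delta> z (entries N g))\<bar> * indicator (cball
      0 R) z) \<partial>lborel)"
  proof (intro nn_integral_mono_AE, use AE in eventually_elim)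
    fix z assume z: "\<forall>\<mu>\<in>set_mset (m1 + m2). z \<noteq> \<mu>"
    then have nz: "(\<Prod>\<mu>\<in>#m1. z - \<mu>) \<noteq> 0" "(\<Prod>\<mu>\<in>#m2. z - \<mu>) \<noteq> 0" by (auto simp: prod_mset_zero_iff)
    have "D z = h z * ln (norm (\<Prod>\<mu>\<in>#m1. z - \<mu>) / norm (\<Prod>\<mu>\<in>#m2. z - \<mu>))"
      using nz by (simp add: D_def ln_div right_diff_distrib)
    also have "norm (\<Prod>\<mu>\<in>#m1. z - \<mu>) / norm (\<Prod>\<mu>\<in>#m2. z - \<mu>) = det_ratio d a N \<delta> z (entries N g)"
      unfolding m1_def m2_def norm_char_poly_noisy[OF g] norm_prod_nodes by (simp add: det_ratio_def)
    finally show "ennreal \<bar>D z\<bar> \<le> ennreal H * (ennreal \<bar>ln (det_ratio d a N \<delta> z (entries N g))\<bar> *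
        indicator (cball 0 R) z)"
      using test_density_bound[OF h] by simp
  qed
  also have "\<dots> = ennreal H * (\<integral>\<^sup>+z. ennreal \<bar>ln (det_ratio d a N \<delta> z (entries N g))\<bar> * indicator (cball
      0 R) z \<partial>lborel)"
  proof (rule nn_integral_cmult)
    have "entries N g \<in> space (gauss_entries N)" by (auto simp: entries_def gauss_entries_def space_PiM)
    then have "(\<lambda>z. det_ratio d a N \<delta> z (entries N g)) \<in> borel_measurable borel"
      using measurable_compose[OF measurable_Pair2' det_ratio_measurable, of "entries N g"] by simp
    then show "(\<lambda>z. ennreal \<bar>ln (det_ratio d a N \<delta> z (entries N g))\<bar> * indicator (cball 0 R) z)
        \<in> borel_measurable lborel"
      by measurable
  qed
  finally show ?thesis unfolding eq .
qed

lemma gaussian_matrix_entries: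
  assumes P: "prob_space P" and G: "gaussian_matrix P N G" and N: "N > 0"
  shows "(\<lambda>\<omega>. entries N (G \<omega>)) \<in> P \<rightarrow>\<^sub>M gauss_entries N"
    and "distr P (gauss_entries N) (\<lambda>\<omega>. entries N (G \<omega>)) = gauss_entries N"
proof -
  interpret prob_space P by (rule P)
  let ?I = "{..<N} \<times> {..<N}"
  have ind: "indep_vars (\<lambda>_. borel) (\<lambda>ij \<omega>. G \<omega> $$ ij) ?I"
    and std: "\<And>p. p \<in> ?I \<Longrightarrow> std_complex_gaussian P (\<lambda>\<omega>. G \<omega> $$ p)"
    using G by (auto simp: gaussian_matrix_def)
  have rv: "random_variable borel (\<lambda>\<omega>. G \<omega> $$ p)" if "p \<in> ?I" for p
    using std[OF that] by (simp add: std_complex_gaussian_def distributed_def measurable_lborel1)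
  have dis: "distr P borel (\<lambda>\<omega>. G \<omega> $$ p) = cgauss" if "p \<in> ?I" for p
  proof -
    have "distr P borel (\<lambda>\<omega>. G \<omega> $$ p) = distr P lborel (\<lambda>\<omega>. G \<omega> $$ p)" by (rule distr_cong) auto
    then show ?thesis using std[OF that] by (simp add: std_complex_gaussian_def distributed_def
        cgauss_def)
  qed
  have sets: "sets (\<Pi>\<^sub>M p\<in>?I. (borel :: complex measure)) = sets (gauss_entries N)"
    unfolding gauss_entries_def by (intro sets_PiM_cong) auto
  have "(\<lambda>\<omega>. \<lambda>p\<in>?I. G \<omega> $$ p) \<in> P \<rightarrow>\<^sub>M (\<Pi>\<^sub>M p\<in>?I. (borel :: complex measure))"
    by (intro measurable_restrict rv)
  then show m: "(\<lambda>\<omega>. entries N (G \<omega>)) \<in> P \<rightarrow>\<^sub>M gauss_entries N"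
    unfolding entries_def measurable_cong_sets[OF refl sets] .
  have "distr P (gauss_entries N) (\<lambda>\<omega>. entries N (G \<omega>))
      = distr P (\<Pi>\<^sub>M p\<in>?I. borel) (\<lambda>\<omega>. \<lambda>p\<in>?I. G \<omega> $$ p)"
    unfolding entries_def by (intro distr_cong) (simp_all add: sets)
  also have "\<dots> = (\<Pi>\<^sub>M p\<in>?I. distr P borel (\<lambda>\<omega>. G \<omega> $$ p))"
    by (rule iffD1[OF indep_vars_iff_distr_eq_PiM' ind]) (use N rv in auto)
  also have "\<dots> = gauss_entries N"
    unfolding gauss_entries_def by (intro PiM_cong dis) auto
  finally show "distr P (gauss_entries N) (\<lambda>\<omega>. entries N (G \<omega>)) = gauss_entries N" .
qed

lemma gaussian_matrix_carrier: "gaussian_matrix P N G \<Longrightarrow> \<omega> \<in> space P \<Longrightarrow> G \<omega> \<in> carrier_mat N N"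
  by (simp add: gaussian_matrix_def)

text \<open>Here the law of the entries is replaced by the product measure, and the integrals over noise and \<open>z\<close>
are interchanged.\<close>

lemma eig_sum_pot_expectation:
  assumes P: "prob_space P" and G: "gaussian_matrix P N G" and N: "N > 0" and \<gamma>: "\<gamma> > 1/2"
    and h: "test_density H R h"
  shows "(\<integral>\<^sup>+\<omega>. ennreal \<bar>eig_sum (noisy d a (N powr - \<gamma>) N (G \<omega>)) (pot h) - (\<Sum>r<N. pot h (nodes d a N
      r))\<bar> \<partial>P)
    \<le> ennreal (H * (N * error_rate d a \<gamma> R N))"
proof -
  note ent = gaussian_matrix_entries[OF P G N]
  interpret E: prob_space "gauss_entries N" by (rule prob_space_gauss_entries)
  interpret pair_sigma_finite "lborel :: complex measure" "gauss_entries N" ..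
  let ?\<delta> = "real N powr - \<gamma>"
  define F where "F x = (\<integral>\<^sup>+z. ennreal \<bar>ln (det_ratio d a N ?\<delta> z x)\<bar> * indicator (cball 0 R) z \<partial>lborel)"
      for x
  have dr [measurable]: "(\<lambda>p. det_ratio d a N ?\<delta> (fst p) (snd p))
      \<in> borel_measurable (lborel \<Otimes>\<^sub>M gauss_entries N)"
  proof -
    have "sets (lborel \<Otimes>\<^sub>M gauss_entries N) = sets ((borel :: complex measure) \<Otimes>\<^sub>M gauss_entries N)"
      by (intro sets_pair_measure_cong) simp_all
    from measurable_cong_sets[OF this refl] show ?thesis using det_ratio_measurable[of d a N ?\<delta>]
        by blast
  qed
  have mm: "(\<lambda>p. ennreal \<bar>ln (det_ratio d a N ?\<delta> (fst p) (snd p))\<bar> * indicator (cball 0 R) (fst p))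
      \<in> borel_measurable (lborel \<Otimes>\<^sub>M gauss_entries N)"
    by measurable
  have Fm [measurable]: "F \<in> borel_measurable (gauss_entries N)"
    unfolding F_def[abs_def]
    by (rule lborel.borel_measurable_nn_integral)
       (use measurable_compose[OF measurable_pair_swap' mm] in \<open>simp add: case_prod_beta\<close>)
  have H: "H \<ge> 0" and R: "R \<ge> 0" using h by (auto simp: test_density_def)
  have "(\<integral>\<^sup>+\<omega>. ennreal \<bar>eig_sum (noisy d a ?\<delta> N (G \<omega>)) (pot h) - (\<Sum>r<N. pot h (nodes d a N r))\<bar> \<partial>P)
    \<le> (\<integral>\<^sup>+\<omega>. ennreal H * F (entries N (G \<omega>)) \<partial>P)"
    unfolding F_def by (intro nn_integral_mono eig_sum_pot_diff[OF h] gaussian_matrix_carrier[OF G])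
  also have "\<dots> = (\<integral>\<^sup>+x. ennreal H * F x \<partial>distr P (gauss_entries N) (\<lambda>\<omega>. entries N (G \<omega>)))"
    by (rule nn_integral_distr[symmetric, OF ent(1)]) measurable
  also have "\<dots> = ennreal H * (\<integral>\<^sup>+x. F x \<partial>gauss_entries N)"
    unfolding ent(2) by (rule nn_integral_cmult) measurable
  also have "(\<integral>\<^sup>+x. F x \<partial>gauss_entries N) = (\<integral>\<^sup>+z. \<integral>\<^sup>+x. ennreal \<bar>ln (det_ratio d a N ?\<delta> z x)\<bar> *
      indicator (cball 0 R) z \<partial>gauss_entries N \<partial>lborel)"
    unfolding F_def using Fubini[OF mm] by simp
  also have "\<dots> = (\<integral>\<^sup>+z. (\<integral>\<^sup>+x. ennreal \<bar>ln (det_ratio d a N ?\<delta> z x)\<bar> \<partial>gauss_entries N) * indicator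
      (cball 0 R) z \<partial>lborel)"
    by (intro nn_integral_cong nn_integral_multc) measurable
  also have "ennreal H * \<dots> \<le> ennreal H * ennreal (N * error_rate d a \<gamma> R N)"
    by (intro mult_left_mono det_ratio_spatial_rate N \<gamma> R) simp
  also have "\<dots> = ennreal (H * (N * error_rate d a \<gamma> R N))"
    using H by (cases "N * error_rate d a \<gamma> R N
        \<ge> 0") (auto simp: ennreal_mult ennreal_neg mult_nonneg_nonpos)
  finally show ?thesis .
qed

text \<open>Measurability of eigenvalue statistics is obtained without choosing the eigenvalues measurably: the
sum of a potential over the eigenvalues is an integral of \<open>ln |det|\<close>, and other test functions
follow by pointwise limits.\<close>

lemma eig_sum_measurable_pot:
  assumes P: "prob_space P" and G: "gaussian_matrix P N G" and N: "N > 0" and h: "test_density H R h"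
  shows "(\<lambda>\<omega>. eig_sum (noisy d a \<delta> N (G \<omega>)) (pot h)) \<in> borel_measurable P"
proof -
  note ent = gaussian_matrix_entries[OF P G N]
  have [measurable]: "h \<in> borel_measurable borel" using h by (simp add: test_density_def)
  define K where "K x = (\<integral>z. h z * ln (norm (fdet N (\<lambda>i j. toeplitz_entry d a z i j + of_real \<delta> * x (i,
      j)))) \<partial>lborel)" for x :: "nat \<times> nat \<Rightarrow> complex"
  have [measurable]: "(\<lambda>p. fdet N (\<lambda>i j. toeplitz_entry d a (snd p) i j + of_real \<delta> * fst p (i, j)))
      \<in> borel_measurable (gauss_entries N \<Otimes>\<^sub>M lborel)"
  proof (rule fdet_measurable)
    fix i j assume ij: "i < N" "j < N"
    have "(\<lambda>x. x (i, j)) \<in> borel_measurable (gauss_entries N)"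
      unfolding gauss_entries_def using ij measurable_component_singleton[of "(i, j)" "{..<N} \<times> {..<N}"
          "\<lambda>_. cgauss"] by simp
    then show "(\<lambda>p. toeplitz_entry d a (snd p) i j + of_real \<delta> * fst p (i, j))
        \<in> borel_measurable (gauss_entries N \<Otimes>\<^sub>M lborel)"
      by (intro borel_measurable_add borel_measurable_times toeplitz_entry_measurable
          measurable_compose[OF measurable_fst]) auto
  qed
  have K: "K \<in> borel_measurable (gauss_entries N)"
    unfolding K_def[abs_def] by (rule lborel.borel_measurable_lebesgue_integral) (simp add:
        case_prod_beta)
  have "eig_sum (noisy d a \<delta> N (G \<omega>)) (pot h) = K (entries N (G \<omega>))" if "\<omega> \<in> space P" for \<omega>
    unfolding eig_sum_def K_def
    using pot_mset[OF h, of "proots (char_poly (noisy d a \<delta> N (G \<omega>)))"] norm_char_poly_noisy[OF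
        gaussian_matrix_carrier[OF G that], where d = d and a = a and \<delta> = \<delta>]
    by simp
  then show ?thesis
    using measurable_compose[OF ent(1) K] by (subst measurable_cong) auto
qed

section \<open>Weak convergence in probability\<close>

lemma eig_sum_measurable_test:
  assumes P: "prob_space P" and G: "gaussian_matrix P N G" and N: "N > 0"
    and f: "test_density H R f" and cont: "continuous_on UNIV f"
  shows "(\<lambda>\<omega>. eig_sum (noisy d a \<delta> N (G \<omega>)) f) \<in> borel_measurable P"
proof -
  have "\<forall>n::nat. \<exists>h H' R'. test_density H' R' h \<and> (\<forall>\<mu>. \<bar>pot h \<mu> - f \<mu>\<bar> \<le> 1 / real (Suc n))"
    by (intro allI uniform_approx_by_pot[OF f cont]) simp
  then obtain h H' R' where h: "\<And>n::nat. test_density (H' n) (R' n) (h n)"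
    and le: "\<And>n \<mu>. \<bar>pot (h n) \<mu> - f \<mu>\<bar> \<le> 1 / real (Suc n)" by metis
  show ?thesis
  proof (rule borel_measurable_LIMSEQ_real)
    show "(\<lambda>\<omega>. eig_sum (noisy d a \<delta> N (G \<omega>)) (pot (h n))) \<in> borel_measurable P" for n
      by (rule eig_sum_measurable_pot[OF P G N h])
    fix \<omega> assume "\<omega> \<in> space P"
    then have A: "noisy d a \<delta> N (G \<omega>) \<in> carrier_mat N N"
      by (intro noisy_carrier gaussian_matrix_carrier[OF G])
    have "(\<lambda>n. eig_sum (noisy d a \<delta> N (G \<omega>)) (pot (h n)) - eig_sum (noisy d a \<delta> N (G \<omega>)) f) \<longlonglongrightarrow> 0"
    proof (rule Lim_null_comparison)
      show "\<forall>\<^sub>F n in sequentially. norm (eig_sum (noisy d a \<delta> N (G \<omega>)) (pot (h n)) - eig_sum (noisy d a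
          \<delta> N (G \<omega>)) f) \<le> real N * (1 / real (Suc n))"
        using eig_sum_diff_le[OF A le] by simp
      show "(\<lambda>n. real N * (1 / real (Suc n))) \<longlonglongrightarrow> 0"
        using tendsto_mult[OF tendsto_const[of "real N"] LIMSEQ_inverse_real_of_nat]
            by (simp add: inverse_eq_divide)
    qed
    then show "(\<lambda>n. eig_sum (noisy d a \<delta> N (G \<omega>)) (pot (h n))) \<longlonglongrightarrow> eig_sum (noisy d a \<delta> N (G \<omega>)) f"
      by (simp add: LIM_zero_iff)
  qed
qed

definition cutoff :: "real \<Rightarrow> complex \<Rightarrow> real" where
  "cutoff K z = max 0 (min 1 (K + 1 - norm z))"

lemma cutoff_bounds: "0 \<le> cutoff K z" "cutoff K z \<le> 1"
  by (auto simp: cutoff_def)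

lemma cutoff_eq_1: "norm z \<le> K \<Longrightarrow> cutoff K z = 1"
  by (simp add: cutoff_def)

lemma cutoff_eq_0: "norm z > K + 1 \<Longrightarrow> cutoff K z = 0"
  by (simp add: cutoff_def)

lemma continuous_cutoff: "continuous_on UNIV (cutoff K)"
  unfolding cutoff_def[abs_def] by (intro continuous_intros)

lemma test_density_cutoff:
  assumes cont: "continuous_on UNIV f" and B: "\<And>z. \<bar>f z\<bar> \<le> B" and K: "K \<ge> 0"
  shows "test_density B (K + 1) (\<lambda>z. f z * cutoff K z)" "continuous_on UNIV (\<lambda>z. f z * cutoff K z)"
proof -
  show c: "continuous_on UNIV (\<lambda>z. f z * cutoff K z)"
      by (intro continuous_intros cont continuous_cutoff)
  have "B \<ge> 0" using B[of 0] by linarith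
  moreover have "\<bar>f z * cutoff K z\<bar> \<le> B" for z
  proof -
    have "\<bar>f z * cutoff K z\<bar> \<le> \<bar>f z\<bar> * 1"
      using cutoff_bounds[of K z] unfolding abs_mult by (intro mult_left_mono) auto
    then show ?thesis using B[of z] by linarith
  qed
  ultimately show "test_density B (K + 1) (\<lambda>z. f z * cutoff K z)"
    using K borel_measurable_continuous_onI[OF c] by (auto simp: test_density_def cutoff_eq_0)
qed

lemma eig_sum_measurable:
  assumes P: "prob_space P" and G: "gaussian_matrix P N G" and N: "N > 0"
    and cont: "continuous_on UNIV f" and B: "\<And>z. \<bar>f z\<bar> \<le> B"
  shows "(\<lambda>\<omega>. eig_sum (noisy d a \<delta> N (G \<omega>)) f) \<in> borel_measurable P"
proof (rule borel_measurable_LIMSEQ_real)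
  show "(\<lambda>\<omega>. eig_sum (noisy d a \<delta> N (G \<omega>)) (\<lambda>z. f z * cutoff (real n) z)) \<in> borel_measurable P" for n
    by (rule eig_sum_measurable_test[OF P G N test_density_cutoff[OF cont B]]) auto
  fix \<omega>
  have "(\<lambda>n. \<Sum>\<mu>\<in>#m. f \<mu> * cutoff (real n) \<mu>) \<longlonglongrightarrow> (\<Sum>\<mu>\<in>#m. f \<mu>)" for m
  proof (induction m)
    case (add \<mu> m)
    obtain n0 :: nat where "norm \<mu> \<le> n0" using real_arch_simple by blast
    then have "\<forall>\<^sub>F n in sequentially. f \<mu> * cutoff (real n) \<mu> = f \<mu>"
      by (intro eventually_sequentiallyI[of n0]) (simp add: cutoff_eq_1)
    then have "(\<lambda>n. f \<mu> * cutoff (real n) \<mu>) \<longlonglongrightarrow> f \<mu>" by (rule tendsto_eventually)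
    then show ?case using add by (simp add: tendsto_add)
  qed simp
  then show "(\<lambda>n. eig_sum (noisy d a \<delta> N (G \<omega>)) (\<lambda>z. f z * cutoff (real n) z))
      \<longlonglongrightarrow> eig_sum (noisy d a \<delta> N (G \<omega>)) f"
    by (simp add: eig_sum_def)
qed

lemma continuous_symbol: "continuous_on UNIV (symbol d a)"
  unfolding symbol_def[abs_def] by (intro continuous_intros)

text \<open>Replacing \<open>f\<close> by a potential costs \<open>e/8\<close> for the eigenvalues and for the nodes, the Riemann sum
another \<open>e/8\<close>; the remaining deviation is at least \<open>e/2\<close> and is controlled by the Markov inequality.\<close>

lemma test_statistic_tendsto:
  fixes P :: "nat \<Rightarrow> 'w measure"
  assumes \<gamma>: "\<gamma> > 1/2" and P: "\<And>N. prob_space (P N)" and G: "\<And>N. gaussian_matrix (P N) N (G N)"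
    and f: "test_density H R f" and cont: "continuous_on UNIV f" and e: "e > 0"
  shows "(\<lambda>N. measure (P N) {\<omega>\<in>space (P N). \<bar>eig_sum (noisy d a (real N powr - \<gamma>) N (G N \<omega>)) f / real N
      - (\<integral>u. f (symbol d a u) \<partial>uniform_unit_circle)\<bar> > e}) \<longlonglongrightarrow> 0"
proof -
  define x where "x = (\<integral>u. f (symbol d a u) \<partial>uniform_unit_circle)"
  define A where "A N \<omega> = noisy d a (real N powr - \<gamma>) N (G N \<omega>)" for N \<omega>
  obtain h H' R' where h: "test_density H' R' h" and le: "\<And>\<mu>. \<bar>pot h \<mu> - f \<mu>\<bar> \<le> e / 8"
    using uniform_approx_by_pot[OF f cont, of "e / 8"] e by auto
  define V where "V N \<omega> = eig_sum (A N \<omega>) (pot h) - (\<Sum>r<N. pot h (nodes d a N r))" for N \<omega>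
  define b where "b N = 2 * H' / e * error_rate d a \<gamma> R' N" for N
  have "(\<lambda>N. (\<Sum>r<N. f (symbol d a (cis (2 * pi * real r / real N)))) / N) \<longlonglongrightarrow> x"
    unfolding x_def by (intro circle_riemann_sum continuous_on_compose2[OF cont] continuous_symbol) auto
  then have riem: "\<forall>\<^sub>F N in sequentially. \<bar>(\<Sum>r<N. f (nodes d a N r)) / N - x\<bar> < e / 8"
    using e by (auto dest!: tendstoD[of _ _ _ "e / 8"] simp: dist_real_def nodes_def)
  have bound: "\<forall>\<^sub>F N in sequentially. norm (measure (P N) {\<omega>\<in>space (P N). \<bar>eig_sum (A N \<omega>) f / real N -
      x\<bar> > e}) \<le> \<bar>b N\<bar>"
    using riem eventually_gt_at_top[of 0]
  proof eventually_elim
    case (elim N)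
    then have N: "N > 0" by simp
    interpret prob_space "P N" by (rule P)
    have V_meas [measurable]: "V N \<in> borel_measurable (P N)"
      unfolding V_def[abs_def] A_def using eig_sum_measurable_pot[OF P G N h] by measurable
    define c where "c = 2 / (real N * e)"
    have c: "c > 0" using N e by (simp add: c_def)
    have sub: "{\<omega>\<in>space (P N). \<bar>eig_sum (A N \<omega>) f / real N - x\<bar> > e} \<subseteq> {\<omega>\<in>space (P N). 1
        \<le> ennreal c * ennreal \<bar>V N \<omega>\<bar>}"
    proof safe
      fix \<omega> assume \<omega>: "\<omega> \<in> space (P N)" and gt: "e < \<bar>eig_sum (A N \<omega>) f / real N - x\<bar>"
      have carr: "A N \<omega> \<in> carrier_mat N N" unfolding A_def
        by (intro noisy_carrier gaussian_matrix_carrier[OF G \<omega>])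
      have "\<bar>eig_sum (A N \<omega>) (pot h) - eig_sum (A N \<omega>) f\<bar> \<le> real N * (e / 8)"
        by (rule eig_sum_diff_le[OF carr le])
      then have 1: "\<bar>eig_sum (A N \<omega>) (pot h) / N - eig_sum (A N \<omega>) f / N\<bar> \<le> e / 8"
        using N by (simp add: diff_divide_distrib[symmetric] abs_divide divide_le_eq mult.commute)
      have "\<bar>(\<Sum>r<N. pot h (nodes d a N r)) - (\<Sum>r<N. f (nodes d a N r))\<bar> \<le> (\<Sum>r<N. e / 8)"
        unfolding sum_subtractf[symmetric] by (intro order_trans[OF sum_abs] sum_mono le)
      then have 2: "\<bar>(\<Sum>r<N. pot h (nodes d a N r)) / N - (\<Sum>r<N. f (nodes d a N r)) / N\<bar> \<le> e / 8"
        using N by (simp add: diff_divide_distrib[symmetric] abs_divide divide_le_eq mult.commute)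
      have "V N \<omega> / N = eig_sum (A N \<omega>) (pot h) / N - (\<Sum>r<N. pot h (nodes d a N r)) / N"
        by (simp add: V_def diff_divide_distrib)
      then have "e / 2 \<le> \<bar>V N \<omega> / N\<bar>" using 1 2 gt elim(1) e by linarith
      then have "e / 2 * N \<le> \<bar>V N \<omega>\<bar>" using N by (simp add: abs_divide le_divide_eq)
      then have "c * (e / 2 * N) \<le> c * \<bar>V N \<omega>\<bar>" using c by (intro mult_left_mono) auto
      then have "1 \<le> c * \<bar>V N \<omega>\<bar>" using N e by (simp add: c_def)
      then show "1 \<le> ennreal c * ennreal \<bar>V N \<omega>\<bar>" using c by (simp add: ennreal_mult[symmetric])
    qed
    have "emeasure (P N) {\<omega>\<in>space (P N). 1 \<le> ennreal c * ennreal \<bar>V N \<omega>\<bar>}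
        \<le> ennreal c * (\<integral>\<^sup>+\<omega>. ennreal \<bar>V N \<omega>\<bar> * indicator (space (P N)) \<omega> \<partial>P N)"
      by (rule nn_integral_Markov_inequality) measurable
    also have "(\<integral>\<^sup>+\<omega>. ennreal \<bar>V N \<omega>\<bar> * indicator (space (P N)) \<omega> \<partial>P N) = (\<integral>\<^sup>+\<omega>. ennreal \<bar>V N \<omega>\<bar> \<partial>P N)"
      by (intro nn_integral_cong) simp
    also have "\<dots> \<le> ennreal (H' * (N * error_rate d a \<gamma> R' N))"
      unfolding V_def A_def by (rule eig_sum_pot_expectation[OF P G N \<gamma> h])
    also have "ennreal c * ennreal (H' * (N * error_rate d a \<gamma> R' N))
        = ennreal (c * (H' * (N * error_rate d a \<gamma> R' N)))"
      using c by (subst ennreal_mult') auto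
    also have "c * (H' * (N * error_rate d a \<gamma> R' N)) = b N" using N e by (simp add: c_def b_def)
    finally have em: "emeasure (P N) {\<omega>\<in>space (P N). 1 \<le> ennreal c * ennreal \<bar>V N \<omega>\<bar>} \<le> ennreal (b N)"
      by (simp add: mult_left_mono)
    have "measure (P N) {\<omega>\<in>space (P N). \<bar>eig_sum (A N \<omega>) f / real N - x\<bar> > e}
        \<le> measure (P N) {\<omega>\<in>space (P N). 1 \<le> ennreal c * ennreal \<bar>V N \<omega>\<bar>}"
      by (rule finite_measure_mono[OF sub]) measurable
    also have "ennreal (measure (P N) {\<omega>\<in>space (P N). 1 \<le> ennreal c * ennreal \<bar>V N \<omega>\<bar>}) \<le> ennreal \<bar>b N\<bar>"
      using em unfolding emeasure_eq_measure by (rule order_trans) (simp add: ennreal_leI)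
    then have "measure (P N) {\<omega>\<in>space (P N). 1 \<le> ennreal c * ennreal \<bar>V N \<omega>\<bar>} \<le> \<bar>b N\<bar>" by simp
    finally show ?case by simp
  qed
  have "b \<longlonglongrightarrow> 2 * H' / e * 0"
    unfolding b_def[abs_def] by (intro tendsto_intros error_rate_tendsto \<gamma>)
  then have "(\<lambda>N. \<bar>b N\<bar>) \<longlonglongrightarrow> 0" by (simp add: tendsto_rabs_zero)
  with bound show ?thesis unfolding A_def x_def by (rule Lim_null_comparison)
qed

lemma mat_0_0: "g \<in> carrier_mat 0 0 \<Longrightarrow> g' \<in> carrier_mat 0 0 \<Longrightarrow> g = g'"
  by (rule eq_matI) auto

lemma symbol_circle_integral:
  assumes "\<And>z. norm z \<le> coeff_sum d a \<Longrightarrow> f z = (g z :: real)" and "f \<in> borel_measurable borel" "g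
      \<in> borel_measurable borel"
  shows "(\<integral>u. f (symbol d a u) \<partial>uniform_unit_circle) = (\<integral>u. g (symbol d a u) \<partial>uniform_unit_circle)"
proof (rule integral_cong_AE)
  have [measurable]: "symbol d a \<in> borel_measurable borel"
      by (rule borel_measurable_continuous_onI[OF continuous_symbol])
  note assms(2,3)[measurable]
  show "(\<lambda>u. f (symbol d a u)) \<in> borel_measurable uniform_unit_circle" by measurable
  show "(\<lambda>u. g (symbol d a u)) \<in> borel_measurable uniform_unit_circle" by measurable
  show "AE u in uniform_unit_circle. f (symbol d a u) = g (symbol d a u)"
    using AE_uniform_unit_circle by eventually_elim (intro assms(1) norm_symbol_le)
qed

text \<open>Tightness comes from the cutoff function itself: it equals 1 on all nodes, so the statistic of the
cutoff tends to 1, and the mass of the eigenvalues outside the disc, which bounds the error made by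
truncating \<open>f\<close>, tends to 0.\<close>

lemma bounded_statistic_tendsto:
  fixes P :: "nat \<Rightarrow> 'w measure"
  assumes \<gamma>: "\<gamma> > 1/2" and P: "\<And>N. prob_space (P N)" and G: "\<And>N. gaussian_matrix (P N) N (G N)"
    and cont: "continuous_on UNIV f" and B: "\<And>z. \<bar>f z\<bar> \<le> B" and e: "e > 0"
  shows "(\<lambda>N. measure (P N) {\<omega>\<in>space (P N). \<bar>eig_sum (noisy d a (real N powr - \<gamma>) N (G N \<omega>)) f / real N
      - (\<integral>u. f (symbol d a u) \<partial>uniform_unit_circle)\<bar> > e}) \<longlonglongrightarrow> 0"
proof -
  define K where "K = coeff_sum d a"
  have K: "K \<ge> 0" by (simp add: K_def coeff_sum_nonneg)
  have B0: "B \<ge> 0" using B[of 0] by linarith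
  define x where "x = (\<integral>u. f (symbol d a u) \<partial>uniform_unit_circle)"
  define A where "A N \<omega> = noisy d a (real N powr - \<gamma>) N (G N \<omega>)" for N \<omega>
  define g where "g z = f z * cutoff K z" for z
  define ct where "ct z = 1 * cutoff K z" for z
  have g: "test_density B (K + 1) g" "continuous_on UNIV g"
    unfolding g_def[abs_def] using test_density_cutoff[OF cont B K] by auto
  have ct: "test_density 1 (K + 1) ct" "continuous_on UNIV ct"
    unfolding ct_def[abs_def] using test_density_cutoff[OF continuous_on_const[of UNIV 1] _ K, of 1]
        by auto
  have fm: "f \<in> borel_measurable borel" and gm: "g \<in> borel_measurable borel" and ctm: "ct
      \<in> borel_measurable borel"
    using cont g(2) ct(2) by (auto intro: borel_measurable_continuous_onI)
  have xg: "(\<integral>u. g (symbol d a u) \<partial>uniform_unit_circle) = x"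
    unfolding x_def by (rule symbol_circle_integral[OF _ gm fm]) (simp add: g_def cutoff_eq_1 K_def)
  have "(\<integral>u. ct (symbol d a u) \<partial>uniform_unit_circle)
      = (\<integral>u. (\<lambda>_. 1) (symbol d a u) \<partial>uniform_unit_circle)"
    by (rule symbol_circle_integral[OF _ ctm borel_measurable_const]) (simp add: ct_def cutoff_eq_1
        K_def)
  also have "\<dots> = 1" using prob_space.prob_space[OF prob_space_uniform_unit_circle] by simp
  finally have xct: "(\<integral>u. ct (symbol d a u) \<partial>uniform_unit_circle) = 1" .
  define e2 where "e2 = e / (2 * (B + 1))"
  have e2: "e2 > 0" using e B0 by (simp add: e2_def)
  define S1 where "S1 N = {\<omega>\<in>space (P N). \<bar>eig_sum (A N \<omega>) g / real N - x\<bar> > e / 2}" for N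
  define S2 where "S2 N = {\<omega>\<in>space (P N). \<bar>eig_sum (A N \<omega>) ct / real N - 1\<bar> > e2}" for N
  have t1: "(\<lambda>N. measure (P N) (S1 N)) \<longlonglongrightarrow> 0"
    using test_statistic_tendsto[OF \<gamma> P G g, of "e / 2" d a] e unfolding S1_def A_def xg by simp
  have t2: "(\<lambda>N. measure (P N) (S2 N)) \<longlonglongrightarrow> 0"
    using test_statistic_tendsto[OF \<gamma> P G ct e2, of d a] unfolding S2_def A_def xct by simp
  have bound: "\<forall>\<^sub>F N in sequentially. norm (measure (P N) {\<omega>\<in>space (P N). \<bar>eig_sum (A N \<omega>) f / real N -
      x\<bar> > e}) \<le> measure (P N) (S1 N) + measure (P N) (S2 N)"
    using eventually_gt_at_top[of 0]
  proof eventually_elim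
    case (elim N)
    then have N: "N > 0" by simp
    interpret prob_space "P N" by (rule P)
    have [measurable]: "(\<lambda>\<omega>. eig_sum (A N \<omega>) g) \<in> borel_measurable (P N)" "(\<lambda>\<omega>. eig_sum (A N \<omega>) ct)
        \<in> borel_measurable (P N)"
      unfolding A_def by (rule eig_sum_measurable_test[OF P G N g] eig_sum_measurable_test[OF P G N
          ct])+
    have S [measurable]: "S1 N \<in> sets (P N)" "S2 N \<in> sets (P N)" unfolding S1_def S2_def by measurable
    have "{\<omega>\<in>space (P N). \<bar>eig_sum (A N \<omega>) f / real N - x\<bar> > e} \<subseteq> S1 N \<union> S2 N"
    proof (rule subsetI, rule ccontr)
      fix \<omega> assume \<omega>: "\<omega> \<in> {\<omega>\<in>space (P N). \<bar>eig_sum (A N \<omega>) f / real N - x\<bar> > e}"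
          and n: "\<omega> \<notin> S1 N \<union> S2 N"
      then have sp: "\<omega> \<in> space (P N)" by simp
      have carr: "A N \<omega> \<in> carrier_mat N N" unfolding A_def
        by (intro noisy_carrier gaussian_matrix_carrier[OF G sp])
      have s1: "\<bar>eig_sum (A N \<omega>) g / real N - x\<bar> \<le> e / 2" and s2: "\<bar>eig_sum (A N \<omega>) ct / real N - 1\<bar>
          \<le> e2"
        using n sp by (auto simp: S1_def S2_def not_less)
      have "\<bar>(\<Sum>\<mu>\<in>#m. f \<mu>) - (\<Sum>\<mu>\<in>#m. g \<mu>)\<bar> \<le> B * (real (size m) - (\<Sum>\<mu>\<in>#m. ct \<mu>))" for m
      proof (induction m)
        case (add \<mu> m)
        have "f \<mu> - g \<mu> = f \<mu> * (1 - ct \<mu>)" by (simp add: g_def ct_def algebra_simps)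
        then have "\<bar>f \<mu> - g \<mu>\<bar> \<le> B * (1 - ct \<mu>)"
          using B[of \<mu>] cutoff_bounds(2)[of K \<mu>] by (simp add: abs_mult ct_def mult_right_mono)
        then show ?case using add by (simp add: algebra_simps)
      qed simp
      from this[of "proots (char_poly (A N \<omega>))"]
      have "\<bar>eig_sum (A N \<omega>) f - eig_sum (A N \<omega>) g\<bar> \<le> B * (N - eig_sum (A N \<omega>) ct)"
        by (simp add: eig_sum_def size_eigenvalues[OF carr])
      then have "\<bar>eig_sum (A N \<omega>) f - eig_sum (A N \<omega>) g\<bar> / N \<le> B * (N - eig_sum (A N \<omega>) ct) / N"
        by (rule divide_right_mono) simp
      also have "\<dots> = B * (1 - eig_sum (A N \<omega>) ct / N)" using N by (simp add: field_simps)
      also have "\<dots> \<le> B * e2" using s2 B0 by (intro mult_left_mono) auto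
      also have "\<dots> \<le> (B + 1) * e2" using e2 by simp
      also have "\<dots> = e / 2" using B0 by (simp add: e2_def field_simps)
      finally have "\<bar>eig_sum (A N \<omega>) f / N - eig_sum (A N \<omega>) g / N\<bar> \<le> e / 2"
        using N by (simp add: diff_divide_distrib[symmetric] abs_divide)
      moreover have "e < \<bar>eig_sum (A N \<omega>) f / real N - x\<bar>" using \<omega> by simp
      ultimately show False using s1 by linarith
    qed
    then have "measure (P N) {\<omega>\<in>space (P N). \<bar>eig_sum (A N \<omega>) f / real N - x\<bar> > e}
        \<le> measure (P N) (S1 N \<union> S2 N)"
      by (intro finite_measure_mono) auto
    also have "\<dots> \<le> measure (P N) (S1 N) + measure (P N) (S2 N)"
      by (rule measure_Un_le) (rule S)+
    finally show ?case by simp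
  qed
  have "(\<lambda>N. measure (P N) (S1 N) + measure (P N) (S2 N)) \<longlonglongrightarrow> 0"
    using tendsto_add[OF t1 t2] by simp
  with bound show ?thesis unfolding A_def x_def by (rule Lim_null_comparison)
qed

theorem theorem1p2:
  fixes \<gamma> :: real and d :: nat and a :: "nat \<Rightarrow> complex"
    and P :: "nat \<Rightarrow> 'w measure" and G :: "nat \<Rightarrow> 'w \<Rightarrow> complex mat"
  assumes "\<gamma> > 1 / 2"
    and "\<And>N. prob_space (P N)"
    and "\<And>N. gaussian_matrix (P N) N (G N)"
  shows "weakly_tendsto_in_prob P
           (\<lambda>N \<omega>. empirical_eigenvalue_measure
                    (toeplitz_mat d a N + complex_of_real (real N powr - \<gamma>) \<cdot>\<^sub>m G N \<omega>))
           (distr uniform_unit_circle borel (\<lambda>u. \<Sum>i\<le>d. a i * u ^ i))"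
  unfolding weakly_tendsto_in_prob_def tendsto_in_prob_def noisy_def[symmetric]
proof (intro allI impI conjI)
  fix f :: "complex \<Rightarrow> real"
  assume f: "continuous_on UNIV f \<and> bounded (range f)"
  then obtain B where B: "\<And>z. \<bar>f z\<bar> \<le> B" by (auto simp: bounded_iff)
  have fm [measurable]: "f \<in> borel_measurable borel" using f
      by (intro borel_measurable_continuous_onI) simp
  have sm [measurable]: "symbol d a \<in> borel_measurable borel"
      by (rule borel_measurable_continuous_onI[OF continuous_symbol])
  have limit: "(\<integral>z. f z \<partial>distr uniform_unit_circle borel (\<lambda>u. \<Sum>i\<le>d. a i * u ^ i))
      = (\<integral>u. f (symbol d a u) \<partial>uniform_unit_circle)"
    unfolding symbol_def[symmetric] by (rule integral_distr) measurable
  have stat: "(\<integral>z. f z \<partial>empirical_eigenvalue_measure (noisy d a (real N powr - \<gamma>) N (G N \<omega>)))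
      = eig_sum (noisy d a (real N powr - \<gamma>) N (G N \<omega>)) f / N"
    if "N > 0" "\<omega> \<in> space (P N)" for N \<omega>
    using that by (intro integral_empirical noisy_carrier gaussian_matrix_carrier[OF assms(3)] fm)
  {
    fix N
    show "(\<lambda>\<omega>. \<integral>z. f z \<partial>empirical_eigenvalue_measure (noisy d a (real N powr - \<gamma>) N (G N \<omega>)))
        \<in> borel_measurable (P N)"
    proof (cases "N = 0")
      \<comment> \<open>the empirical measure of the empty matrix is arbitrary, but constant in \<open>\<omega>\<close>\<close>
      case True
      have eq: "(\<integral>z. f z \<partial>empirical_eigenvalue_measure (noisy d a (real N powr - \<gamma>) N (G N \<omega>)))
          = (\<integral>z. f z \<partial>empirical_eigenvalue_measure (toeplitz_mat d a 0))"
        if "\<omega> \<in> space (P N)" for \<omega>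
      proof -
        have "noisy d a (real N powr - \<gamma>) N (G N \<omega>) \<in> carrier_mat 0 0"
          using noisy_carrier[OF gaussian_matrix_carrier[OF assms(3) that]] True by simp
        then have "noisy d a (real N powr - \<gamma>) N (G N \<omega>) = toeplitz_mat d a 0"
          by (rule mat_0_0) (simp add: toeplitz_mat_def)
        then show ?thesis by simp
      qed
      have "(\<lambda>\<omega>. \<integral>z. f z \<partial>empirical_eigenvalue_measure (toeplitz_mat d a 0)) \<in> borel_measurable (P N)"
          by simp
      then show ?thesis by (subst measurable_cong[OF eq])
    next
      case False
      then have N: "N > 0" by simp
      have "(\<lambda>\<omega>. eig_sum (noisy d a (real N powr - \<gamma>) N (G N \<omega>)) f / N) \<in> borel_measurable (P N)"
        using eig_sum_measurable[OF assms(2) assms(3) N conjunct1[OF f] B] by simp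
      then show ?thesis by (subst measurable_cong[OF stat[OF N]])
    qed
  }
  fix e :: real assume e: "e > 0"
  have "\<forall>\<^sub>F N in sequentially. measure (P N) {\<omega>\<in>space (P N). \<bar>eig_sum (noisy d a (real N powr - \<gamma>) N (G
      N \<omega>)) f / real N - (\<integral>u. f (symbol d a u) \<partial>uniform_unit_circle)\<bar> > e}
     = measure (P N) {\<omega>\<in>space (P N). \<bar>(\<integral>z. f z \<partial>empirical_eigenvalue_measure (noisy d a (real N powr -
         \<gamma>) N (G N \<omega>))) - (\<integral>z. f z \<partial>distr uniform_unit_circle borel (\<lambda>u. \<Sum>i\<le>d. a i * u ^ i))\<bar> > e}"
    using eventually_gt_at_top[of 0]
    by eventually_elim (intro arg_cong2[where f
        = measure] refl Collect_cong conj_cong, auto simp: stat limit)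
  from Lim_transform_eventually[OF bounded_statistic_tendsto[OF assms conjunct1[OF f] B e, of d a] this]
  show "(\<lambda>N. measure (P N) {\<omega>\<in>space (P N). \<bar>(\<integral>z. f z \<partial>empirical_eigenvalue_measure (noisy d a (real N
      powr - \<gamma>) N (G N \<omega>))) - (\<integral>z. f z \<partial>distr uniform_unit_circle borel (\<lambda>u. \<Sum>i\<le>d. a i * u ^ i))\<bar> > e})
      \<longlonglongrightarrow> 0" .
qed

end
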